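(* Let $G\hookrightarrow P\overset{\pi}{\rightarrow}B$ be a principal bundle with $G$ and $P$ compact and connected and $P$, $B$ oriented, let $h^P$ be a $G$-invariant Riemannian metric on $P$ with induced volume form $\mu^P$, let $h^B$ be the metric on $B$ making $\pi:(P,h^P)\to(B,h^B)$ a Riemannian submersion, with induced volume form $\mu^B$, and let $V\in C^\infty(B,\mathbb{R}_{>0})$ be the function defined in the context. For every $f\in C^\infty(B,\mathbb{R})$, $$\int_P (f\circ\pi)\,\mu^P=\int_B f\,V\mu^B.$$
   Context: $\vartheta:P\times G\to P$ is the right action; for $x\in P$, $\vartheta_x:G\to\mathcal{O}_x$, $g\mapsto\vartheta(x,g)$, is the orbit map (a diffeomorphism onto the orbit $\mathcal{O}_x$). $\theta\in\Omega^1(P,\mathfrak{g})$ is the connection form $\theta_x(X_x)=(\vartheta_x^{-1})_{*_x}X_x^v$, where $X_x^v$ is the $h^P$-orthogonal projection of $X_x$ on $T_x\mathcal{O}_x$. $h^{\mathfrak{g}}$ is the Euclidean structure on the trivial bundle $P\times\mathfrak{g}$ with $h^P=\pi^*h^B+h^{\mathfrak{g}}(\theta,\theta)$. Orientations: $(T_x\mathcal{O}_x)^\perp$ is oriented by the isomorphism $\pi_{*_x}$ onto $T_{\pi(x)}B$; $T_x\mathcal{O}_x$ is oriented so that a positive basis of $(T_x\mathcal{O}_x)^\perp$ followed by a positive basis of $T_x\mathcal{O}_x$ is a positive basis of $T_xP$; $\mathfrak{g}$ (hence $G$) is oriented via $\theta_x|_{T_x\mathcal{O}_x}$, independently of $x$.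 Let $\mu^{\mathfrak{g}}_x$ be the volume form on $\mathfrak{g}$ of $h^{\mathfrak{g}}_x$ and $\nu^G$ the bi-invariant volume form on $G$ with $\int_G\nu^G=1$. The function $V$ is defined by $V(\pi(x))\,\nu^G_e=\mu_x^{\mathfrak{g}}$ for all $x\in P$; equivalently $V(\pi(x))$ is the Riemannian volume of $\mathcal{O}_x$ for the metric induced by $h^P$. *)

theory Defs
  imports "HOL-Analysis.Analysis" "HOL-Algebra.Group"
begin

section \<open>Smooth manifolds\<close>

text \<open>For functions on an open subset of a finite-dimensional space this is the usual class
  \<open>C\<^sup>k\<close>: all iterated directional derivatives up to order \<open>k\<close> exist and are continuous.\<close>

primrec Ck_on :: "nat \<Rightarrow> ('a::real_normed_vector \<Rightarrow> 'b::real_normed_vector) \<Rightarrow> 'a set \<Rightarrow> bool" where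
  "Ck_on 0 f S \<longleftrightarrow> continuous_on S f"
| "Ck_on (Suc k) f S \<longleftrightarrow> (\<forall>x\<in>S. f differentiable (at x)) \<and>
     (\<forall>v. Ck_on k (\<lambda>x. frechet_derivative f (at x) v) S)"

definition smooth_on :: "('a::real_normed_vector \<Rightarrow> 'b::real_normed_vector) \<Rightarrow> 'a set \<Rightarrow> bool" where
  "smooth_on f S \<longleftrightarrow> (\<forall>k. Ck_on k f S)"

text \<open>A chart is a pair (domain, coordinate map). The model space \<open>'e\<close> is a finite-dimensional
  normed space (see \<open>smooth_manifold\<close>); unlike with the class \<open>euclidean_space\<close>, dimension 0 is
  allowed.\<close>

type_synonym ('a, 'e) chart = "'a set \<times> ('a \<Rightarrow> 'e)"

record ('a, 'e) manifold =
  mtop :: "'a topology"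
  atlas :: "('a, 'e) chart set"

abbreviation points :: "('a, 'e) manifold \<Rightarrow> 'a set" where
  "points M \<equiv> topspace (mtop M)"

definition chart_inv :: "('a, 'e) chart \<Rightarrow> 'e \<Rightarrow> 'a" where
  "chart_inv c = inv_into (fst c) (snd c)"

definition smooth_manifold :: "('a, 'e::real_normed_vector) manifold \<Rightarrow> bool" where
  "smooth_manifold M \<longleftrightarrow>
     (\<exists>S :: 'e set. finite S \<and> span S = UNIV) \<and>
     Hausdorff_space (mtop M) \<and>
     (\<exists>\<B>. countable \<B> \<and> (\<forall>W\<in>\<B>. openin (mtop M) W) \<and>
        (\<forall>U. \<forall>x\<in>U. openin (mtop M) U \<longrightarrow> (\<exists>W\<in>\<B>. x \<in> W \<and> W \<subseteq> U))) \<and>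
     points M = (\<Union>c\<in>atlas M. fst c) \<and>
     (\<forall>c\<in>atlas M. openin (mtop M) (fst c) \<and> open (snd c ` fst c) \<and>
        homeomorphic_map (subtopology (mtop M) (fst c)) (top_of_set (snd c ` fst c)) (snd c)) \<and>
     (\<forall>c\<in>atlas M. \<forall>d\<in>atlas M. smooth_on (snd d \<circ> chart_inv c) (snd c ` (fst c \<inter> fst d)))"

definition model_manifold :: "('e::real_normed_vector, 'e) manifold" where
  "model_manifold = \<lparr>mtop = euclidean, atlas = {(UNIV, id)}\<rparr>"

definition prod_manifold ::
    "('a, 'e) manifold \<Rightarrow> ('b, 'f) manifold \<Rightarrow> ('a \<times> 'b, 'e \<times> 'f) manifold" where
  "prod_manifold M N = \<lparr>mtop = prod_topology (mtop M) (mtop N),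
     atlas = {(fst c \<times> fst d, map_prod (snd c) (snd d)) |c d. c \<in> atlas M \<and> d \<in> atlas N}\<rparr>"

definition open_submanifold :: "('a, 'e) manifold \<Rightarrow> 'a set \<Rightarrow> ('a, 'e) manifold" where
  "open_submanifold M W = \<lparr>mtop = subtopology (mtop M) W,
     atlas = {(fst c \<inter> W, snd c) |c. c \<in> atlas M}\<rparr>"

definition smooth_map ::
    "('a, 'e::real_normed_vector) manifold \<Rightarrow> ('b, 'f::real_normed_vector) manifold \<Rightarrow>
     ('a \<Rightarrow> 'b) \<Rightarrow> bool" where
  "smooth_map M N f \<longleftrightarrow> continuous_map (mtop M) (mtop N) f \<and>
     (\<forall>c\<in>atlas M. \<forall>d\<in>atlas N.
        smooth_on (snd d \<circ> f \<circ> chart_inv c) (snd c ` (fst c \<inter> f -` fst d)))"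

definition diffeomorphism ::
    "('a, 'e::real_normed_vector) manifold \<Rightarrow> ('b, 'f::real_normed_vector) manifold \<Rightarrow>
     ('a \<Rightarrow> 'b) \<Rightarrow> bool" where
  "diffeomorphism M N f \<longleftrightarrow> bij_betw f (points M) (points N) \<and>
     smooth_map M N f \<and> smooth_map N M (inv_into (points M) f)"

abbreviation smooth_function :: "('a, 'e::real_normed_vector) manifold \<Rightarrow> ('a \<Rightarrow> real) \<Rightarrow> bool" where
  "smooth_function M f \<equiv> smooth_map M model_manifold f"

text \<open>The tangent space at \<open>x\<close> is the model space \<open>'e\<close>: a tangent vector is represented by its
  coordinates in the preferred chart \<open>chart_at M x\<close>. The vector with coordinates \<open>v\<close> in another
  chart \<open>c\<close> around \<open>x\<close> is then \<open>chart_vector M c x v\<close>, so \<open>chart_vector M c x\<close> maps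
  the standard vectors of the chart \<open>c\<close> to the corresponding coordinate frame of \<open>T\<^sub>xM\<close>.\<close>

definition chart_at :: "('a, 'e) manifold \<Rightarrow> 'a \<Rightarrow> ('a, 'e) chart" where
  "chart_at M x = (SOME c. c \<in> atlas M \<and> x \<in> fst c)"

definition chart_vector ::
    "('a, 'e::real_normed_vector) manifold \<Rightarrow> ('a, 'e) chart \<Rightarrow> 'a \<Rightarrow> 'e \<Rightarrow> 'e" where
  "chart_vector M c x = frechet_derivative (snd (chart_at M x) \<circ> chart_inv c) (at (snd c x))"

definition tangent_map ::
    "('a, 'e::real_normed_vector) manifold \<Rightarrow> ('b, 'f::real_normed_vector) manifold \<Rightarrow>
     ('a \<Rightarrow> 'b) \<Rightarrow> 'a \<Rightarrow> 'e \<Rightarrow> 'f" where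
  "tangent_map M N f x = frechet_derivative
     (snd (chart_at N (f x)) \<circ> f \<circ> chart_inv (chart_at M x)) (at (snd (chart_at M x) x))"


section \<open>Linear algebra: bases, forms, orientations\<close>

definition ordered_basis :: "'e::real_vector set \<Rightarrow> 'e list \<Rightarrow> bool" where
  "ordered_basis W bs \<longleftrightarrow> distinct bs \<and> independent (set bs) \<and> span (set bs) = W"

text \<open>Top-degree forms are functions on lists of vectors; only their values on lists of length
  \<open>dim UNIV\<close> are meaningful.\<close>

definition top_form :: "('e::real_vector list \<Rightarrow> real) \<Rightarrow> bool" where
  "top_form \<omega> \<longleftrightarrow>
     (\<forall>vs. length vs = dim (UNIV :: 'e set) \<longrightarrow>
        (\<forall>i<length vs. linear (\<lambda>v. \<omega> (vs[i := v]))) \<and>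
        (\<forall>i<length vs. \<forall>j<i. vs ! i = vs ! j \<longrightarrow> \<omega> vs = 0))"

text \<open>An orientation is given by the sign (1 or -1) of every ordered basis; the positive bases are
  those with sign 1. In dimension 0 it is the sign of the empty basis.\<close>

definition orientation :: "('e::real_vector list \<Rightarrow> real) \<Rightarrow> bool" where
  "orientation \<epsilon> \<longleftrightarrow> (\<exists>\<omega>. top_form \<omega> \<and>
     (\<forall>bs. ordered_basis UNIV bs \<longrightarrow> \<omega> bs \<noteq> 0 \<and> \<epsilon> bs = sgn (\<omega> bs)))"

definition inner_product :: "('e::real_vector \<Rightarrow> 'e \<Rightarrow> real) \<Rightarrow> bool" where
  "inner_product h \<longleftrightarrow> (\<forall>u. linear (h u)) \<and> (\<forall>u v. h u v = h v u) \<and> (\<forall>u. u \<noteq> 0 \<longrightarrow> h u u > 0)"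

definition orthogonal_complement :: "('e \<Rightarrow> 'e \<Rightarrow> real) \<Rightarrow> 'e set \<Rightarrow> 'e set" where
  "orthogonal_complement h W = {u. \<forall>w\<in>W. h u w = 0}"

definition orthogonal_projection ::
    "('e::real_vector \<Rightarrow> 'e \<Rightarrow> real) \<Rightarrow> 'e set \<Rightarrow> 'e \<Rightarrow> 'e" where
  "orthogonal_projection h W u = (THE w. w \<in> W \<and> u - w \<in> orthogonal_complement h W)"

definition orthonormal_basis :: "('e::real_vector \<Rightarrow> 'e \<Rightarrow> real) \<Rightarrow> 'e list \<Rightarrow> bool" where
  "orthonormal_basis h bs \<longleftrightarrow> ordered_basis UNIV bs \<and>
     (\<forall>i<length bs. \<forall>j<length bs. h (bs ! i) (bs ! j) = (if i = j then 1 else 0))"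

text \<open>The volume form is 1 on positive (and hence -1 on negative) orthonormal bases.\<close>

definition euclidean_volume_form ::
    "('e::real_vector \<Rightarrow> 'e \<Rightarrow> real) \<Rightarrow> ('e list \<Rightarrow> real) \<Rightarrow> ('e list \<Rightarrow> real) \<Rightarrow> bool" where
  "euclidean_volume_form h \<epsilon> \<mu> \<longleftrightarrow> top_form \<mu> \<and> (\<forall>bs. orthonormal_basis h bs \<longrightarrow> \<mu> bs = \<epsilon> bs)"


section \<open>Riemannian metrics, orientations, and integration of top-degree forms\<close>

definition riemannian_metric ::
    "('a, 'e::real_normed_vector) manifold \<Rightarrow> ('a \<Rightarrow> 'e \<Rightarrow> 'e \<Rightarrow> real) \<Rightarrow> bool" where
  "riemannian_metric M h \<longleftrightarrow> (\<forall>x\<in>points M. inner_product (h x)) \<and>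
     (\<forall>c\<in>atlas M. \<forall>u v. smooth_on
        (\<lambda>y. let x = chart_inv c y in h x (chart_vector M c x u) (chart_vector M c x v))
        (snd c ` fst c))"

definition smooth_top_form ::
    "('a, 'e::real_normed_vector) manifold \<Rightarrow> ('a \<Rightarrow> 'e list \<Rightarrow> real) \<Rightarrow> bool" where
  "smooth_top_form M \<omega> \<longleftrightarrow> (\<forall>x\<in>points M. top_form (\<omega> x)) \<and>
     (\<forall>c\<in>atlas M. \<forall>vs. length vs = dim (UNIV :: 'e set) \<longrightarrow> smooth_on
        (\<lambda>y. let x = chart_inv c y in \<omega> x (map (chart_vector M c x) vs)) (snd c ` fst c))"

text \<open>The signs of coordinate frames are required to be continuous, i.e. locally constant.\<close>

definition manifold_orientation ::
    "('a, 'e::real_normed_vector) manifold \<Rightarrow> ('a \<Rightarrow> 'e list \<Rightarrow> real) \<Rightarrow> bool" where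
  "manifold_orientation M \<epsilon> \<longleftrightarrow> (\<forall>x\<in>points M. orientation (\<epsilon> x)) \<and>
     (\<forall>c\<in>atlas M. \<forall>bs. ordered_basis UNIV bs \<longrightarrow> continuous_on (snd c ` fst c)
        (\<lambda>y. let x = chart_inv c y in \<epsilon> x (map (chart_vector M c x) bs)))"

definition riemannian_volume_form ::
    "('a, 'e::real_normed_vector) manifold \<Rightarrow> ('a \<Rightarrow> 'e \<Rightarrow> 'e \<Rightarrow> real) \<Rightarrow>
     ('a \<Rightarrow> 'e list \<Rightarrow> real) \<Rightarrow> ('a \<Rightarrow> 'e list \<Rightarrow> real) \<Rightarrow> bool" where
  "riemannian_volume_form M h \<epsilon> \<mu> \<longleftrightarrow>
     (\<forall>x\<in>points M. euclidean_volume_form (h x) (\<epsilon> x) (\<mu> x))"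

definition model_basis :: "'e::real_vector list" where
  "model_basis = (SOME bs. ordered_basis UNIV bs)"

text \<open>Integral of a form over the domain of a chart \<open>c\<close>. Coordinates \<open>t \<in> \<real>\<^sup>n\<close> on the model space
  are taken with respect to \<open>model_basis\<close>, and the sign of the coordinate frame accounts for the
  orientation of the chart.\<close>

definition chart_integral ::
    "('a, 'e::real_normed_vector) manifold \<Rightarrow> ('a \<Rightarrow> 'e list \<Rightarrow> real) \<Rightarrow> ('a, 'e) chart \<Rightarrow>
     ('a \<Rightarrow> 'e list \<Rightarrow> real) \<Rightarrow> real" where
  "chart_integral M \<epsilon> c \<omega> =
     (let bs = (model_basis :: 'e list); n = length bs in
      LINT t | (\<Pi>\<^sub>M i\<in>{..<n}. (lborel :: real measure)).
        (let y = (\<Sum>i<n. t i *\<^sub>R bs ! i);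
             x = chart_inv c y;
             frame = map (chart_vector M c x) bs
         in if y \<in> snd c ` fst c then \<epsilon> x frame * \<omega> x frame else 0))"

text \<open>Integration over a compact oriented manifold by means of a finite partition of unity
  subordinate to charts. Smoothness of the partition plays no role for the integral, so only
  continuity is asked for.\<close>

definition has_form_integral ::
    "('a, 'e::real_normed_vector) manifold \<Rightarrow> ('a \<Rightarrow> 'e list \<Rightarrow> real) \<Rightarrow>
     ('a \<Rightarrow> 'e list \<Rightarrow> real) \<Rightarrow> real \<Rightarrow> bool" where
  "has_form_integral M \<epsilon> \<omega> I \<longleftrightarrow> (\<exists>(m::nat) c \<rho>.
     (\<forall>i<m. c i \<in> atlas M \<and> continuous_map (mtop M) euclideanreal (\<rho> i) \<and>
        (\<forall>x\<in>points M. 0 \<le> \<rho> i x) \<and>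
        mtop M closure_of {x \<in> points M. \<rho> i x \<noteq> 0} \<subseteq> fst (c i)) \<and>
     (\<forall>x\<in>points M. (\<Sum>i<m. \<rho> i x) = 1) \<and>
     I = (\<Sum>i<m. chart_integral M \<epsilon> (c i) (\<lambda>x vs. \<rho> i x * \<omega> x vs)))"

definition form_integral ::
    "('a, 'e::real_normed_vector) manifold \<Rightarrow> ('a \<Rightarrow> 'e list \<Rightarrow> real) \<Rightarrow>
     ('a \<Rightarrow> 'e list \<Rightarrow> real) \<Rightarrow> real" where
  "form_integral M \<epsilon> \<omega> = (THE I. has_form_integral M \<epsilon> \<omega> I)"

definition riemannian_submersion ::
    "('a, 'e::real_normed_vector) manifold \<Rightarrow> ('b, 'f::real_normed_vector) manifold \<Rightarrow>
     ('a \<Rightarrow> 'e \<Rightarrow> 'e \<Rightarrow> real) \<Rightarrow> ('b \<Rightarrow> 'f \<Rightarrow> 'f \<Rightarrow> real) \<Rightarrow> ('a \<Rightarrow> 'b) \<Rightarrow> bool" where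
  "riemannian_submersion M N hM hN f \<longleftrightarrow> smooth_map M N f \<and>
     (\<forall>x\<in>points M. let D = tangent_map M N f x; H = orthogonal_complement (hM x) {v. D v = 0} in
        surj D \<and> (\<forall>u\<in>H. \<forall>v\<in>H. hN (f x) (D u) (D v) = hM x u v))"


section \<open>Principal bundles\<close>

text \<open>A Lie group is a group \<open>G\<close> together with a manifold \<open>MG\<close> on its carrier. Its Lie algebra
  is the tangent space at the unit, hence the model space of \<open>MG\<close>.\<close>

definition lie_group :: "'g monoid \<Rightarrow> ('g, 'k::real_normed_vector) manifold \<Rightarrow> bool" where
  "lie_group G MG \<longleftrightarrow> group G \<and> smooth_manifold MG \<and> points MG = carrier G \<and>
     smooth_map (prod_manifold MG MG) MG (\<lambda>(g, h). g \<otimes>\<^bsub>G\<^esub> h) \<and>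
     smooth_map MG MG (\<lambda>g. inv\<^bsub>G\<^esub> g)"

definition smooth_right_action ::
    "'g monoid \<Rightarrow> ('g, 'k::real_normed_vector) manifold \<Rightarrow> ('p, 'e::real_normed_vector) manifold \<Rightarrow>
     ('p \<times> 'g \<Rightarrow> 'p) \<Rightarrow> bool" where
  "smooth_right_action G MG P act \<longleftrightarrow> smooth_map (prod_manifold P MG) P act \<and>
     (\<forall>x\<in>points P. act (x, \<one>\<^bsub>G\<^esub>) = x \<and>
        (\<forall>g\<in>carrier G. \<forall>h\<in>carrier G. act (act (x, g), h) = act (x, g \<otimes>\<^bsub>G\<^esub> h)))"

definition principal_bundle ::
    "'g monoid \<Rightarrow> ('g, 'k::real_normed_vector) manifold \<Rightarrow> ('p, 'e::real_normed_vector) manifold \<Rightarrow>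
     ('b, 'f::real_normed_vector) manifold \<Rightarrow> ('p \<Rightarrow> 'b) \<Rightarrow> ('p \<times> 'g \<Rightarrow> 'p) \<Rightarrow> bool" where
  "principal_bundle G MG P B \<pi> act \<longleftrightarrow>
     lie_group G MG \<and> smooth_manifold P \<and> smooth_manifold B \<and>
     smooth_map P B \<pi> \<and> smooth_right_action G MG P act \<and>
     (\<forall>b\<in>points B. \<exists>U \<psi>. openin (mtop B) U \<and> b \<in> U \<and>
        diffeomorphism (prod_manifold (open_submanifold B U) MG)
          (open_submanifold P {x \<in> points P. \<pi> x \<in> U}) \<psi> \<and>
        (\<forall>u\<in>U. \<forall>g\<in>carrier G. \<pi> (\<psi> (u, g)) = u \<and>
           (\<forall>h\<in>carrier G. act (\<psi> (u, g), h) = \<psi> (u, g \<otimes>\<^bsub>G\<^esub> h))))"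

definition invariant_metric ::
    "'g monoid \<Rightarrow> ('p, 'e::real_normed_vector) manifold \<Rightarrow> ('p \<times> 'g \<Rightarrow> 'p) \<Rightarrow>
     ('p \<Rightarrow> 'e \<Rightarrow> 'e \<Rightarrow> real) \<Rightarrow> bool" where
  "invariant_metric G P act h \<longleftrightarrow> (\<forall>g\<in>carrier G. \<forall>x\<in>points P. \<forall>u v.
     let D = tangent_map P P (\<lambda>x. act (x, g)) x in h (act (x, g)) (D u) (D v) = h x u v)"

text \<open>The differential at the unit of the orbit map \<open>g \<mapsto> act (x, g)\<close>, and its image, the tangent
  space at \<open>x\<close> of the orbit of \<open>x\<close>.\<close>

definition orbit_map_deriv ::
    "'g monoid \<Rightarrow> ('g, 'k::real_normed_vector) manifold \<Rightarrow> ('p, 'e::real_normed_vector) manifold \<Rightarrow>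
     ('p \<times> 'g \<Rightarrow> 'p) \<Rightarrow> 'p \<Rightarrow> 'k \<Rightarrow> 'e" where
  "orbit_map_deriv G MG P act x = tangent_map MG P (\<lambda>g. act (x, g)) \<one>\<^bsub>G\<^esub>"

definition orbit_tangent ::
    "'g monoid \<Rightarrow> ('g, 'k::real_normed_vector) manifold \<Rightarrow> ('p, 'e::real_normed_vector) manifold \<Rightarrow>
     ('p \<times> 'g \<Rightarrow> 'p) \<Rightarrow> 'p \<Rightarrow> 'e set" where
  "orbit_tangent G MG P act x = range (orbit_map_deriv G MG P act x)"

definition connection_form ::
    "'g monoid \<Rightarrow> ('g, 'k::real_normed_vector) manifold \<Rightarrow> ('p, 'e::real_normed_vector) manifold \<Rightarrow>
     ('p \<times> 'g \<Rightarrow> 'p) \<Rightarrow> ('p \<Rightarrow> 'e \<Rightarrow> 'e \<Rightarrow> real) \<Rightarrow> 'p \<Rightarrow> 'e \<Rightarrow> 'k" where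
  "connection_form G MG P act hP x v =
     inv_into UNIV (orbit_map_deriv G MG P act x)
       (orthogonal_projection (hP x) (orbit_tangent G MG P act x) v)"

text \<open>The Euclidean structure \<open>hg\<close> on the trivial bundle with fibre the Lie algebra, such that
  \<open>hP = \<pi>\<^sup>* hB + hg (\<theta>, \<theta>)\<close>.\<close>

definition fibre_metric ::
    "'g monoid \<Rightarrow> ('g, 'k::real_normed_vector) manifold \<Rightarrow> ('p, 'e::real_normed_vector) manifold \<Rightarrow>
     ('b, 'f::real_normed_vector) manifold \<Rightarrow> ('p \<Rightarrow> 'b) \<Rightarrow> ('p \<times> 'g \<Rightarrow> 'p) \<Rightarrow>
     ('p \<Rightarrow> 'e \<Rightarrow> 'e \<Rightarrow> real) \<Rightarrow> ('b \<Rightarrow> 'f \<Rightarrow> 'f \<Rightarrow> real) \<Rightarrow>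
     ('p \<Rightarrow> 'k \<Rightarrow> 'k \<Rightarrow> real) \<Rightarrow> bool" where
  "fibre_metric G MG P B \<pi> act hP hB hg \<longleftrightarrow>
     (\<forall>x\<in>points P. inner_product (hg x)) \<and>
     (\<forall>a b. smooth_function P (\<lambda>x. hg x a b)) \<and>
     (\<forall>x\<in>points P. \<forall>u v.
        let D = tangent_map P B \<pi> x; \<theta> = connection_form G MG P act hP x in
        hP x u v = hB (\<pi> x) (D u) (D v) + hg x (\<theta> u) (\<theta> v))"

text \<open>Sign of a basis \<open>bs\<close> of the tangent space of the orbit: a basis \<open>as\<close> of the orthogonal
  complement, with the sign transported from the base, followed by \<open>bs\<close> must have the product
  sign.\<close>

definition orbit_orientation ::
    "'g monoid \<Rightarrow> ('g, 'k::real_normed_vector) manifold \<Rightarrow> ('p, 'e::real_normed_vector) manifold \<Rightarrow>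
     ('b, 'f::real_normed_vector) manifold \<Rightarrow> ('p \<Rightarrow> 'b) \<Rightarrow> ('p \<times> 'g \<Rightarrow> 'p) \<Rightarrow>
     ('p \<Rightarrow> 'e \<Rightarrow> 'e \<Rightarrow> real) \<Rightarrow> ('p \<Rightarrow> 'e list \<Rightarrow> real) \<Rightarrow> ('b \<Rightarrow> 'f list \<Rightarrow> real) \<Rightarrow>
     'p \<Rightarrow> 'e list \<Rightarrow> real" where
  "orbit_orientation G MG P B \<pi> act hP \<epsilon>P \<epsilon>B x bs =
     (THE s. \<forall>as. ordered_basis (orthogonal_complement (hP x) (orbit_tangent G MG P act x)) as \<longrightarrow>
        \<epsilon>P x (as @ bs) = \<epsilon>B (\<pi> x) (map (tangent_map P B \<pi> x) as) * s)"

definition lie_algebra_orientation ::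
    "'g monoid \<Rightarrow> ('g, 'k::real_normed_vector) manifold \<Rightarrow> ('p, 'e::real_normed_vector) manifold \<Rightarrow>
     ('b, 'f::real_normed_vector) manifold \<Rightarrow> ('p \<Rightarrow> 'b) \<Rightarrow> ('p \<times> 'g \<Rightarrow> 'p) \<Rightarrow>
     ('p \<Rightarrow> 'e \<Rightarrow> 'e \<Rightarrow> real) \<Rightarrow> ('p \<Rightarrow> 'e list \<Rightarrow> real) \<Rightarrow> ('b \<Rightarrow> 'f list \<Rightarrow> real) \<Rightarrow>
     ('k list \<Rightarrow> real) \<Rightarrow> bool" where
  "lie_algebra_orientation G MG P B \<pi> act hP \<epsilon>P \<epsilon>B \<epsilon>g \<longleftrightarrow> orientation \<epsilon>g \<and>
     (\<forall>x\<in>points P. \<forall>bs. ordered_basis (orbit_tangent G MG P act x) bs \<longrightarrow>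
        \<epsilon>g (map (connection_form G MG P act hP x) bs) =
        orbit_orientation G MG P B \<pi> act hP \<epsilon>P \<epsilon>B x bs)"

definition left_invariant_orientation ::
    "'g monoid \<Rightarrow> ('g, 'k::real_normed_vector) manifold \<Rightarrow> ('k list \<Rightarrow> real) \<Rightarrow>
     'g \<Rightarrow> 'k list \<Rightarrow> real" where
  "left_invariant_orientation G MG \<epsilon>g g bs =
     \<epsilon>g (map (tangent_map MG MG (\<lambda>h. inv\<^bsub>G\<^esub> g \<otimes>\<^bsub>G\<^esub> h) g) bs)"

definition biinvariant_volume_form ::
    "'g monoid \<Rightarrow> ('g, 'k::real_normed_vector) manifold \<Rightarrow> ('g \<Rightarrow> 'k list \<Rightarrow> real) \<Rightarrow> bool" where
  "biinvariant_volume_form G MG \<nu> \<longleftrightarrow> smooth_top_form MG \<nu> \<and>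
     (\<forall>g\<in>carrier G. \<forall>bs. ordered_basis UNIV bs \<longrightarrow> \<nu> g bs \<noteq> 0) \<and>
     (\<forall>a\<in>carrier G. \<forall>g\<in>carrier G. \<forall>vs. length vs = dim (UNIV :: 'k set) \<longrightarrow>
        \<nu> (a \<otimes>\<^bsub>G\<^esub> g) (map (tangent_map MG MG (\<lambda>h. a \<otimes>\<^bsub>G\<^esub> h) g) vs) = \<nu> g vs \<and>
        \<nu> (g \<otimes>\<^bsub>G\<^esub> a) (map (tangent_map MG MG (\<lambda>h. h \<otimes>\<^bsub>G\<^esub> a) g) vs) = \<nu> g vs)"

text \<open>\<open>V\<close> is the function on \<open>B\<close> determined by \<open>V (\<pi> x) \<nu>\<^sub>e = \<mu>g x\<close> for all \<open>x\<close> in \<open>P\<close>, where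
  the Euclidean structure \<open>hg\<close>, the orientation \<open>\<epsilon>g\<close> of the Lie algebra, the volume forms \<open>\<mu>g x\<close>
  and the normalised bi-invariant form \<open>\<nu>\<close> are uniquely determined by the other data.\<close>

definition orbit_volume_function ::
    "'g monoid \<Rightarrow> ('g, 'k::real_normed_vector) manifold \<Rightarrow> ('p, 'e::real_normed_vector) manifold \<Rightarrow>
     ('b, 'f::real_normed_vector) manifold \<Rightarrow> ('p \<Rightarrow> 'b) \<Rightarrow> ('p \<times> 'g \<Rightarrow> 'p) \<Rightarrow>
     ('p \<Rightarrow> 'e \<Rightarrow> 'e \<Rightarrow> real) \<Rightarrow> ('b \<Rightarrow> 'f \<Rightarrow> 'f \<Rightarrow> real) \<Rightarrow>
     ('p \<Rightarrow> 'e list \<Rightarrow> real) \<Rightarrow> ('b \<Rightarrow> 'f list \<Rightarrow> real) \<Rightarrow> ('b \<Rightarrow> real) \<Rightarrow> bool" where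
  "orbit_volume_function G MG P B \<pi> act hP hB \<epsilon>P \<epsilon>B V \<longleftrightarrow> (\<exists>hg \<epsilon>g \<mu>g \<nu>.
     fibre_metric G MG P B \<pi> act hP hB hg \<and>
     lie_algebra_orientation G MG P B \<pi> act hP \<epsilon>P \<epsilon>B \<epsilon>g \<and>
     (\<forall>x\<in>points P. euclidean_volume_form (hg x) \<epsilon>g (\<mu>g x)) \<and>
     biinvariant_volume_form G MG \<nu> \<and>
     form_integral MG (left_invariant_orientation G MG \<epsilon>g) \<nu> = 1 \<and>
     (\<forall>x\<in>points P. \<forall>vs. length vs = dim (UNIV :: 'k set) \<longrightarrow>
        V (\<pi> x) * \<nu> \<one>\<^bsub>G\<^esub> vs = \<mu>g x vs))"

end

theory Submission
  imports Defs
begin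

text \<open>In a local trivialisation \<open>\<psi> : U \<times> G \<rightarrow> P\<close> the differential of \<open>\<psi>\<close> sends a vector tangent to \<open>G\<close> at \<open>g\<close>
  to the tangent space of the orbit, through the Maurer-Cartan form at \<open>g\<close> followed by the orbit map, while
  horizontal vectors project isometrically to \<open>B\<close>. Since \<open>\<mu>\<^sup>g\<^sub>x = V (\<pi> x) \<nu>\<^sub>e\<close> and \<open>\<nu>\<close> is left
  invariant, the density of \<open>\<mu>P\<close> in product coordinates is the product of the densities of \<open>V \<mu>B\<close> and
  of \<open>\<nu>\<close>. As an orientation times a positive volume form is the absolute value of that form, orientations
  play no further role. For a function on \<open>B\<close> supported in \<open>U\<close>, a partition of unity on \<open>G\<close> is
  carried to \<open>P\<close> by \<open>\<psi>\<close>; each piece is transported from a chart of \<open>P\<close> to a product of charts of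
  \<open>B\<close> and \<open>G\<close> by the change of variables formula, the partition of unity on \<open>P\<close> sums to 1 there,
  and Fubini's theorem with \<open>\<integral>\<^sub>G \<nu> = 1\<close> leaves the integral over \<open>B\<close>. A partition of unity on \<open>B\<close>
  reduces the general case to this one.\<close>

section \<open>Top-degree forms\<close>

text \<open>\<open>form_integral\<close> is a definite description, so nothing can be computed
  before its value is known to be independent of the partition and of the charts; this is proved
  once, for a notion of density that covers \<open>P\<close>, \<open>B\<close> and \<open>G\<close>
  alike. The integral over \<open>P\<close> admits only charts of the given atlas, and the product
  charts coming from a trivialisation need not belong to it. Hence a partition of unity on
  \<open>P\<close> is kept throughout, and each of its pieces is moved into product coordinates by
  an explicit change of variables. The fibre coordinate exists only over \<open>U\<close>, so a
  partition function of \<open>G\<close> carried to \<open>P\<close> is merely extended by 0; the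
  pieces are treated as measurable functions dominated by integrable ones rather than as continuous
  functions with compact support. The volume forms of \<open>hP\<close> and \<open>hB\<close> are
  given pointwise, and the continuity of their absolute values on coordinate frames comes from Gram
  determinants. Tangent spaces are copies of the model space through chosen charts that jump from
  point to point, which is why derivatives are computed near one point and compared by
  uniqueness.\<close>

lemma ordered_basis_length:
  fixes bs :: "'e::real_vector list"
  assumes "ordered_basis UNIV bs"
  shows "length bs = dim (UNIV :: 'e set)"
proof -
  have "dim (UNIV :: 'e set) = card (set bs)"
    using assms dim_eq_card[of "set bs" UNIV] by (auto simp: ordered_basis_def)
  then show ?thesis using assms distinct_card[of bs] by (simp add: ordered_basis_def)
qed

lemma ex_ordered_basis:
  assumes "finite S" "span S = (UNIV :: 'e::real_vector set)"
  shows "\<exists>bs :: 'e list. ordered_basis UNIV bs"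
proof -
  obtain T where T: "T \<subseteq> S" "independent T" "S \<subseteq> span T"
    using maximal_independent_subset[of S] by auto
  have "span T = UNIV"
    using T(3) assms(2) span_mono[of S "span T"] by (auto simp: span_span)
  moreover obtain bs where "distinct bs" "set bs = T"
    using finite_distinct_list[of T] T(1) assms(1) finite_subset by metis
  ultimately show ?thesis using T(2) unfolding ordered_basis_def by metis
qed

lemma model_basis_ordered_basis:
  assumes "finite S" "span S = (UNIV :: 'e::real_vector set)"
  shows "ordered_basis UNIV (model_basis :: 'e list)"
  unfolding model_basis_def using ex_ordered_basis[OF assms] by (rule someI_ex)

context
  fixes \<omega> :: "'e::real_vector list \<Rightarrow> real"
  assumes top: "top_form \<omega>"
begin

lemma top_form_linear:
  assumes "length vs = dim (UNIV :: 'e set)" "i < length vs"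
  shows "linear (\<lambda>v. \<omega> (vs[i := v]))"
  using top assms by (auto simp: top_form_def)

lemma top_form_repeated:
  assumes "length vs = dim (UNIV :: 'e set)" "i < length vs" "j < length vs" "i \<noteq> j" "vs ! i = vs ! j"
  shows "\<omega> vs = 0"
  using top assms by (metis linorder_neqE_nat top_form_def)

text \<open>Polarisation: the form vanishes when both slots carry \<open>?a + ?b\<close>, and
  expanding leaves only the two mixed terms.\<close>

lemma top_form_swap:
  assumes n: "length vs = dim (UNIV :: 'e set)" and ij: "i < length vs" "j < length vs" "i \<noteq> j"
  shows "\<omega> (vs[i := vs ! j, j := vs ! i]) = - \<omega> vs"
proof -
  define W where "W = (\<lambda>a b. \<omega> (vs[i := a, j := b]))"
  have l1: "linear (\<lambda>b. W a b)" for a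
    unfolding W_def using top_form_linear[of "vs[i := a]" j] n ij by simp
  have l2: "linear (\<lambda>a. W a b)" for b
    unfolding W_def using top_form_linear[of "vs[j := b]" i] n ij
    by (simp add: list_update_swap[OF ij(3)])
  have z: "W a a = 0" for a
    unfolding W_def using top_form_repeated[of "vs[i := a, j := a]" i j] n ij by simp
  let ?a = "vs ! i" and ?b = "vs ! j"
  have "0 = W (?a + ?b) (?a + ?b)" by (simp add: z)
  also have "\<dots> = W ?a ?b + W ?b ?a"
    by (simp only: linear_add[OF l1] linear_add[OF l2]) (simp add: z)
  finally have "W ?b ?a = - W ?a ?b" by simp
  then show ?thesis by (simp add: W_def)
qed

text \<open>By linearity in slot \<open>i\<close> it suffices to insert one of the other entries,
  which creates a repetition. It follows that adding combinations of the other entries to an entry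
  does not change the value of a form.\<close>

lemma top_form_span:
  assumes n: "length vs = dim (UNIV :: 'e set)" and i: "i < length vs"
    and v: "v \<in> span {vs ! j |j. j < length vs \<and> j \<noteq> i}"
  shows "\<omega> (vs[i := v]) = 0"
proof -
  have "v \<in> {v. \<omega> (vs[i := v]) = 0}"
  proof (rule span_induct_alt[OF v, where h = "\<lambda>v. v \<in> {v. \<omega> (vs[i := v]) = 0}"])
    note lin = top_form_linear[OF n i]
    show "0 \<in> {v. \<omega> (vs[i := v]) = 0}" using linear_0[OF lin] by simp
    fix c x y assume x: "x \<in> {vs ! j |j. j < length vs \<and> j \<noteq> i}" and y: "y \<in> {v. \<omega> (vs[i := v]) = 0}"
    obtain j where j: "j < length vs" "j \<noteq> i" "x = vs ! j" using x by blast
    have "\<omega> (vs[i := x]) = 0"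
      using top_form_repeated[of "vs[i := x]" i j] n i j by simp
    then show "c *\<^sub>R x + y \<in> {v. \<omega> (vs[i := v]) = 0}"
      using y linear_add[OF lin] linear_scale[OF lin] by simp
  qed
  then show ?thesis by simp
qed

text \<open>A repeated or dependent entry would make the form vanish. An independent list of full
  length must span, since one more independent vector would exceed the size of the spanning set
  \<open>bs\<close>.\<close>

lemma top_form_nonzero_imp_basis:
  fixes bs :: "'e list"
  assumes bs: "ordered_basis UNIV bs" and n: "length vs = dim (UNIV :: 'e set)" and nz: "\<omega> vs \<noteq> 0"
  shows "ordered_basis UNIV vs"
proof -
  have d: "distinct vs"
    using top_form_repeated[OF n] nz by (auto simp: distinct_conv_nth)
  have ind: "independent (set vs)"
  proof
    assume "dependent (set vs)"
    then obtain a where a: "a \<in> set vs" "a \<in> span (set vs - {a})" by (auto simp: dependent_def)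
    then obtain i where i: "i < length vs" "a = vs ! i" by (auto simp: in_set_conv_nth)
    have "set vs - {a} = {vs ! j |j. j < length vs \<and> j \<noteq> i}"
      using d i by (auto simp: in_set_conv_nth distinct_conv_nth)
    then have "\<omega> (vs[i := a]) = 0" using top_form_span[OF n i(1)] a(2) by simp
    then show False using nz i by simp
  qed
  have "span (set vs) = UNIV"
  proof (rule ccontr)
    assume "span (set vs) \<noteq> UNIV"
    then obtain a where a: "a \<notin> span (set vs)" by blast
    then have "a \<notin> set vs" using span_base by blast
    have "independent (insert a (set vs))" using independent_insertI[OF a ind] .
    then have "card (insert a (set vs)) \<le> card (set bs)"
      using independent_span_bound[of "set bs" "insert a (set vs)"] bs by (simp add: ordered_basis_def)
    then show False
      using bs d n ordered_basis_length[OF bs] \<open>a \<notin> set vs\<close> by (simp add: distinct_card ordered_basis_def)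
  qed
  then show ?thesis using d ind by (simp add: ordered_basis_def)
qed

text \<open>Steinitz exchange: the entries of \<open>bs\<close> are moved into the list one after the other, keeping
  the value of the form nonzero.\<close>

lemma top_form_nonzero_on_basis:
  fixes bs :: "'e list"
  assumes bs: "ordered_basis UNIV bs" and n: "length vs = dim (UNIV :: 'e set)" and nz: "\<omega> vs \<noteq> 0"
  shows "\<omega> bs \<noteq> 0"
proof -
  let ?n = "dim (UNIV :: 'e set)"
  have lbs: "length bs = ?n" by (rule ordered_basis_length[OF bs])
  have "\<exists>zs. length zs = ?n \<and> \<omega> zs \<noteq> 0 \<and> take t zs = take t bs" if "t \<le> ?n" for t
    using that
  proof (induction t)
    case 0
    then show ?case using n nz by auto
  next
    case (Suc t)
    then obtain zs where zs: "length zs = ?n" "\<omega> zs \<noteq> 0" "take t zs = take t bs" by auto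
    have t: "t < ?n" using Suc.prems by simp
    have nthz: "zs ! j = bs ! j" if "j < t" for j
      using zs(3) that by (metis nth_take)
    have zb: "ordered_basis UNIV zs" by (rule top_form_nonzero_imp_basis[OF bs zs(1,2)])
    have fin: "finite (set zs)" by simp
    have "bs ! t \<in> span (set zs)" using zb by (simp add: ordered_basis_def)
    then obtain u where u: "bs ! t = (\<Sum>v\<in>set zs. u v *\<^sub>R v)"
      using span_finite[OF fin] by auto
    \<comment> \<open>If all coefficients from position \<open>t\<close> on vanished,
      \<open>bs ! t\<close> would be a combination of the earlier basis vectors, which
      \<open>zs\<close> already shares with \<open>bs\<close>.\<close>
    have "\<exists>p. t \<le> p \<and> p < ?n \<and> u (zs ! p) \<noteq> 0"
    proof (rule ccontr)
      assume "\<nexists>p. t \<le> p \<and> p < ?n \<and> u (zs ! p) \<noteq> 0"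
      then have z: "u v *\<^sub>R v \<in> span (set (take t bs))" if v: "v \<in> set zs" for v
      proof -
        obtain p where p: "p < ?n" "v = zs ! p" using v zs(1) by (auto simp: in_set_conv_nth)
        show ?thesis
        proof (cases "t \<le> p")
          case True
          then show ?thesis using p \<open>\<nexists>p. _\<close> by (auto simp: span_zero)
        next
          case False
          then have "v \<in> set (take t bs)" using p nthz t lbs by (auto simp: in_set_conv_nth intro!: exI[of _ p])
          then show ?thesis by (simp add: span_base span_scale)
        qed
      qed
      have "bs ! t \<in> span (set (take t bs))" unfolding u by (rule span_sum) (use z in auto)
      moreover have "set (take t bs) \<subseteq> set bs - {bs ! t}"
      proof
        fix v assume "v \<in> set (take t bs)"
        then obtain i where "i < t" "v = bs ! i" using t lbs by (auto simp: in_set_conv_nth)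
        then show "v \<in> set bs - {bs ! t}"
          using bs t lbs by (auto simp: ordered_basis_def nth_eq_iff_index_eq)
      qed
      ultimately have "bs ! t \<in> span (set bs - {bs ! t})" using span_mono by blast
      moreover have "bs ! t \<in> set bs" using t lbs by simp
      ultimately show False using bs by (auto simp: ordered_basis_def dependent_def)
    qed
    then obtain p where p: "t \<le> p" "p < ?n" "u (zs ! p) \<noteq> 0" by blast
    define ys where "ys = zs[p := bs ! t]"
    have lys: "length ys = ?n" by (simp add: ys_def zs)
    have lin: "linear (\<lambda>v. \<omega> (zs[p := v]))" using top_form_linear[OF zs(1), of p] p zs(1) by simp
    have dz: "distinct zs" using zb by (simp add: ordered_basis_def)
    \<comment> \<open>Only the term of \<open>zs ! p\<close> survives the expansion: any other entry
      of \<open>zs\<close> would appear twice.\<close>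
    have "\<omega> ys = (\<Sum>v\<in>set zs. u v * \<omega> (zs[p := v]))"
      unfolding ys_def u by (subst linear_sum[OF lin]) (simp only: linear_scale[OF lin] real_scaleR_def)
    also have "\<dots> = (\<Sum>v\<in>set zs. if v = zs ! p then u v * \<omega> zs else 0)"
    proof (rule sum.cong[OF refl])
      fix v assume "v \<in> set zs"
      then obtain q where q: "q < ?n" "v = zs ! q" using zs(1) by (auto simp: in_set_conv_nth)
      show "u v * \<omega> (zs[p := v]) = (if v = zs ! p then u v * \<omega> zs else 0)"
      proof (cases "q = p")
        case True
        then show ?thesis using q by simp
      next
        case False
        then have "v \<noteq> zs ! p" using dz q p zs(1) by (simp add: nth_eq_iff_index_eq)
        moreover have "\<omega> (zs[p := v]) = 0"
          using top_form_repeated[of "zs[p := v]" p q] False q p zs(1) by simp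
        ultimately show ?thesis by simp
      qed
    qed
    also have "\<dots> = u (zs ! p) * \<omega> zs" using p zs(1) by simp
    finally have nzy: "\<omega> ys \<noteq> 0" using p zs(2) by simp
    \<comment> \<open>A transposition changes the form by a sign only, so the new vector may be
      moved from position \<open>p\<close> to position \<open>t\<close>.\<close>
    define xs where "xs = ys[t := ys ! p, p := ys ! t]"
    have "\<omega> xs \<noteq> 0"
    proof (cases "t = p")
      case True
      then show ?thesis using nzy by (simp add: xs_def)
    next
      case False
      then show ?thesis using top_form_swap[of ys t p] nzy lys p t by (simp add: xs_def)
    qed
    moreover have "length xs = ?n" by (simp add: xs_def lys)
    moreover have "take (Suc t) xs = take (Suc t) bs"
    proof (rule nth_equalityI)
      show "length (take (Suc t) xs) = length (take (Suc t) bs)"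
        using \<open>length xs = ?n\<close> lbs by simp
      fix i assume "i < length (take (Suc t) xs)"
      then have i: "i \<le> t" by simp
      show "take (Suc t) xs ! i = take (Suc t) bs ! i"
      proof (cases "i = t")
        case True
        then show ?thesis using p t zs(1) lys by (simp add: xs_def ys_def nth_list_update)
      next
        case False
        then show ?thesis using i p t zs(1) nthz[of i] by (simp add: xs_def ys_def nth_list_update)
      qed
    qed
    ultimately show ?case by blast
  qed
  from this[of ?n] show ?thesis using lbs by auto
qed

end

lemma top_form_diff_scaled:
  assumes "top_form \<omega>" "top_form \<eta>"
  shows "top_form (\<lambda>vs. \<omega> vs * a - \<eta> vs * b)"
  unfolding top_form_def
proof (intro allI impI conjI)
  fix vs :: "'a list" and i assume n: "length vs = dim (UNIV :: 'a set)" and i: "i < length vs"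
  note l1 = top_form_linear[OF assms(1) n i] and l2 = top_form_linear[OF assms(2) n i]
  show "linear (\<lambda>v. \<omega> (vs[i := v]) * a - \<eta> (vs[i := v]) * b)"
    by (rule linearI) (simp_all add: linear_add[OF l1] linear_add[OF l2] linear_scale[OF l1]
        linear_scale[OF l2] algebra_simps)
  fix j assume j: "j < i" "vs ! i = vs ! j"
  show "\<omega> vs * a - \<eta> vs * b = 0"
    using top_form_repeated[OF assms(1) n i _ _ j(2)] top_form_repeated[OF assms(2) n i _ _ j(2)] i j
    by simp
qed

text \<open>The cross difference \<open>?z\<close> is a top-degree form that is 0 on the basis
  \<open>bs\<close>, and a form that is nonzero on some list of full length is nonzero on every
  basis. Cross multiplication avoids dividing by \<open>\<eta> bs\<close>.\<close>

lemma top_form_proportional: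
  fixes \<omega> \<eta> :: "'e::real_vector list \<Rightarrow> real"
  assumes "top_form \<omega>" "top_form \<eta>" "ordered_basis UNIV bs" "length vs = dim (UNIV :: 'e set)"
  shows "\<omega> vs * \<eta> bs = \<eta> vs * \<omega> bs"
proof -
  let ?z = "\<lambda>vs. \<omega> vs * \<eta> bs - \<eta> vs * \<omega> bs"
  have "top_form ?z" using assms(1,2) by (rule top_form_diff_scaled)
  from top_form_nonzero_on_basis[OF this assms(3,4)] have "?z vs = 0" by force
  then show ?thesis by simp
qed

text \<open>Together with its counterpart for the last entries this cuts a form on the total space
  into a form on the base and a form on the Lie algebra, one block of arguments being frozen at a
  time.\<close>

lemma top_form_append_left:
  fixes A :: "'f::real_vector \<Rightarrow> 'e::real_vector"
  assumes top: "top_form \<omega>" and A: "linear A" and n: "dim (UNIV :: 'f set) + length ws = dim (UNIV :: 'e set)"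
  shows "top_form (\<lambda>vs. \<omega> (map A vs @ ws))"
  unfolding top_form_def
proof (intro allI impI conjI)
  fix vs :: "'f list" and i assume l: "length vs = dim (UNIV :: 'f set)" and i: "i < length vs"
  have "linear (\<lambda>v. \<omega> ((map A vs @ ws)[i := v]))"
    by (rule top_form_linear[OF top]) (use n l i in auto)
  from linear_compose[OF A this] show "linear (\<lambda>v. \<omega> (map A (vs[i := v]) @ ws))"
    using i by (simp add: o_def map_update list_update_append)
  fix j assume "j < i" "vs ! i = vs ! j"
  then show "\<omega> (map A vs @ ws) = 0"
    using i n l by (intro top_form_repeated[OF top, of _ i j]) (auto simp: nth_append)
qed

lemma top_form_append_right:
  fixes A :: "'f::real_vector \<Rightarrow> 'e::real_vector"
  assumes top: "top_form \<omega>" and A: "linear A" and n: "length ws + dim (UNIV :: 'f set) = dim (UNIV :: 'e set)"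
  shows "top_form (\<lambda>vs. \<omega> (ws @ map A vs))"
  unfolding top_form_def
proof (intro allI impI conjI)
  fix vs :: "'f list" and i assume l: "length vs = dim (UNIV :: 'f set)" and i: "i < length vs"
  have "linear (\<lambda>v. \<omega> ((ws @ map A vs)[length ws + i := v]))"
    by (rule top_form_linear[OF top]) (use n l i in auto)
  from linear_compose[OF A this] show "linear (\<lambda>v. \<omega> (ws @ map A (vs[i := v])))"
    using i by (simp add: o_def map_update list_update_append)
  fix j assume "j < i" "vs ! i = vs ! j"
  then show "\<omega> (ws @ map A vs) = 0"
    using i n l by (intro top_form_repeated[OF top, of _ "length ws + i" "length ws + j"]) (auto simp: nth_append)
qed

lemma top_form_comp_linear:
  fixes A :: "'f::real_vector \<Rightarrow> 'e::real_vector"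
  assumes "top_form \<omega>" "linear A" "dim (UNIV :: 'f set) = dim (UNIV :: 'e set)"
  shows "top_form (\<lambda>vs. \<omega> (map A vs))"
  using top_form_append_left[of \<omega> A "[]"] assms by simp

lemma ordered_basis_map:
  assumes "ordered_basis UNIV bs" "linear A" "bij A"
  shows "ordered_basis UNIV (map A bs)"
proof -
  have "inj A" using assms(3) by (rule bij_is_inj)
  then have "inj_on A (set bs)" "inj_on A (span (set bs))" by (auto intro: inj_on_subset)
  then have "independent (A ` set bs)"
    using linear_independent_injective_image[OF assms(2)] assms(1) by (simp add: ordered_basis_def)
  moreover have "span (A ` set bs) = UNIV"
    using linear_span_image[OF assms(2)] assms(1) bij_is_surj[OF assms(3)] by (simp add: ordered_basis_def)
  ultimately show ?thesis
    using assms(1) \<open>inj_on A (set bs)\<close> by (simp add: ordered_basis_def distinct_map)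
qed

section \<open>Inner products\<close>

text \<open>Drops the spanning condition of \<open>orthonormal_basis\<close>, so as to apply to
  lists inside a subspace and to lists still under construction.\<close>

definition orthonormal_list :: "('e::real_vector \<Rightarrow> 'e \<Rightarrow> real) \<Rightarrow> 'e list \<Rightarrow> bool" where
  "orthonormal_list h bs \<longleftrightarrow>
     (\<forall>i<length bs. \<forall>j<length bs. h (bs ! i) (bs ! j) = (if i = j then 1 else 0))"

context
  fixes h :: "'e::real_vector \<Rightarrow> 'e \<Rightarrow> real"
  assumes ip: "inner_product h"
begin

lemma ip_linear: "linear (h u)" and ip_commute: "h u v = h v u" and ip_pos: "u \<noteq> 0 \<Longrightarrow> h u u > 0"
  using ip by (auto simp: inner_product_def)

lemma ip_linear_left: "linear (\<lambda>u. h u v)"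
  using ip_linear[of v] by (simp add: ip_commute[of v, symmetric])

lemma ip_zero_iff: "h u u = 0 \<longleftrightarrow> u = 0"
  using ip_pos[of u] linear_0[OF ip_linear] by force

lemma orthonormal_list_distinct: "orthonormal_list h bs \<Longrightarrow> distinct bs"
  by (auto simp: orthonormal_list_def distinct_conv_nth) (metis zero_neq_one)

lemma orthonormal_list_coeff:
  assumes "orthonormal_list h bs" "b \<in> set bs"
  shows "h (\<Sum>v\<in>set bs. u v *\<^sub>R v) b = u b"
proof -
  have "h (\<Sum>v\<in>set bs. u v *\<^sub>R v) b = (\<Sum>v\<in>set bs. u v * h v b)"
    by (simp add: linear_sum[OF ip_linear_left] linear_scale[OF ip_linear_left])
  also have "\<dots> = (\<Sum>v\<in>set bs. if v = b then u v else 0)"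
    using assms by (intro sum.cong) (auto simp: orthonormal_list_def in_set_conv_nth split: if_splits)
  finally show ?thesis using assms(2) by simp
qed

lemma orthonormal_list_independent:
  assumes "orthonormal_list h bs"
  shows "independent (set bs)"
proof (rule independent_if_scalars_zero)
  fix u b assume "(\<Sum>x\<in>set bs. u x *\<^sub>R x) = 0" "b \<in> set bs"
  then show "u b = 0" using orthonormal_list_coeff[OF assms, of b u] linear_0[OF ip_linear_left] by simp
qed simp

text \<open>An orthonormal list in \<open>T\<close> of maximal length exists because lengths are
  bounded by the dimension. Were its span smaller than \<open>T\<close>, one Gram-Schmidt step would
  lengthen it.\<close>

lemma ex_orthonormal_list:
  fixes bs :: "'e list"
  assumes bs: "ordered_basis UNIV bs" and T: "subspace T"
  shows "\<exists>es. orthonormal_list h es \<and> span (set es) = T"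
proof -
  let ?Q = "\<lambda>es. orthonormal_list h es \<and> set es \<subseteq> T"
  have bound: "length es \<le> length bs" if Q: "?Q es" for es
  proof -
    have "card (set es) \<le> card (set bs)"
      using independent_span_bound[of "set bs" "set es"] orthonormal_list_independent[of es] Q bs
      by (simp add: ordered_basis_def)
    then show ?thesis
      using orthonormal_list_distinct[of es] Q bs by (simp add: distinct_card ordered_basis_def)
  qed
  have "?Q []" by (simp add: orthonormal_list_def)
  then obtain es where es: "?Q es" and max: "\<And>fs. ?Q fs \<Longrightarrow> length fs \<le> length es"
    using ex_has_greatest_nat[of ?Q "[]" length "Suc (length bs)"] bound by (auto simp: less_Suc_eq_le)
  have "T \<subseteq> span (set es)"
  proof (rule ccontr)
    assume "\<not> T \<subseteq> span (set es)"
    then obtain u where u: "u \<in> T" "u \<notin> span (set es)" by blast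
    define w where "w = u - (\<Sum>v\<in>set es. h u v *\<^sub>R v)"
    have "(\<Sum>v\<in>set es. h u v *\<^sub>R v) \<in> span (set es)"
      by (intro span_sum span_scale span_base)
    then have w0: "w \<noteq> 0" using u by (auto simp: w_def)
    have wo: "h w b = 0" if "b \<in> set es" for b
      using linear_diff[OF ip_linear_left] orthonormal_list_coeff[OF _ that, of "h u"] es by (simp add: w_def)
    have wT: "w \<in> T" unfolding w_def
      using es u by (intro subspace_diff[OF T] subspace_sum[OF T] subspace_scale[OF T]) auto
    define e where "e = (1 / sqrt (h w w)) *\<^sub>R w"
    have "h e e = 1"
      using ip_pos[OF w0] linear_scale[OF ip_linear] linear_scale[OF ip_linear_left]
      by (simp add: e_def field_simps)
    moreover have "h e b = 0" "h b e = 0" if "b \<in> set es" for b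
      using wo[OF that] linear_scale[OF ip_linear_left] ip_commute by (auto simp: e_def)
    ultimately have "?Q (e # es)"
      using es wT subspace_scale[OF T] by (auto simp: orthonormal_list_def nth_Cons e_def split: nat.splits)
    then show False using max[of "e # es"] by simp
  qed
  moreover have "span (set es) \<subseteq> T" using es T by (simp add: span_minimal)
  ultimately show ?thesis using es by blast
qed

lemma ex_orthonormal_basis:
  fixes bs :: "'e list"
  assumes bs: "ordered_basis UNIV bs"
  shows "\<exists>es. orthonormal_basis h es"
  using ex_orthonormal_list[OF bs subspace_UNIV] orthonormal_list_distinct orthonormal_list_independent
  unfolding orthonormal_basis_def ordered_basis_def orthonormal_list_def[symmetric] by blast

lemma orthogonal_decomposition:
  fixes bs :: "'e list"
  assumes bs: "ordered_basis UNIV bs" and T: "subspace T"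
  shows "\<exists>w\<in>T. u - w \<in> orthogonal_complement h T"
proof -
  obtain es where es: "orthonormal_list h es" "span (set es) = T"
    using ex_orthonormal_list[OF bs T] by blast
  define w where "w = (\<Sum>v\<in>set es. h u v *\<^sub>R v)"
  have "w \<in> T" unfolding w_def es(2)[symmetric] by (intro span_sum span_scale span_base)
  moreover have "h (u - w) v = 0" if "v \<in> T" for v
  proof -
    have "v \<in> span (set es)" using that es by simp
    then show ?thesis
    proof (rule span_induct_alt[where h = "\<lambda>v. h (u - w) v = 0"])
      show "h (u - w) 0 = 0" by (rule linear_0[OF ip_linear])
      fix c x y assume x: "x \<in> set es" and y: "h (u - w) y = 0"
      have "h (u - w) x = 0"
        using linear_diff[OF ip_linear_left] orthonormal_list_coeff[OF es(1) x, of "h u"] by (simp add: w_def)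
      then show "h (u - w) (c *\<^sub>R x + y) = 0"
        using y linear_add[OF ip_linear] linear_scale[OF ip_linear] by simp
    qed
  qed
  ultimately show ?thesis by (auto simp: orthogonal_complement_def)
qed

text \<open>The connection form will be evaluated at vectors tangent to the orbit, so this is the
  case of the projection that matters.\<close>

lemma orthogonal_projection_ident:
  assumes T: "subspace T" and u: "u \<in> T"
  shows "orthogonal_projection h T u = u"
  unfolding orthogonal_projection_def
proof (rule the_equality)
  show "u \<in> T \<and> u - u \<in> orthogonal_complement h T"
    using u linear_0[OF ip_linear_left] by (simp add: orthogonal_complement_def)
  fix w assume w: "w \<in> T \<and> u - w \<in> orthogonal_complement h T"
  then have "u - w \<in> T" using u T subspace_diff by blast
  then have "h (u - w) (u - w) = 0" using w by (auto simp: orthogonal_complement_def)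
  then show "w = u" by (simp add: ip_zero_iff)
qed

lemma euclidean_volume_form_abs:
  assumes or: "orientation \<epsilon>" and vol: "euclidean_volume_form h \<epsilon> \<mu>" and es: "orthonormal_basis h es"
  shows "\<bar>\<mu> es\<bar> = 1"
proof -
  have "ordered_basis UNIV es" using es by (simp add: orthonormal_basis_def)
  then show ?thesis using or vol es by (auto simp: orientation_def euclidean_volume_form_def abs_sgn_eq)
qed

text \<open>The form \<open>\<omega>\<close> behind the orientation and the volume form
  \<open>\<mu>\<close> are proportional. On an orthonormal basis \<open>es\<close> the second is the
  sign of the first, so the factor between them is the absolute value of \<open>\<omega> es\<close>.
  It is positive, and the two forms have the same sign on every basis.\<close>

lemma orientation_volume_form:
  fixes \<mu> :: "'e list \<Rightarrow> real"
  assumes or: "orientation \<epsilon>" and vol: "euclidean_volume_form h \<epsilon> \<mu>" and bs: "ordered_basis UNIV bs"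
  shows "\<epsilon> bs * \<mu> bs = \<bar>\<mu> bs\<bar>" and "\<mu> bs \<noteq> 0"
proof -
  obtain \<omega> where \<omega>: "top_form \<omega>" "\<And>bs. ordered_basis UNIV bs \<Longrightarrow> \<omega> bs \<noteq> 0 \<and> \<epsilon> bs = sgn (\<omega> bs)"
    using or by (auto simp: orientation_def)
  obtain es where es: "orthonormal_basis h es" using ex_orthonormal_basis[OF bs] by blast
  then have esb: "ordered_basis UNIV es" by (simp add: orthonormal_basis_def)
  have "\<mu> es = sgn (\<omega> es)" using vol es \<omega>(2)[OF esb] by (simp add: euclidean_volume_form_def)
  moreover have "\<omega> bs * \<mu> es = \<mu> bs * \<omega> es"
    using \<omega>(1) vol esb ordered_basis_length[OF bs]
    by (intro top_form_proportional) (auto simp: euclidean_volume_form_def)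
  ultimately have "\<omega> bs * sgn (\<omega> es) = \<mu> bs * \<omega> es" by simp
  then have eq: "\<omega> bs = \<mu> bs * \<bar>\<omega> es\<bar>"
    using \<omega>(2)[OF esb] by (cases "\<omega> es > 0") (auto simp: sgn_if)
  then show "\<mu> bs \<noteq> 0" using \<omega>(2)[OF bs] by auto
  have "sgn (\<omega> bs) = sgn (\<mu> bs)"
    unfolding eq using \<omega>(2)[OF esb] by (simp add: sgn_mult)
  then show "\<epsilon> bs * \<mu> bs = \<bar>\<mu> bs\<bar>" using \<omega>(2)[OF bs] by (simp add: sgn_if)
qed

end

section \<open>Volume forms and Riemannian submersions, pointwise\<close>

text \<open>Both sides are top-degree in \<open>ws\<close>, and the left-hand side depends on \<open>us\<close> only modulo the
  kernel of \<open>D\<close>, so it is enough to compare them on a basis consisting of horizontal lifts of an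
  orthonormal basis and the image under \<open>Q\<close> of an orthonormal basis.\<close>

lemma submersion_volume:
  fixes D :: "'e::real_vector \<Rightarrow> 'f::real_vector" and Q :: "'k::real_vector \<Rightarrow> 'e"
  assumes ipP: "inner_product hP" and ipB: "inner_product hB" and ipg: "inner_product hg"
    and bP: "ordered_basis UNIV (bP :: 'e list)" and bF: "ordered_basis UNIV (bF :: 'f list)"
    and bK: "ordered_basis UNIV (bK :: 'k list)"
    and D: "linear D" "surj D" and Q: "linear Q" "range Q = {v. D v = 0}"
    and sub: "\<And>u v. u \<in> orthogonal_complement hP {v. D v = 0} \<Longrightarrow>
        v \<in> orthogonal_complement hP {v. D v = 0} \<Longrightarrow> hB (D u) (D v) = hP u v"
    and iso: "\<And>a b. hP (Q a) (Q b) = hg a b"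
    and top: "top_form \<mu>P" "top_form \<mu>B" "top_form \<mu>g"
    and unit: "\<And>es. orthonormal_basis hP es \<Longrightarrow> \<bar>\<mu>P es\<bar> = 1"
      "\<And>es. orthonormal_basis hB es \<Longrightarrow> \<bar>\<mu>B es\<bar> = 1"
      "\<And>es. orthonormal_basis hg es \<Longrightarrow> \<bar>\<mu>g es\<bar> = 1"
  shows "dim (UNIV :: 'f set) + dim (UNIV :: 'k set) = dim (UNIV :: 'e set)"
    and "length us = dim (UNIV :: 'f set) \<Longrightarrow> length ws = dim (UNIV :: 'k set) \<Longrightarrow>
      \<bar>\<mu>P (us @ map Q ws)\<bar> = \<bar>\<mu>B (map D us)\<bar> * \<bar>\<mu>g ws\<bar>"
proof -
  let ?K = "{v. D v = 0}"
  let ?H = "orthogonal_complement hP ?K"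
  have K: "subspace ?K" using D(1) by (rule linear_subspace_kernel)
  obtain a0 where a0: "orthonormal_basis hB a0" using ex_orthonormal_basis[OF ipB bF] by blast
  obtain k0 where k0: "orthonormal_basis hg k0" using ex_orthonormal_basis[OF ipg bK] by blast
  have a0b: "ordered_basis UNIV a0" and k0b: "ordered_basis UNIV k0"
    using a0 k0 by (auto simp: orthonormal_basis_def)
  have la0: "length a0 = dim (UNIV :: 'f set)" and lk0: "length k0 = dim (UNIV :: 'k set)"
    using ordered_basis_length a0b k0b by auto
  have "\<exists>e. D e = a \<and> e \<in> ?H" for a
  proof -
    obtain u where u: "D u = a" using D(2) by (metis surjD)
    obtain w where "w \<in> ?K" "u - w \<in> ?H" using orthogonal_decomposition[OF ipP bP K] by blast
    then show ?thesis using u linear_diff[OF D(1)] by (intro exI[of _ "u - w"]) auto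
  qed
  then obtain l where l: "\<And>a. D (l a) = a" "\<And>a. l a \<in> ?H" by metis
  define es where "es = map l a0"
  let ?E = "es @ map Q k0"
  have horver: "hP (l a) (Q k) = 0" "hP (Q k) (l a) = 0" for a k
  proof -
    have "Q k \<in> ?K" using Q(2) by blast
    then show "hP (l a) (Q k) = 0" using l(2)[of a] by (auto simp: orthogonal_complement_def)
    then show "hP (Q k) (l a) = 0" by (simp add: ip_commute[OF ipP])
  qed
  have oE: "orthonormal_list hP ?E"
    unfolding orthonormal_list_def
  proof (intro allI impI)
    fix i j assume i: "i < length ?E" and j: "j < length ?E"
    consider "i < length a0" "j < length a0" | "i < length a0" "\<not> j < length a0"
      | "\<not> i < length a0" "j < length a0" | "\<not> i < length a0" "\<not> j < length a0" by blast
    then show "hP (?E ! i) (?E ! j) = (if i = j then 1 else 0)"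
    proof cases
      case 1
      then show ?thesis
        using a0 l sub[OF l(2) l(2)] by (simp add: es_def nth_append orthonormal_basis_def)
    next
      case 4
      then have "i - length a0 < length k0" "j - length a0 < length k0" using i j by (auto simp: es_def)
      then show ?thesis
        using 4 k0 by (auto simp: es_def nth_append orthonormal_basis_def iso)
    qed (use i j in \<open>auto simp: es_def nth_append horver\<close>)
  qed
  have spQ: "span (Q ` set k0) = ?K"
    using linear_span_image[OF Q(1)] k0b Q(2) by (simp add: ordered_basis_def)
  have spE: "span (set ?E) = UNIV"
  proof (intro equalityI subsetI UNIV_I)
    fix u :: 'e
    have "D ` set es = set a0" using l(1) by (auto simp: es_def image_image)
    then have "D ` span (set es) = UNIV"
      using linear_span_image[OF D(1), of "set es"] a0b by (simp add: ordered_basis_def)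
    then obtain u' where u': "u' \<in> span (set es)" "D u = D u'" by (metis UNIV_I imageE)
    then have "u - u' \<in> span (Q ` set k0)" unfolding spQ using linear_diff[OF D(1)] by simp
    then have "u' + (u - u') \<in> span (set ?E)"
      using u' span_mono[of "set es" "set ?E"] span_mono[of "Q ` set k0" "set ?E"]
      by (intro span_add) auto
    then show "u \<in> span (set ?E)" by simp
  qed
  have Eb: "orthonormal_basis hP ?E"
    using oE spE orthonormal_list_distinct[OF ipP oE] orthonormal_list_independent[OF ipP oE]
    unfolding orthonormal_basis_def ordered_basis_def orthonormal_list_def by blast
  then have "ordered_basis UNIV ?E" by (simp add: orthonormal_basis_def)
  from ordered_basis_length[OF this]
  show dims: "dim (UNIV :: 'f set) + dim (UNIV :: 'k set) = dim (UNIV :: 'e set)"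
    by (simp add: es_def la0 lk0)
  assume lus: "length us = dim (UNIV :: 'f set)" and lws: "length ws = dim (UNIV :: 'k set)"
  define \<eta> where "\<eta> = (\<lambda>us. \<mu>P (us @ map Q k0))"
  have eq1: "\<mu>P (us @ map Q ws) * \<mu>g k0 = \<mu>g ws * \<eta> us"
    unfolding \<eta>_def
    by (rule top_form_proportional[OF top_form_append_right[OF top(1) Q(1)] top(3) k0b lws])
      (use dims lus in simp)
  \<comment> \<open>Entries are replaced from the left one at a time. Each difference lies in the
    kernel of \<open>D\<close>, hence in the span of the entries \<open>map Q k0\<close> that are
    already present in the list.\<close>
  have mod: "\<eta> us' = \<eta> us"
    if len: "length us = dim (UNIV :: 'f set)" "length us' = dim (UNIV :: 'f set)"
      and eq: "\<And>i. i < dim (UNIV :: 'f set) \<Longrightarrow> D (us' ! i) = D (us ! i)" for us us'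
  proof -
    have "\<eta> (take t us' @ drop t us) = \<eta> us" if "t \<le> length us" for t
      using that
    proof (induction t)
      case 0
      then show ?case by simp
    next
      case (Suc t)
      define zs where "zs = take t us' @ drop t us"
      have t: "t < length us" "t < length us'" using Suc.prems len by auto
      have s1: "zs[t := us ! t] = zs" "zs[t := us' ! t] = take (Suc t) us' @ drop (Suc t) us"
        using t len by (auto simp: zs_def list_update_append min_def take_Suc_conv_app_nth
            Cons_nth_drop_Suc[symmetric] simp del: Cons_nth_drop_Suc)
      have lz: "length (zs @ map Q k0) = dim (UNIV :: 'e set)"
        using dims lk0 len t by (simp add: zs_def)
      have tz: "t < length zs" "t < length (zs @ map Q k0)" using t len by (auto simp: zs_def)
      note lin = top_form_linear[OF top(1) lz tz(2)]
      have "us' ! t - us ! t \<in> span (Q ` set k0)"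
        unfolding spQ using eq[of t] t len linear_diff[OF D(1)] by simp
      moreover have "Q ` set k0 \<subseteq> {(zs @ map Q k0) ! j |j. j < length (zs @ map Q k0) \<and> j \<noteq> t}"
      proof
        fix x assume "x \<in> Q ` set k0"
        then obtain i where i: "i < length k0" "x = Q (k0 ! i)" by (auto simp: in_set_conv_nth)
        then show "x \<in> {(zs @ map Q k0) ! j |j. j < length (zs @ map Q k0) \<and> j \<noteq> t}"
          using tz by (intro CollectI exI[of _ "length zs + i"]) (auto simp: nth_append)
      qed
      ultimately have "us' ! t - us ! t \<in> span {(zs @ map Q k0) ! j |j. j < length (zs @ map Q k0) \<and> j \<noteq> t}"
        using span_mono by blast
      then have "\<mu>P ((zs @ map Q k0)[t := us' ! t - us ! t]) = 0"
        by (rule top_form_span[OF top(1) lz tz(2)])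
      then have "\<mu>P ((zs @ map Q k0)[t := us' ! t]) = \<mu>P ((zs @ map Q k0)[t := us ! t])"
        using linear_diff[OF lin] by simp
      then have "\<eta> (zs[t := us' ! t]) = \<eta> (zs[t := us ! t])"
        using tz by (simp add: \<eta>_def list_update_append)
      then show ?case using Suc s1 by (simp add: zs_def)
    qed
    from this[of "length us"] show ?thesis using len by simp
  qed
  \<comment> \<open>The horizontal lift \<open>l\<close> was chosen point by point and is not known
    to be linear. Pulling \<open>\<eta>\<close> back to a form on the base needs a linear section;
    it differs from \<open>l\<close> by vectors of the kernel, to which \<open>\<eta>\<close> is
    insensitive by \<open>mod\<close>.\<close>
  obtain A where A: "linear A" "\<And>x. D (A x) = x"
    using linear_surj_right_inverse[OF D(1), of UNIV UNIV] D(2) by (auto simp: span_UNIV)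
  have "\<eta> us = \<eta> (map A (map D us))" by (rule mod) (use lus A in auto)
  moreover have "\<eta> (map A a0) = \<eta> es" by (rule mod) (use la0 A l in \<open>auto simp: es_def\<close>)
  moreover have "\<eta> (map A (map D us)) * \<mu>B a0 = \<mu>B (map D us) * \<eta> (map A a0)"
    unfolding \<eta>_def
    by (rule top_form_proportional[OF top_form_append_left[OF top(1) A(1)] top(2) a0b])
      (use dims lus lk0 in auto)
  ultimately have "\<eta> us * \<mu>B a0 = \<mu>B (map D us) * \<eta> es" by simp
  moreover have "\<bar>\<eta> es\<bar> = 1" "\<bar>\<mu>B a0\<bar> = 1" "\<bar>\<mu>g k0\<bar> = 1"
    using unit Eb a0 k0 by (auto simp: \<eta>_def)
  ultimately have "\<bar>\<eta> us\<bar> = \<bar>\<mu>B (map D us)\<bar>" by (metis abs_mult mult.right_neutral)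
  then show "\<bar>\<mu>P (us @ map Q ws)\<bar> = \<bar>\<mu>B (map D us)\<bar> * \<bar>\<mu>g ws\<bar>"
    using eq1 \<open>\<bar>\<mu>g k0\<bar> = 1\<close> by (metis abs_mult mult.commute mult.right_neutral)
qed

section \<open>Coordinates and determinants\<close>

text \<open>The change of variables theorem lives on \<open>real^'n\<close>. The following index type has \<open>dim UNIV\<close>
  elements, except that it must not be empty in dimension 0.\<close>

typedef (overloaded) ('e::real_vector) basis_index = "{i::nat. i = 0 \<or> i < dim (UNIV :: 'e set)}"
  by auto

text \<open>The change of variables theorem on \<open>real^'n\<close> asks for a finite well-ordered
  index type; the order is inherited from the natural numbers.\<close>

instantiation basis_index :: (real_vector) wellorder
begin

definition less_eq_basis_index :: "'a basis_index \<Rightarrow> 'a basis_index \<Rightarrow> bool" where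
  "less_eq_basis_index i j \<longleftrightarrow> Rep_basis_index i \<le> Rep_basis_index j"

definition less_basis_index :: "'a basis_index \<Rightarrow> 'a basis_index \<Rightarrow> bool" where
  "less_basis_index i j \<longleftrightarrow> Rep_basis_index i < Rep_basis_index j"

instance
proof
  fix P :: "'a basis_index \<Rightarrow> bool" and a :: "'a basis_index"
  assume step: "\<And>x. (\<And>y. y < x \<Longrightarrow> P y) \<Longrightarrow> P x"
  show "P a"
    by (induction "Rep_basis_index a" arbitrary: a rule: less_induct)
      (rule step, auto simp: less_basis_index_def)
qed (auto simp: less_eq_basis_index_def less_basis_index_def Rep_basis_index_inject)

end

instance basis_index :: (real_vector) finite
proof
  have "finite {i::nat. i = 0 \<or> i < dim (UNIV :: 'a set)}" by auto
  moreover have "(UNIV :: 'a basis_index set) = Abs_basis_index ` {i. i = 0 \<or> i < dim (UNIV :: 'a set)}"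
    by (metis (mono_tags, lifting) type_definition.Abs_image type_definition_basis_index)
  ultimately show "finite (UNIV :: 'a basis_index set)" by (metis finite_imageI)
qed

lemma bij_betw_Rep_basis_index:
  assumes "dim (UNIV :: 'e::real_vector set) \<noteq> 0"
  shows "bij_betw Rep_basis_index (UNIV :: 'e basis_index set) {..<dim (UNIV :: 'e set)}"
proof -
  have "range (Rep_basis_index :: 'e basis_index \<Rightarrow> nat) = {i. i = 0 \<or> i < dim (UNIV :: 'e set)}"
    by (rule type_definition.Rep_range[OF type_definition_basis_index])
  also have "\<dots> = {..<dim (UNIV :: 'e set)}" using assms by auto
  finally show ?thesis by (auto simp: bij_betw_def inj_def Rep_basis_index_inject)
qed

definition list_coord :: "'e::real_vector list \<Rightarrow> nat \<Rightarrow> 'e \<Rightarrow> real" where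
  "list_coord bs i v = representation (set bs) v (bs ! i)"

lemma list_coord:
  fixes bs :: "'e::real_vector list"
  assumes bs: "ordered_basis UNIV bs"
  shows "linear (list_coord bs i)"
    and "(\<Sum>i<length bs. list_coord bs i v *\<^sub>R bs ! i) = v"
    and "i < length bs \<Longrightarrow> list_coord bs i (\<Sum>j<length bs. t j *\<^sub>R bs ! j) = t i"
    and "i < length bs \<Longrightarrow> j < length bs \<Longrightarrow> list_coord bs i (bs ! j) = (if i = j then 1 else 0)"
proof -
  have b: "independent (set bs)" "\<And>v. v \<in> span (set bs)" "distinct bs"
    using bs by (auto simp: ordered_basis_def)
  show lin: "linear (list_coord bs i)" for i
    unfolding list_coord_def
    by (rule linearI) (simp_all add: representation_add[OF b(1,2,2)] representation_scale[OF b(1,2)])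
  show one: "list_coord bs i (bs ! j) = (if i = j then 1 else 0)" if "i < length bs" "j < length bs" for i j
    using that b by (simp add: list_coord_def representation_basis nth_eq_iff_index_eq)
  show "list_coord bs i (\<Sum>j<length bs. t j *\<^sub>R bs ! j) = t i" if i: "i < length bs"
  proof -
    have "list_coord bs i (\<Sum>j<length bs. t j *\<^sub>R bs ! j) = (\<Sum>j<length bs. if i = j then t j else 0)"
      unfolding linear_sum[OF lin] linear_scale[OF lin] by (intro sum.cong) (auto simp: one i)
    then show ?thesis using i by simp
  qed
  have "bij_betw ((!) bs) {..<length bs} (set bs)" using b(3) by (simp add: bij_betw_nth)
  from sum.reindex_bij_betw[OF this, of "\<lambda>b. representation (set bs) v b *\<^sub>R b"]
  show "(\<Sum>i<length bs. list_coord bs i v *\<^sub>R bs ! i) = v"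
    unfolding list_coord_def using sum_representation_eq[OF b(1,2) _ order_refl, of v] by simp
qed

text \<open>In dimension 0 the index type still has one element, so the matrix would not be the
  empty one; the value 1 of the empty determinant is put in by hand.\<close>

definition basis_det :: "'e::real_vector list \<Rightarrow> 'e list \<Rightarrow> real" where
  "basis_det bs vs = (if dim (UNIV :: 'e set) = 0 then 1 else
     det (\<chi> (i::'e basis_index) (j::'e basis_index). list_coord bs (Rep_basis_index j) (vs ! Rep_basis_index i)))"

text \<open>The functionals \<open>c j\<close> are arbitrary so that the lemma serves both
  coordinates in a basis and, in the Gram determinant, inner products with fixed vectors.\<close>

lemma top_form_det:
  fixes c :: "nat \<Rightarrow> 'e::real_vector \<Rightarrow> real"
  assumes n: "dim (UNIV :: 'e set) \<noteq> 0" and lin: "\<And>j. linear (c j)"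
  shows "top_form (\<lambda>vs. det (\<chi> (i::'e basis_index) (j::'e basis_index).
    c (Rep_basis_index j) (vs ! Rep_basis_index i)))" (is "top_form (\<lambda>vs. det (?M vs))")
  unfolding top_form_def
proof (intro allI impI conjI)
  fix vs :: "'e list" and p assume l: "length vs = dim (UNIV :: 'e set)" and p: "p < length vs"
  obtain k :: "'e basis_index" where k: "Rep_basis_index k = p"
    using bij_betw_Rep_basis_index[OF n] p l by (metis bij_betw_iff_bijections lessThan_iff)
  have upd: "?M (vs[p := v]) = (\<chi> i. if i = k then (\<chi> j. c (Rep_basis_index j) v) else row i (?M vs))" for v
  proof -
    have "vs[p := v] ! Rep_basis_index i = (if i = k then v else vs ! Rep_basis_index i)" for i :: "'e basis_index"
      using k p by (metis Rep_basis_index_inject nth_list_update_eq nth_list_update_neq)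
    then show ?thesis by (simp add: vec_eq_iff row_def)
  qed
  show "linear (\<lambda>v. det (?M (vs[p := v])))"
  proof (rule linearI)
    fix v w :: 'e and r :: real
    have "(\<chi> j::'e basis_index. c (Rep_basis_index j) (v + w)) =
        (\<chi> j. c (Rep_basis_index j) v) + (\<chi> j. c (Rep_basis_index j) w)"
      by (simp add: vec_eq_iff linear_add[OF lin])
    then show "det (?M (vs[p := v + w])) = det (?M (vs[p := v])) + det (?M (vs[p := w]))"
      unfolding upd by (simp only: det_row_add)
    have "(\<chi> j::'e basis_index. c (Rep_basis_index j) (r *\<^sub>R v)) = r *s (\<chi> j. c (Rep_basis_index j) v)"
      by (simp add: vec_eq_iff linear_scale[OF lin])
    then show "det (?M (vs[p := r *\<^sub>R v])) = r *\<^sub>R det (?M (vs[p := v]))"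
      unfolding upd by (simp only: det_row_mul real_scaleR_def)
  qed
  fix q assume q: "q < p" "vs ! p = vs ! q"
  obtain m :: "'e basis_index" where m: "Rep_basis_index m = q"
    using bij_betw_Rep_basis_index[OF n] p q l by (metis bij_betw_iff_bijections lessThan_iff order.strict_trans)
  have "m \<noteq> k" using m k q by auto
  moreover have "row m (?M vs) = row k (?M vs)" using m k q by (simp add: row_def)
  ultimately show "det (?M vs) = 0" by (rule det_identical_rows)
qed

lemma basis_det:
  fixes bs :: "'e::real_vector list"
  assumes bs: "ordered_basis UNIV bs"
  shows "top_form (basis_det bs)" and "basis_det bs bs = 1"
proof -
  show "top_form (basis_det bs)"
  proof (cases "dim (UNIV :: 'e set) = 0")
    case True
    then show ?thesis by (auto simp: basis_det_def top_form_def)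
  next
    case False
    then show ?thesis
      unfolding basis_det_def using top_form_det[OF False list_coord(1)[OF bs]] by simp
  qed
  show "basis_det bs bs = 1"
  proof (cases "dim (UNIV :: 'e set) = 0")
    case True
    then show ?thesis by (simp add: basis_det_def)
  next
    case False
    have "Rep_basis_index i < length bs" for i :: "'e basis_index"
      using bij_betw_Rep_basis_index[OF False] ordered_basis_length[OF bs] by (auto simp: bij_betw_def)
    then have "(\<chi> (i::'e basis_index) (j::'e basis_index). list_coord bs (Rep_basis_index j) (bs ! Rep_basis_index i)) = mat 1"
      by (auto simp: vec_eq_iff mat_def list_coord(4)[OF bs] Rep_basis_index_inject)
    then show ?thesis using False by (simp add: basis_det_def)
  qed
qed

lemma top_form_basis_det:
  fixes bs :: "'e::real_vector list"
  assumes "top_form \<omega>" "ordered_basis UNIV bs" "length vs = dim (UNIV :: 'e set)"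
  shows "\<omega> vs = basis_det bs vs * \<omega> bs"
  using top_form_proportional[OF assms(1) basis_det(1)[OF assms(2)] assms(2,3)] basis_det(2)[OF assms(2)]
  by simp

text \<open>Gram determinant: as a form in the row vectors it is a multiple of \<open>\<mu>\<close>, and so it is in the
  column vectors.\<close>

lemma gram_det:
  fixes \<mu> :: "'e::real_vector list \<Rightarrow> real"
  assumes ip: "inner_product h" and n: "dim (UNIV :: 'e set) \<noteq> 0" and bs: "ordered_basis UNIV (bs :: 'e list)"
    and top: "top_form \<mu>" and unit: "\<And>es. orthonormal_basis h es \<Longrightarrow> \<bar>\<mu> es\<bar> = 1"
    and l: "length vs = dim (UNIV :: 'e set)"
  shows "(\<mu> vs)\<^sup>2 = det (\<chi> (i::'e basis_index) (j::'e basis_index). h (vs ! Rep_basis_index i) (vs ! Rep_basis_index j))"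
proof -
  define g where "g = (\<lambda>us vs. det (\<chi> (i::'e basis_index) (j::'e basis_index). h (vs ! Rep_basis_index j) (us ! Rep_basis_index i)))"
  obtain es where es: "orthonormal_basis h es" using ex_orthonormal_basis[OF ip bs] by blast
  then have esb: "ordered_basis UNIV es" by (simp add: orthonormal_basis_def)
  have top': "top_form (\<lambda>us. g us vs)" for vs
    unfolding g_def by (rule top_form_det[OF n]) (rule ip_linear[OF ip])
  have sym: "g us vs = g vs us" for us vs
    unfolding g_def by (subst det_transpose[symmetric]) (simp add: transpose_def ip_commute[OF ip])
  have "Rep_basis_index i < length es" for i :: "'e basis_index"
    using bij_betw_Rep_basis_index[OF n] ordered_basis_length[OF esb] by (auto simp: bij_betw_def)
  then have "(\<chi> (i::'e basis_index) (j::'e basis_index). h (es ! Rep_basis_index j) (es ! Rep_basis_index i)) = mat 1"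
    using es by (auto simp: vec_eq_iff mat_def orthonormal_basis_def Rep_basis_index_inject)
  then have "g es es = 1" by (simp add: g_def)
  have "g vs vs * (\<mu> es)\<^sup>2 = (g vs vs * \<mu> es) * \<mu> es" by (simp add: power2_eq_square)
  also have "\<dots> = \<mu> vs * (g es vs * \<mu> es)"
    using top_form_proportional[OF top' top esb l, of vs] by simp
  also have "\<dots> = \<mu> vs * (\<mu> vs * g es es)"
    using top_form_proportional[OF top' top esb l, of es] by (simp add: sym)
  finally have "g vs vs = (\<mu> vs)\<^sup>2"
    using unit[OF es] \<open>g es es = 1\<close> by (auto simp: power2_eq_square abs_if split: if_splits)
  then show ?thesis by (simp add: g_def ip_commute[OF ip])
qed

section \<open>Lebesgue measure with respect to a basis\<close>

definition coord_sum :: "'e::real_vector list \<Rightarrow> (nat \<Rightarrow> real) \<Rightarrow> 'e" where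
  "coord_sum bs t = (\<Sum>i<length bs. t i *\<^sub>R bs ! i)"

text \<open>The measure behind \<open>chart_integral\<close>, moved from coordinate tuples to the
  model space, where charts and their transition maps live.\<close>

definition basis_lborel :: "'e::real_normed_vector list \<Rightarrow> 'e measure" where
  "basis_lborel bs = distr (\<Pi>\<^sub>M i\<in>{..<length bs}. (lborel :: real measure)) borel (coord_sum bs)"

text \<open>The index type is built from a type \<open>'i\<close> independent of \<open>'e\<close>:
  when two model spaces of equal dimension are compared, both must be parametrised by the same
  \<open>real^'n\<close>.\<close>

definition vec_sum :: "'e::real_vector list \<Rightarrow> real ^ ('i::real_vector basis_index) \<Rightarrow> 'e" where
  "vec_sum bs v = (\<Sum>k\<in>UNIV. v $ k *\<^sub>R bs ! Rep_basis_index k)"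

definition vec_coord :: "'e::real_vector list \<Rightarrow> 'e \<Rightarrow> real ^ ('i::real_vector basis_index)" where
  "vec_coord bs v = (\<chi> k. list_coord bs (Rep_basis_index k) v)"

lemma sets_basis_lborel [simp, measurable_cong]: "sets (basis_lborel bs) = sets borel"
  by (simp add: basis_lborel_def)

lemma space_basis_lborel [simp]: "space (basis_lborel bs) = UNIV"
  by (simp add: basis_lborel_def)

context
  fixes bs :: "'e::real_normed_vector list"
    and ty :: "'i::real_normed_vector itself"
  assumes bs: "ordered_basis UNIV bs"
    and len: "length bs = dim (UNIV :: 'i set)" and nz: "dim (UNIV :: 'i set) \<noteq> 0"
begin

lemma Rep_basis_index_less: "Rep_basis_index (k :: 'i basis_index) < length bs"
  using bij_betw_Rep_basis_index[OF nz] len by (auto simp: bij_betw_def)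

lemma vec_sum_coord: "vec_sum bs (vec_coord bs v :: real ^ ('i basis_index)) = v"
proof -
  have "vec_sum bs (vec_coord bs v :: real ^ ('i basis_index)) =
      (\<Sum>k\<in>(UNIV :: 'i basis_index set). list_coord bs (Rep_basis_index k) v *\<^sub>R bs ! Rep_basis_index k)"
    by (simp add: vec_sum_def vec_coord_def)
  also have "\<dots> = (\<Sum>i<length bs. list_coord bs i v *\<^sub>R bs ! i)"
    using sum.reindex_bij_betw[OF bij_betw_Rep_basis_index[OF nz], of "\<lambda>i. list_coord bs i v *\<^sub>R bs ! i"]
    by (simp add: len)
  finally show ?thesis using list_coord(2)[OF bs] by simp
qed

lemma vec_coord_sum: "vec_coord bs (vec_sum bs v) = (v :: real ^ ('i basis_index))"
proof -
  let ?inv = "inv_into UNIV (Rep_basis_index :: 'i basis_index \<Rightarrow> nat)"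
  have "inj (Rep_basis_index :: 'i basis_index \<Rightarrow> nat)"
    using bij_betw_Rep_basis_index[OF nz] by (auto simp: bij_betw_def)
  then have inv: "?inv (Rep_basis_index k) = k" for k by simp
  have "vec_sum bs v = (\<Sum>i<length bs. v $ ?inv i *\<^sub>R bs ! i)"
    using sum.reindex_bij_betw[OF bij_betw_Rep_basis_index[OF nz], of "\<lambda>i. v $ ?inv i *\<^sub>R bs ! i"]
    by (simp add: vec_sum_def len inv)
  then show ?thesis
    by (simp add: vec_eq_iff vec_coord_def list_coord(3)[OF bs Rep_basis_index_less] inv)
qed

lemma linear_vec_sum: "linear (vec_sum bs :: real ^ ('i basis_index) \<Rightarrow> 'e)"
  by (rule linearI) (simp_all add: vec_sum_def scaleR_add_left sum.distrib scaleR_right.sum)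

lemma bounded_linear_vec_sum: "bounded_linear (vec_sum bs :: real ^ ('i basis_index) \<Rightarrow> 'e)"
  using linear_vec_sum by (simp add: linear_conv_bounded_linear)

text \<open>\<open>vec_sum\<close> is bounded below on the compact unit sphere.\<close>

lemma bounded_linear_vec_coord: "bounded_linear (vec_coord bs :: 'e \<Rightarrow> real ^ ('i basis_index))"
proof -
  let ?T = "vec_sum bs :: real ^ ('i basis_index) \<Rightarrow> 'e"
  let ?C = "vec_coord bs :: 'e \<Rightarrow> real ^ ('i basis_index)"
  have "continuous_on (sphere 0 1) (\<lambda>v. norm (?T v))"
    using bounded_linear_vec_sum by (intro continuous_intros linear_continuous_on)
  moreover have "compact (sphere 0 1 :: (real ^ ('i basis_index)) set)" "sphere 0 1 \<noteq> ({} :: (real ^ ('i basis_index)) set)"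
    by auto
  ultimately obtain v0 :: "real ^ ('i basis_index)"
    where v0: "v0 \<in> sphere 0 1" "\<And>v. v \<in> sphere 0 1 \<Longrightarrow> norm (?T v0) \<le> norm (?T v)"
    using continuous_attains_inf[of "sphere 0 1 :: (real ^ ('i basis_index)) set" "\<lambda>v. norm (?T v)"] by blast
  have "?T v0 \<noteq> 0"
  proof
    assume "?T v0 = 0"
    then have "v0 = ?C 0" using vec_coord_sum[of v0] by simp
    also have "?C 0 = 0" by (simp add: vec_eq_iff vec_coord_def linear_0[OF list_coord(1)[OF bs]])
    finally show False using v0 by simp
  qed
  then have pos: "norm (?T v0) > 0" by simp
  have below: "norm (?T v0) * norm v \<le> norm (?T v)" for v
  proof (cases "v = 0")
    case False
    then have "norm (?T v0) \<le> norm (?T ((1 / norm v) *\<^sub>R v))" by (intro v0) simp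
    also have "\<dots> = norm (?T v) / norm v" by (simp add: linear_scale[OF linear_vec_sum])
    finally show ?thesis using False by (simp add: pos_le_divide_eq)
  qed simp
  show ?thesis
  proof (rule bounded_linear_intro)
    fix x y :: 'e and r :: real
    show "?C (x + y) = ?C x + ?C y"
      by (simp add: vec_eq_iff vec_coord_def linear_add[OF list_coord(1)[OF bs]])
    show "?C (r *\<^sub>R x) = r *\<^sub>R ?C x"
      by (simp add: vec_eq_iff vec_coord_def linear_scale[OF list_coord(1)[OF bs]])
    show "norm (?C x) \<le> norm x * (1 / norm (?T v0))"
      using below[of "?C x"] pos by (simp add: vec_sum_coord field_simps)
  qed
qed

text \<open>Lebesgue measure on \<open>real^'n\<close> is characterised by its values on boxes.
  Reindexing tuples by \<open>Rep_basis_index\<close> matches boxes with product sets, so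
  \<open>lborel\<close> is the image of the product measure, and \<open>coord_sum\<close> factors
  through this reindexing.\<close>

lemma basis_lborel_vec_sum:
  "coord_sum bs \<in> (\<Pi>\<^sub>M i\<in>{..<length bs}. (lborel :: real measure)) \<rightarrow>\<^sub>M borel"
  "basis_lborel bs = distr lborel borel (vec_sum bs :: real ^ ('i basis_index) \<Rightarrow> 'e)"
proof -
  let ?P = "\<Pi>\<^sub>M i\<in>{..<length bs}. (lborel :: real measure)"
  let ?R = "\<lambda>t. (\<chi> k. t (Rep_basis_index k)) :: real ^ ('i basis_index)"
  interpret product_sigma_finite "\<lambda>_::nat. lborel :: real measure"
    by standard
  note bij = bij_betw_Rep_basis_index[OF nz, folded len]
  have mR: "?R \<in> ?P \<rightarrow>\<^sub>M borel"
    by (rule borel_measurable_euclidean_space[THEN iffD2])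
      (use Rep_basis_index_less in \<open>auto simp: Basis_vec_def inner_axis\<close>)
  have lb: "lborel = distr ?P borel ?R"
  proof (rule lborel_eqI)
    fix l u :: "real ^ ('i basis_index)"
    assume le: "\<And>b. b \<in> Basis \<Longrightarrow> l \<bullet> b \<le> u \<bullet> b"
    let ?inv = "inv_into UNIV (Rep_basis_index :: 'i basis_index \<Rightarrow> nat)"
    have inv: "?inv (Rep_basis_index k) = k" for k :: "'i basis_index"
      using bij by (simp add: bij_betw_def)
    have le': "l $ k \<le> u $ k" for k using le[of "axis k 1"] by (simp add: inner_axis)
    have "?R -` box l u \<inter> space ?P = (\<Pi>\<^sub>E i\<in>{..<length bs}. {l $ ?inv i <..< u $ ?inv i})"
    proof (intro equalityI subsetI)
      fix t assume t: "t \<in> ?R -` box l u \<inter> space ?P"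
      have "t i \<in> {l $ ?inv i <..< u $ ?inv i}" if i: "i < length bs" for i
      proof -
        obtain k :: "'i basis_index" where k: "i = Rep_basis_index k"
          using bij i by (metis bij_betw_iff_bijections lessThan_iff)
        show ?thesis unfolding k inv using t by (simp add: mem_box_cart)
      qed
      then show "t \<in> (\<Pi>\<^sub>E i\<in>{..<length bs}. {l $ ?inv i <..< u $ ?inv i})"
        using t by (simp add: space_PiM PiE_iff)
    next
      fix t assume t: "t \<in> (\<Pi>\<^sub>E i\<in>{..<length bs}. {l $ ?inv i <..< u $ ?inv i})"
      have "t (Rep_basis_index k) \<in> {l $ k <..< u $ k}" for k :: "'i basis_index"
        using PiE_mem[OF t, of "Rep_basis_index k"] Rep_basis_index_less[of k] by (simp only: inv lessThan_iff)
      then show "t \<in> ?R -` box l u \<inter> space ?P"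
        using t by (simp add: space_PiM PiE_iff mem_box_cart)
    qed
    then have "emeasure (distr ?P borel ?R) (box l u) = emeasure ?P (\<Pi>\<^sub>E i\<in>{..<length bs}. {l $ ?inv i <..< u $ ?inv i})"
      by (subst emeasure_distr[OF mR]) auto
    also have "\<dots> = (\<Prod>i<length bs. emeasure lborel {l $ ?inv i <..< u $ ?inv i})"
      by (rule emeasure_PiM) auto
    also have "\<dots> = (\<Prod>k\<in>(UNIV :: 'i basis_index set). ennreal (u $ k - l $ k))"
      using prod.reindex_bij_betw[OF bij, of "\<lambda>i. emeasure lborel {l $ ?inv i <..< u $ ?inv i}"]
      by (simp add: inv le')
    also have "\<dots> = ennreal (\<Prod>k\<in>(UNIV :: 'i basis_index set). (u $ k - l $ k))"
      using le' by (simp add: prod_ennreal)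
    also have "(\<Prod>k\<in>(UNIV :: 'i basis_index set). (u $ k - l $ k)) = (\<Prod>b\<in>Basis. (u - l) \<bullet> b)"
    proof -
      have B: "(Basis :: (real ^ ('i basis_index)) set) = (\<lambda>k. axis k 1) ` UNIV"
        by (auto simp: Basis_vec_def)
      have inj: "inj (\<lambda>k :: 'i basis_index. axis k (1::real))"
        by (simp add: inj_on_def axis_eq_axis)
      have "(\<Prod>b\<in>Basis. (u - l) \<bullet> b) = (\<Prod>k\<in>UNIV. (u - l) \<bullet> axis k 1)"
        unfolding B by (subst prod.reindex[OF inj]) (simp add: o_def)
      then show ?thesis by (simp add: inner_axis)
    qed
    finally show "emeasure (distr ?P borel ?R) (box l u) = ennreal (\<Prod>b\<in>Basis. (u - l) \<bullet> b)" .
  qed simp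
  have eq: "coord_sum bs t = vec_sum bs (?R t)" for t
    using sum.reindex_bij_betw[OF bij, of "\<lambda>i. t i *\<^sub>R bs ! i"] by (simp add: coord_sum_def vec_sum_def)
  have mT: "(vec_sum bs :: real ^ ('i basis_index) \<Rightarrow> 'e) \<in> borel \<rightarrow>\<^sub>M borel"
    using bounded_linear_vec_sum by (intro borel_measurable_continuous_onI linear_continuous_on)
  have comp: "coord_sum bs = vec_sum bs \<circ> ?R" by (auto simp: eq)
  show "coord_sum bs \<in> ?P \<rightarrow>\<^sub>M borel" unfolding comp using mR mT by (rule measurable_comp)
  show "basis_lborel bs = distr lborel borel (vec_sum bs :: real ^ ('i basis_index) \<Rightarrow> 'e)"
    unfolding basis_lborel_def comp by (subst lb, subst distr_distr[OF mT mR]) simp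
qed

end

section \<open>Measurability and integrability on the model space, with dimension 0 treated
  apart\<close>

lemma measurable_coord_sum:
  fixes bs :: "'e::real_normed_vector list"
  assumes bs: "ordered_basis UNIV bs"
  shows "coord_sum bs \<in> (\<Pi>\<^sub>M i\<in>{..<length bs}. (lborel :: real measure)) \<rightarrow>\<^sub>M borel"
proof (cases "bs = []")
  case True
  then have "coord_sum bs = (\<lambda>_. 0)" by (simp add: coord_sum_def fun_eq_iff)
  then show ?thesis by simp
next
  case False
  then have "dim (UNIV :: 'e set) \<noteq> 0" using ordered_basis_length[OF bs] by (metis length_0_conv)
  then show ?thesis by (rule basis_lborel_vec_sum(1)[OF bs ordered_basis_length[OF bs]])
qed

lemma dim_0_singleton:
  fixes bs :: "'e::real_vector list"
  assumes "ordered_basis UNIV bs" "dim (UNIV :: 'e set) = 0"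
  shows "(x :: 'e) = 0"
proof -
  have "bs = []" using ordered_basis_length[OF assms(1)] assms(2) by simp
  then have "(UNIV :: 'e set) = {0}" using assms(1) by (simp add: ordered_basis_def)
  then show ?thesis by blast
qed

text \<open>The empty product measure has total mass 1, so integration is evaluation at the only
  point. This is the case that the nonempty type \<open>basis_index\<close> cannot
  represent.\<close>

lemma basis_lborel_Nil:
  fixes G :: "'e::real_normed_vector \<Rightarrow> real"
  assumes bs: "ordered_basis UNIV ([] :: 'e list)"
  shows "integral\<^sup>L (basis_lborel ([] :: 'e list)) G = G 0" and "integrable (basis_lborel ([] :: 'e list)) G"
proof -
  have "dim (UNIV :: 'e set) = 0" using ordered_basis_length[OF bs] by simp
  then have triv: "G = (\<lambda>_. G 0)" using dim_0_singleton[OF bs] by (intro ext) metis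
  interpret product_sigma_finite "\<lambda>_::nat. lborel :: real measure" by standard
  have "emeasure (Pi\<^sub>M {} (\<lambda>_::nat. lborel :: real measure)) (space (Pi\<^sub>M {} (\<lambda>_. lborel))) = 1"
    using emeasure_PiM[of "{}" "\<lambda>_. UNIV"] by (simp add: space_PiM)
  then have one: "emeasure (basis_lborel ([] :: 'e list)) UNIV = 1"
    unfolding basis_lborel_def using measurable_coord_sum[OF bs] by (simp add: emeasure_distr)
  then interpret finite_measure "basis_lborel ([] :: 'e list)"
    by (intro finite_measureI) simp
  have "measure (basis_lborel ([] :: 'e list)) UNIV = 1" using one by (simp add: measure_def)
  then show "integral\<^sup>L (basis_lborel ([] :: 'e list)) G = G 0"
    by (subst triv) simp
  show "integrable (basis_lborel ([] :: 'e list)) G" by (subst triv) simp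
qed

lemma emeasure_basis_lborel_compact:
  fixes bs :: "'e::real_normed_vector list"
  assumes bs: "ordered_basis UNIV bs" and K: "compact K"
  shows "emeasure (basis_lborel bs) K < \<infinity>"
proof (cases "bs = []")
  case True
  have "integrable (basis_lborel bs) (\<lambda>_. 1::real)" using basis_lborel_Nil(2) bs True by simp
  then have "emeasure (basis_lborel bs) UNIV < \<infinity>"
    by (simp add: integrable_iff_bounded)
  then show ?thesis using emeasure_mono[of K UNIV "basis_lborel bs"] by (auto simp: less_top[symmetric] top_unique)
next
  case False
  then have nz: "dim (UNIV :: 'e set) \<noteq> 0" using ordered_basis_length[OF bs] by (metis length_0_conv)
  note len = ordered_basis_length[OF bs]
  let ?T = "vec_sum bs :: real ^ ('e basis_index) \<Rightarrow> 'e" and ?C = "vec_coord bs :: 'e \<Rightarrow> real ^ ('e basis_index)"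
  have mT: "?T \<in> borel \<rightarrow>\<^sub>M borel"
    using bounded_linear_vec_sum[OF bs len nz] by (intro borel_measurable_continuous_onI linear_continuous_on)
  have "K \<in> sets borel" using K by (simp add: borel_closed compact_imp_closed)
  then have "emeasure (basis_lborel bs) K = emeasure lborel (?T -` K)"
    using basis_lborel_vec_sum(2)[OF bs len nz] mT by (simp add: emeasure_distr)
  also have "?T -` K = ?C ` K"
    by (auto simp: image_iff vec_sum_coord[OF bs len nz]) (metis vec_coord_sum[OF bs len nz])
  also have "compact (?C ` K)"
    using K bounded_linear_vec_coord[OF bs len nz] by (intro compact_continuous_image linear_continuous_on)
  then have "emeasure lborel (?C ` K) < \<infinity>" by (rule emeasure_compact_finite)
  finally show ?thesis .
qed

lemma borel_measurable_continuous_cutoff: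
  fixes F :: "'e::topological_space \<Rightarrow> real"
  assumes "S \<in> sets borel" "continuous_on S F"
  shows "(\<lambda>y. if y \<in> S then F y else 0) \<in> borel_measurable borel"
proof -
  have "(\<lambda>y. if y \<in> S then F y else 0) = (\<lambda>y. indicator S y *\<^sub>R F y)" by (auto simp: indicator_def)
  then show ?thesis using borel_measurable_continuous_on_indicator[OF assms] by simp
qed

lemma integrable_basis_lborel_compact_support:
  fixes bs :: "'e::real_normed_vector list" and F :: "'e \<Rightarrow> real"
  assumes bs: "ordered_basis UNIV bs" and S: "open S" "continuous_on S F"
    and K: "compact K" "K \<subseteq> S" "\<And>y. y \<in> S - K \<Longrightarrow> F y = 0"
  shows "integrable (basis_lborel bs) (\<lambda>y. if y \<in> S then F y else 0)"
proof -
  let ?F = "\<lambda>y. if y \<in> S then F y else 0"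
  have m: "?F \<in> borel_measurable (basis_lborel bs)"
    using borel_measurable_continuous_cutoff[of S F] S by simp
  have "compact (F ` K)" using K S continuous_on_subset by (intro compact_continuous_image) blast+
  then obtain c where c: "\<And>y. y \<in> K \<Longrightarrow> norm (F y) \<le> c"
    using compact_imp_bounded bounded_iff by (metis imageI)
  show ?thesis
  proof (rule integrableI_bounded_set[where A = K and B = c])
    show "K \<in> sets (basis_lborel bs)" using K by (simp add: borel_closed compact_imp_closed)
    show "emeasure (basis_lborel bs) K < \<infinity>" by (rule emeasure_basis_lborel_compact[OF bs K(1)])
    show "AE x in basis_lborel bs. x \<in> K \<longrightarrow> norm (?F x) \<le> c" using c K(2) by auto
    show "AE x in basis_lborel bs. x \<notin> K \<longrightarrow> ?F x = 0" using K(3) by auto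
  qed (use m in simp)
qed

text \<open>The change of variables theorem is about functions with values in
  \<open>real^'n\<close>, so real functions are read as functions into \<open>real^1\<close>.
  Vanishing outside \<open>S\<close> lets integrals over \<open>S\<close> be exchanged for integrals
  over the whole space.\<close>

lemma absolutely_integrable_on_lborel:
  fixes f :: "real ^ 'n \<Rightarrow> real"
  assumes "f \<in> borel_measurable borel" "\<And>x. x \<notin> S \<Longrightarrow> f x = 0"
  shows "(\<lambda>x. vec (f x) :: real ^ 1) absolutely_integrable_on S \<longleftrightarrow> integrable lborel f"
    and "integrable lborel f \<Longrightarrow> integral S (\<lambda>x. vec (f x) :: real ^ 1) = vec (integral\<^sup>L lborel f)"
proof -
  have ind: "(\<lambda>x. indicator S x *\<^sub>R f x) = f"
    using assms(2) by (intro ext) (case_tac "x \<in> S", simp_all)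
  have iff: "f absolutely_integrable_on S \<longleftrightarrow> integrable lborel f"
    using integrable_completion[of f lborel] assms(1) by (simp only: set_integrable_def ind) simp
  then show "(\<lambda>x. vec (f x) :: real ^ 1) absolutely_integrable_on S \<longleftrightarrow> integrable lborel f"
    by (subst absolutely_integrable_on_1_iff) simp
  assume "integrable lborel f"
  then have "integral S f = integral\<^sup>L lborel f"
    using set_lebesgue_integral_eq_integral(2)[of S f] iff integral_completion[of f lborel] assms(1)
    unfolding set_lebesgue_integral_def ind by simp
  moreover have "f integrable_on S"
    using iff \<open>integrable lborel f\<close> set_lebesgue_integral_eq_integral(1) by blast
  ultimately show "integral S (\<lambda>x. vec (f x) :: real ^ 1) = vec (integral\<^sup>L lborel f)"
    by (subst integral_on_1_eq) (simp_all add: integrable_on_1_iff)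
qed

text \<open>Conjugating \<open>\<phi>\<close> with the two coordinate systems gives a map of
  \<open>real^'n\<close> whose Jacobian determinant is \<open>basis_det\<close>. The sets enter only
  through the vanishing of \<open>G\<close> and \<open>H\<close> outside them, and equality of the
  integrals is claimed without assuming integrability.\<close>

lemma basis_lborel_change_of_variables:
  fixes bs :: "'e::real_normed_vector list" and bs' :: "'d::real_normed_vector list"
    and \<phi> :: "'d \<Rightarrow> 'e" and G :: "'e \<Rightarrow> real" and H :: "'d \<Rightarrow> real"
  assumes bs: "ordered_basis UNIV bs" and bs': "ordered_basis UNIV bs'"
    and len: "dim (UNIV :: 'd set) = dim (UNIV :: 'e set)"
    and S: "S \<in> sets borel" and der: "\<And>y. y \<in> S \<Longrightarrow> (\<phi> has_derivative \<phi>' y) (at y)" and inj: "inj_on \<phi> S"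
    and G: "G \<in> borel_measurable borel" "\<And>y. y \<notin> \<phi> ` S \<Longrightarrow> G y = 0"
    and H: "H \<in> borel_measurable borel" "\<And>y. y \<notin> S \<Longrightarrow> H y = 0"
    and GH: "\<And>y. y \<in> S \<Longrightarrow> H y = \<bar>basis_det bs (map (\<phi>' y) bs')\<bar> * G (\<phi> y)"
  shows "integrable (basis_lborel bs') H \<longleftrightarrow> integrable (basis_lborel bs) G"
    and "integral\<^sup>L (basis_lborel bs') H = integral\<^sup>L (basis_lborel bs) G"
proof -
  have l: "length bs = dim (UNIV :: 'e set)" "length bs' = dim (UNIV :: 'e set)"
    using ordered_basis_length bs bs' len by metis+
  have "(integrable (basis_lborel bs') H \<longleftrightarrow> integrable (basis_lborel bs) G) \<and>
    integral\<^sup>L (basis_lborel bs') H = integral\<^sup>L (basis_lborel bs) G"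
  proof (cases "dim (UNIV :: 'e set) = 0")
    case True
    then have Nil: "bs = []" "bs' = []" using l by auto
    have 0: "\<And>x::'e. x = 0" "\<And>x::'d. x = 0"
      using dim_0_singleton bs bs' True len by metis+
    \<comment> \<open>Both spaces are single points, so it only matters whether \<open>S\<close> is
      empty; the Jacobian factor is 1 by the convention in \<open>basis_det\<close>.\<close>
    have "H 0 = G 0"
    proof (cases "(0::'d) \<in> S")
      case True
      then show ?thesis using GH[OF True] 0(1)[of "\<phi> 0"] \<open>dim (UNIV :: 'e set) = 0\<close> by (simp add: basis_det_def)
    next
      case False
      then have "S = {}" using 0(2) by (metis ex_in_conv)
      then show ?thesis using G(2) H(2) by simp
    qed
    then show ?thesis
      using basis_lborel_Nil[of G] basis_lborel_Nil[of H] bs bs' unfolding Nil by simp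
  next
    case nz: False
    let ?T = "vec_sum bs :: real ^ ('e basis_index) \<Rightarrow> 'e" and ?C = "vec_coord bs :: 'e \<Rightarrow> real ^ ('e basis_index)"
    let ?T' = "vec_sum bs' :: real ^ ('e basis_index) \<Rightarrow> 'd" and ?C' = "vec_coord bs' :: 'd \<Rightarrow> real ^ ('e basis_index)"
    note TC = vec_sum_coord[OF bs l(1) nz] vec_coord_sum[OF bs l(1) nz]
    note TC' = vec_sum_coord[OF bs' l(2) nz] vec_coord_sum[OF bs' l(2) nz]
    have bl: "bounded_linear ?T" "bounded_linear ?C" "bounded_linear ?T'" "bounded_linear ?C'"
      using bounded_linear_vec_sum bounded_linear_vec_coord bs bs' l nz by blast+
    have mT: "?T \<in> borel \<rightarrow>\<^sub>M borel" and mT': "?T' \<in> borel \<rightarrow>\<^sub>M borel"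
      using bl by (auto intro!: borel_measurable_continuous_onI linear_continuous_on)
    define S1 where "S1 = ?T' -` S"
    have S1: "S1 \<in> sets borel" using measurable_sets[OF mT' S] by (simp add: S1_def)
    define g where "g = ?C \<circ> \<phi> \<circ> ?T'"
    define g' where "g' = (\<lambda>v. ?C \<circ> \<phi>' (?T' v) \<circ> ?T')"
    have der_g: "(g has_derivative g' v) (at v within S1)" if "v \<in> S1" for v
    proof -
      have "(\<phi> has_derivative \<phi>' (?T' v)) (at (?T' v))" using that der by (simp add: S1_def)
      then have "(\<phi> \<circ> ?T' has_derivative \<phi>' (?T' v) \<circ> ?T') (at v)"
        by (rule diff_chain_at[OF bounded_linear_imp_has_derivative[OF bl(3)]])
      then have "(?C \<circ> (\<phi> \<circ> ?T') has_derivative ?C \<circ> (\<phi>' (?T' v) \<circ> ?T')) (at v)"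
        by (rule diff_chain_at) (rule bounded_linear_imp_has_derivative[OF bl(2)])
      then show ?thesis unfolding g_def g'_def o_assoc by (rule has_derivative_at_withinI)
    qed
    have inj_g: "inj_on g S1"
    proof (rule inj_onI)
      fix x y assume xy: "x \<in> S1" "y \<in> S1" "g x = g y"
      then have "\<phi> (?T' x) = \<phi> (?T' y)" using TC(1) by (metis comp_apply g_def)
      then have "?T' x = ?T' y" using inj xy by (auto simp: S1_def inj_on_def)
      then show "x = y" using TC'(2) by metis
    qed
    \<comment> \<open>The matrix of a linear map has the images of the axes as columns,
      \<open>basis_det\<close> has them as rows; hence the transpose.\<close>
    have det: "det (matrix (g' v)) = basis_det bs (map (\<phi>' (?T' v)) bs')" for v
    proof -
      have ax: "?T' (axis k 1) = bs' ! Rep_basis_index k" for k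
      proof -
        have "?T' (axis k 1) = (\<Sum>j\<in>UNIV. if j = k then bs' ! Rep_basis_index k else 0)"
          unfolding vec_sum_def by (intro sum.cong) (auto simp: axis_def)
        then show ?thesis by simp
      qed
      have "Rep_basis_index k < length bs'" for k :: "'e basis_index" by (rule Rep_basis_index_less[OF bs' l(2) nz])
      then have "transpose (matrix (g' v)) = (\<chi> i j. list_coord bs (Rep_basis_index j) (map (\<phi>' (?T' v)) bs' ! Rep_basis_index i))"
        by (simp add: matrix_def transpose_def g'_def ax vec_coord_def)
      then show ?thesis using nz det_transpose[of "matrix (g' v)"] by (simp add: basis_det_def)
    qed
    have mG: "(\<lambda>v. G (?T v)) \<in> borel_measurable borel" and mH: "(\<lambda>v. H (?T' v)) \<in> borel_measurable borel"
      using measurable_compose[OF mT G(1)] measurable_compose[OF mT' H(1)] by auto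
    have "G (?T v) = 0" if "v \<notin> g ` S1" for v
    proof (rule G(2), rule notI)
      assume "?T v \<in> \<phi> ` S"
      then obtain y where y: "y \<in> S" "?T v = \<phi> y" by blast
      have "v = ?C (\<phi> y)" using TC(2)[of v] y(2) by simp
      then have "?C' y \<in> S1" "v = g (?C' y)" using TC'(1) y(1) by (simp_all add: S1_def g_def)
      then show False using that by blast
    qed
    note AG = absolutely_integrable_on_lborel[OF mG this]
    have "H (?T' v) = 0" if "v \<notin> S1" for v using that H(2) by (simp add: S1_def)
    note AH = absolutely_integrable_on_lborel[OF mH this]
    have HG: "vec (H (?T' v)) = \<bar>det (matrix (g' v))\<bar> *\<^sub>R (vec (G (?T (g v))) :: real ^ 1)" if "v \<in> S1" for v
      using that GH[of "?T' v"] TC by (simp add: S1_def g_def det vec_eq_iff)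
    have S1L: "S1 \<in> sets lebesgue" using S1 by simp
    note cv = has_absolute_integral_change_of_variables[OF S1L der_g inj_g, of "\<lambda>v. vec (G (?T v)) :: real ^ 1"]
    have "((\<lambda>v. vec (H (?T' v)) :: real ^ 1) absolutely_integrable_on S1 \<and> integral S1 (\<lambda>v. vec (H (?T' v)) :: real ^ 1) = b)
      \<longleftrightarrow> ((\<lambda>v. vec (G (?T v)) :: real ^ 1) absolutely_integrable_on g ` S1 \<and> integral (g ` S1) (\<lambda>v. vec (G (?T v)) :: real ^ 1) = b)" for b
    proof -
      have "(\<lambda>v. vec (H (?T' v)) :: real ^ 1) absolutely_integrable_on S1 \<longleftrightarrow>
          (\<lambda>v. \<bar>det (matrix (g' v))\<bar> *\<^sub>R (vec (G (?T (g v))) :: real ^ 1)) absolutely_integrable_on S1"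
        by (rule set_integrable_cong) (use HG in auto)
      moreover have "integral S1 (\<lambda>v. vec (H (?T' v)) :: real ^ 1) =
          integral S1 (\<lambda>v. \<bar>det (matrix (g' v))\<bar> *\<^sub>R (vec (G (?T (g v))) :: real ^ 1))"
        by (rule integral_cong) (use HG in auto)
      ultimately show ?thesis using cv[of b] by simp
    qed
    note cv' = this
    \<comment> \<open>The equivalence \<open>cv'\<close> holds for every candidate value
      \<open>b\<close>; taking for \<open>b\<close> the actual integral on either side isolates the
      integrability statement.\<close>
    have iff: "integrable lborel (\<lambda>v. H (?T' v)) \<longleftrightarrow> integrable lborel (\<lambda>v. G (?T v))"
      using cv' AG(1) AH(1) by blast
    have eq: "(LINT v|lborel. H (?T' v)) = (LINT v|lborel. G (?T v))"
    proof (cases "integrable lborel (\<lambda>v. H (?T' v))")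
      case True
      then have "integrable lborel (\<lambda>v. G (?T v))" using iff by simp
      then have "(vec (LINT v|lborel. H (?T' v)) :: real ^ 1) = vec (LINT v|lborel. G (?T v))"
        using cv'[of "integral S1 (\<lambda>v. vec (H (?T' v)) :: real ^ 1)"] AG AH True by simp
      then show ?thesis by (simp add: vec_eq_iff)
    next
      case False
      \<comment> \<open>Neither function is integrable, and both Bochner integrals take the default
        value 0.\<close>
      then show ?thesis using iff by (simp add: not_integrable_integral_eq)
    qed
    have "basis_lborel bs = distr lborel borel ?T" "basis_lborel bs' = distr lborel borel ?T'"
      using basis_lborel_vec_sum(2) bs bs' l nz by blast+
    then show ?thesis
      using iff eq mT mT' G(1) H(1) by (simp add: integrable_distr_eq integral_distr)
  qed
  then show "integrable (basis_lborel bs') H \<longleftrightarrow> integrable (basis_lborel bs) G"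
    and "integral\<^sup>L (basis_lborel bs') H = integral\<^sup>L (basis_lborel bs) G" by auto
qed


section \<open>Product bases and Fubini's theorem\<close>

definition prod_basis :: "'f::real_vector list \<Rightarrow> 'k::real_vector list \<Rightarrow> ('f \<times> 'k) list" where
  "prod_basis bs cs = map (\<lambda>v. (v, 0)) bs @ map (\<lambda>w. (0, w)) cs"

lemma ordered_basis_prod:
  fixes bs :: "'f::real_vector list" and cs :: "'k::real_vector list"
  assumes bs: "ordered_basis UNIV bs" and cs: "ordered_basis UNIV cs"
  shows "ordered_basis UNIV (prod_basis bs cs)"
proof -
  let ?i = "\<lambda>v::'f. (v, 0::'k)" and ?j = "\<lambda>w::'k. (0::'f, w)"
  have lin: "linear ?i" "linear ?j" by (auto intro!: linearI)
  have inj: "inj ?i" "inj ?j" by (auto simp: inj_on_def)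
  \<comment> \<open>The two halves of the product basis could only share the vector 0, which no
    basis contains.\<close>
  have nz: "0 \<notin> set bs" "0 \<notin> set cs"
    using bs cs dependent_zero by (auto simp: ordered_basis_def)
  have d: "distinct (prod_basis bs cs)"
    using bs cs nz by (auto simp: prod_basis_def ordered_basis_def distinct_map inj_on_def)
  have sp: "span (?i ` set bs \<union> ?j ` set cs) = UNIV"
  proof (intro equalityI subsetI UNIV_I)
    fix x :: "'f \<times> 'k"
    have "?i (fst x) \<in> span (?i ` set bs)" "?j (snd x) \<in> span (?j ` set cs)"
      using linear_span_image[OF lin(1), of "set bs"] linear_span_image[OF lin(2), of "set cs"] bs cs
      by (auto simp: ordered_basis_def)
    then have "?i (fst x) + ?j (snd x) \<in> span (?i ` set bs \<union> ?j ` set cs)"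
      by (intro span_add) (meson span_mono sup_ge1 sup_ge2 subsetD)+
    then show "x \<in> span (?i ` set bs \<union> ?j ` set cs)" by simp
  qed
  have ind: "independent (?i ` set bs \<union> ?j ` set cs)"
  proof (rule independent_if_scalars_zero)
    fix u x
    assume z: "(\<Sum>x\<in>?i ` set bs \<union> ?j ` set cs. u x *\<^sub>R x) = 0" and x: "x \<in> ?i ` set bs \<union> ?j ` set cs"
    have "(\<Sum>x\<in>?i ` set bs \<union> ?j ` set cs. u x *\<^sub>R x) =
        (\<Sum>x\<in>?i ` set bs. u x *\<^sub>R x) + (\<Sum>x\<in>?j ` set cs. u x *\<^sub>R x)"
      using nz by (intro sum.union_disjoint) auto
    also have "\<dots> = (\<Sum>v\<in>set bs. u (?i v) *\<^sub>R ?i v) + (\<Sum>w\<in>set cs. u (?j w) *\<^sub>R ?j w)"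
      using inj by (simp add: sum.reindex inj_on_def)
    also have "\<dots> = (\<Sum>v\<in>set bs. u (?i v) *\<^sub>R v, \<Sum>w\<in>set cs. u (?j w) *\<^sub>R w)"
      by (simp add: prod_eq_iff fst_sum snd_sum)
    finally have "(\<Sum>v\<in>set bs. u (?i v) *\<^sub>R v) = 0" "(\<Sum>w\<in>set cs. u (?j w) *\<^sub>R w) = 0"
      using z by (auto simp: zero_prod_def)
    then show "u x = 0"
      using x bs cs independentD[of "set bs" "set bs" "\<lambda>v. u (?i v)"]
        independentD[of "set cs" "set cs" "\<lambda>w. u (?j w)"] by (auto simp: ordered_basis_def)
  qed simp
  show ?thesis using d sp ind by (simp add: ordered_basis_def prod_basis_def image_Un image_image)
qed

lemma prod_lessThan_add:
  fixes f :: "nat \<Rightarrow> 'a::comm_monoid_mult"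
  shows "(\<Prod>i<m + k. f i) = (\<Prod>i<m. f i) * (\<Prod>j<k. f (m + j))"
  by (induction k) (simp_all add: mult.assoc)

lemma sum_lessThan_add:
  fixes f :: "nat \<Rightarrow> 'a::comm_monoid_add"
  shows "(\<Sum>i<m + k. f i) = (\<Sum>i<m. f i) + (\<Sum>j<k. f (m + j))"
  by (induction k) (simp_all add: add.assoc)

text \<open>The coordinates of the second factor are numbered after those of the first, and
  \<open>?J\<close> glues two tuples accordingly. Comparison on product sets shows that
  \<open>?J\<close> carries the pair measure to the measure on long tuples, so that the measure of
  the product basis is an image of a pair measure and Fubini's theorem applies to it.\<close>

lemma integral_basis_lborel_prod:
  fixes bs :: "'f::real_normed_vector list" and cs :: "'k::real_normed_vector list"
    and u :: "'f \<Rightarrow> real" and w :: "'k \<Rightarrow> real"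
  assumes bs: "ordered_basis UNIV bs" and cs: "ordered_basis UNIV cs"
    and u: "u \<in> borel_measurable borel" and w: "w \<in> borel_measurable borel"
    and int: "integrable (basis_lborel (prod_basis bs cs)) (\<lambda>x. u (fst x) * w (snd x))"
  shows "(LINT x|basis_lborel (prod_basis bs cs). u (fst x) * w (snd x)) =
    integral\<^sup>L (basis_lborel bs) u * integral\<^sup>L (basis_lborel cs) w"
proof -
  let ?m = "length bs" and ?k = "length cs"
  let ?P = "\<lambda>n. \<Pi>\<^sub>M i\<in>{..<n::nat}. (lborel :: real measure)"
  let ?J = "\<lambda>x :: (nat \<Rightarrow> real) \<times> (nat \<Rightarrow> real). \<lambda>i\<in>{..<?m + ?k}. if i < ?m then fst x i else snd x (i - ?m)"
  interpret product_sigma_finite "\<lambda>_::nat. lborel :: real measure" by standard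
  interpret M: finite_product_sigma_finite "\<lambda>_::nat. lborel :: real measure" "{..<?m}" by standard simp
  interpret K: finite_product_sigma_finite "\<lambda>_::nat. lborel :: real measure" "{..<?k}" by standard simp
  interpret MK: pair_sigma_finite "?P ?m" "?P ?k" ..
  have lb: "length (prod_basis bs cs) = ?m + ?k" by (simp add: prod_basis_def)
  have mJ: "?J \<in> (?P ?m \<Otimes>\<^sub>M ?P ?k) \<rightarrow>\<^sub>M ?P (?m + ?k)"
  proof (rule measurable_restrict)
    fix i assume i: "i \<in> {..<?m + ?k}"
    show "(\<lambda>x. if i < ?m then fst x i else snd x (i - ?m)) \<in> (?P ?m \<Otimes>\<^sub>M ?P ?k) \<rightarrow>\<^sub>M lborel"
    proof (cases "i < ?m")
      case True
      then have "(\<lambda>x. fst x i) \<in> (?P ?m \<Otimes>\<^sub>M ?P ?k) \<rightarrow>\<^sub>M lborel"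
        by (intro measurable_compose[OF measurable_fst measurable_component_singleton]) simp
      then show ?thesis using True by simp
    next
      case False
      then have "(\<lambda>x. snd x (i - ?m)) \<in> (?P ?m \<Otimes>\<^sub>M ?P ?k) \<rightarrow>\<^sub>M lborel"
        using i by (intro measurable_compose[OF measurable_snd measurable_component_singleton]) auto
      then show ?thesis using False by simp
    qed
  qed
  have J: "distr (?P ?m \<Otimes>\<^sub>M ?P ?k) (?P (?m + ?k)) ?J = ?P (?m + ?k)"
  proof (rule PiM_eqI)
    fix A :: "nat \<Rightarrow> real set" assume A: "\<And>i. i \<in> {..<?m + ?k} \<Longrightarrow> A i \<in> sets lborel"
    let ?A = "Pi\<^sub>E {..<?m} A" and ?B = "\<Pi>\<^sub>E j\<in>{..<?k}. A (?m + j)"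
    have pre: "?J -` Pi\<^sub>E {..<?m + ?k} A \<inter> space (?P ?m \<Otimes>\<^sub>M ?P ?k) = ?A \<times> ?B"
    proof (intro equalityI subsetI)
      fix x assume x: "x \<in> ?J -` Pi\<^sub>E {..<?m + ?k} A \<inter> space (?P ?m \<Otimes>\<^sub>M ?P ?k)"
      have Jx: "?J x i \<in> A i" if "i < ?m + ?k" for i
        using x PiE_mem[of "?J x" "{..<?m + ?k}" A i] that by simp
      have "fst x i \<in> A i" if "i < ?m" for i using Jx[of i] that by simp
      moreover have "snd x j \<in> A (?m + j)" if "j < ?k" for j using Jx[of "?m + j"] that by simp
      ultimately show "x \<in> ?A \<times> ?B"
        using x by (auto simp: space_pair_measure space_PiM PiE_iff mem_Times_iff)
    next
      fix x assume x: "x \<in> ?A \<times> ?B"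
      have "?J x i \<in> A i" if "i < ?m + ?k" for i
      proof (cases "i < ?m")
        case True
        then show ?thesis using x by (auto simp: PiE_iff mem_Times_iff)
      next
        case False
        then have "snd x (i - ?m) \<in> A (?m + (i - ?m))"
          using x that PiE_mem[of "snd x" "{..<?k}" "\<lambda>j. A (?m + j)" "i - ?m"] by (auto simp: mem_Times_iff)
        then show ?thesis using False that by simp
      qed
      then have "?J x \<in> Pi\<^sub>E {..<?m + ?k} A" by (simp add: PiE_iff)
      then show "x \<in> ?J -` Pi\<^sub>E {..<?m + ?k} A \<inter> space (?P ?m \<Otimes>\<^sub>M ?P ?k)"
        using x by (auto simp: space_pair_measure space_PiM PiE_iff)
    qed
    have sA: "?A \<in> sets (?P ?m)" "?B \<in> sets (?P ?k)" "Pi\<^sub>E {..<?m + ?k} A \<in> sets (?P (?m + ?k))"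
      using A by (intro sets_PiM_I_finite; simp)+
    have "emeasure (distr (?P ?m \<Otimes>\<^sub>M ?P ?k) (?P (?m + ?k)) ?J) (Pi\<^sub>E {..<?m + ?k} A) =
        emeasure (?P ?m \<Otimes>\<^sub>M ?P ?k) (?A \<times> ?B)"
      using emeasure_distr[OF mJ sA(3)] pre by simp
    also have "\<dots> = emeasure (?P ?m) ?A * emeasure (?P ?k) ?B"
      by (rule K.emeasure_pair_measure_Times[OF sA(1,2)])
    also have "\<dots> = (\<Prod>i<?m + ?k. emeasure lborel (A i))"
      using A by (subst (1 2) emeasure_PiM) (auto simp: prod_lessThan_add)
    finally show "emeasure (distr (?P ?m \<Otimes>\<^sub>M ?P ?k) (?P (?m + ?k)) ?J) (Pi\<^sub>E {..<?m + ?k} A) =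
      (\<Prod>i<?m + ?k. emeasure lborel (A i))" .
  qed simp_all
  let ?c = "coord_sum (prod_basis bs cs)"
  have cJ: "?c (?J x) = (coord_sum bs (fst x), coord_sum cs (snd x))" for x
  proof -
    have "?c (?J x) = (\<Sum>i<?m. fst x i *\<^sub>R (bs ! i, 0)) + (\<Sum>j<?k. snd x j *\<^sub>R (0, cs ! j))"
      unfolding coord_sum_def lb sum_lessThan_add
      by (intro arg_cong2[where f = "(+)"] sum.cong) (auto simp: prod_basis_def nth_append)
    then show ?thesis by (simp add: coord_sum_def prod_eq_iff fst_sum snd_sum)
  qed
  have mc: "?c \<in> ?P (?m + ?k) \<rightarrow>\<^sub>M borel"
    using measurable_coord_sum[OF ordered_basis_prod[OF bs cs]] lb by simp
  have mb: "coord_sum bs \<in> ?P ?m \<rightarrow>\<^sub>M borel" "coord_sum cs \<in> ?P ?k \<rightarrow>\<^sub>M borel"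
    using measurable_coord_sum bs cs by auto
  have muw: "(\<lambda>x. u (fst x) * w (snd x)) \<in> borel_measurable borel"
  proof -
    have "fst \<in> (borel :: ('f \<times> 'k) measure) \<rightarrow>\<^sub>M borel" "snd \<in> (borel :: ('f \<times> 'k) measure) \<rightarrow>\<^sub>M borel"
      by (auto intro!: borel_measurable_continuous_onI continuous_intros)
    from measurable_compose[OF this(1) u] measurable_compose[OF this(2) w] show ?thesis by simp
  qed
  have D: "basis_lborel (prod_basis bs cs) = distr (?P ?m \<Otimes>\<^sub>M ?P ?k) borel (?c \<circ> ?J)"
    unfolding basis_lborel_def lb by (subst J[symmetric]) (rule distr_distr[OF mc mJ])
  have mcJ: "?c \<circ> ?J \<in> (?P ?m \<Otimes>\<^sub>M ?P ?k) \<rightarrow>\<^sub>M borel" using mJ mc by (rule measurable_comp)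
  have intP: "integrable (?P ?m \<Otimes>\<^sub>M ?P ?k) (\<lambda>x. u (coord_sum bs (fst x)) * w (coord_sum cs (snd x)))"
    using int integrable_distr_eq[OF mcJ muw] by (simp add: D o_def cJ del: restrict_apply)
  have "(LINT x|basis_lborel (prod_basis bs cs). u (fst x) * w (snd x)) =
      (LINT x|(?P ?m \<Otimes>\<^sub>M ?P ?k). u (coord_sum bs (fst x)) * w (coord_sum cs (snd x)))"
    unfolding D using integral_distr[OF mcJ muw] by (simp add: o_def cJ del: restrict_apply)
  also have "\<dots> = (LINT s|?P ?m. LINT t|?P ?k. u (coord_sum bs s) * w (coord_sum cs t))"
    using MK.integral_fst'[OF intP] by simp
  also have "\<dots> = (LINT s|?P ?m. u (coord_sum bs s)) * (LINT t|?P ?k. w (coord_sum cs t))"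
    by simp
  finally show ?thesis
    unfolding basis_lborel_def by (simp add: integral_distr[OF mb(1) u] integral_distr[OF mb(2) w])
qed

text \<open>Only the values of \<open>F\<close> on the chart image are tied to the form; prescribing
  \<open>F\<close> as a measurable function on the whole model space is what allows the integral to
  be moved along \<open>coord_sum\<close>.\<close>

lemma chart_integral_eq:
  fixes M :: "('a, 'e::real_normed_vector) manifold"
  assumes bs: "ordered_basis UNIV (model_basis :: 'e list)"
    and F: "F \<in> borel_measurable borel"
    and eq: "\<And>y. y \<in> snd c ` fst c \<Longrightarrow> F y = \<epsilon> (chart_inv c y) (map (chart_vector M c (chart_inv c y)) model_basis) *
        \<omega> (chart_inv c y) (map (chart_vector M c (chart_inv c y)) model_basis)"
    and z: "\<And>y. y \<notin> snd c ` fst c \<Longrightarrow> F y = 0"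
  shows "chart_integral M \<epsilon> c \<omega> = integral\<^sup>L (basis_lborel model_basis) F"
proof -
  have "integral\<^sup>L (basis_lborel model_basis) F =
      (LINT t | (\<Pi>\<^sub>M i\<in>{..<length (model_basis :: 'e list)}. (lborel :: real measure)). F (coord_sum model_basis t))"
    unfolding basis_lborel_def by (rule integral_distr[OF measurable_coord_sum[OF bs] F])
  also have "\<dots> = chart_integral M \<epsilon> c \<omega>"
    unfolding chart_integral_def Let_def coord_sum_def[symmetric]
    by (rule arg_cong[where f = "integral\<^sup>L _"]) (auto simp: fun_eq_iff eq z)
  finally show ?thesis ..
qed

section \<open>Charts\<close>

lemma smooth_on_differentiable:
  assumes "smooth_on f S" "x \<in> S"
  shows "f differentiable (at x)"
proof -
  have "Ck_on (Suc 0) f S" using assms(1) by (simp add: smooth_on_def)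
  then show ?thesis using assms(2) by simp
qed

lemma smooth_on_has_derivative:
  assumes "smooth_on f S" "x \<in> S"
  shows "(f has_derivative frechet_derivative f (at x)) (at x)"
  using smooth_on_differentiable[OF assms] by (simp add: frechet_derivative_works)

lemma smooth_on_continuous_on: "smooth_on f S \<Longrightarrow> continuous_on S f"
  unfolding smooth_on_def using Ck_on.simps(1) by blast

text \<open>Composites of charts and inverse charts simplify only near the point in question, hence
  a chain rule up to equality on an open neighbourhood.\<close>

lemma has_derivative_compose_near:
  assumes f: "(f has_derivative f') (at a)" and g: "(g has_derivative g') (at (f a))"
    and U: "open U" "a \<in> U" "\<And>y. y \<in> U \<Longrightarrow> g (f y) = h y"
  shows "(h has_derivative g' \<circ> f') (at a)"
  using has_derivative_transform_within_open[OF diff_chain_at[OF f g] U(1,2)] U(3) by simp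

context
  fixes M :: "('a, 'e::real_normed_vector) manifold"
  assumes M: "smooth_manifold M"
begin

lemma manifold_basis: "ordered_basis UNIV (model_basis :: 'e list)"
  using M model_basis_ordered_basis unfolding smooth_manifold_def by blast

lemma manifold_Hausdorff: "Hausdorff_space (mtop M)"
  using M by (simp add: smooth_manifold_def)

lemma manifold_chart_ex: "x \<in> points M \<Longrightarrow> \<exists>c\<in>atlas M. x \<in> fst c"
  using M by (auto simp: smooth_manifold_def)

lemma transition_smooth:
  assumes "c \<in> atlas M" "d \<in> atlas M"
  shows "smooth_on (snd d \<circ> chart_inv c) (snd c ` (fst c \<inter> fst d))"
  using M assms by (simp add: smooth_manifold_def)

lemma chart_at_props:
  assumes "x \<in> points M"
  shows "chart_at M x \<in> atlas M" "x \<in> fst (chart_at M x)"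
proof -
  have "\<exists>c. c \<in> atlas M \<and> x \<in> fst c" using manifold_chart_ex[OF assms] by blast
  from someI_ex[OF this] show "chart_at M x \<in> atlas M" "x \<in> fst (chart_at M x)"
    unfolding chart_at_def by auto
qed

context
  fixes c :: "('a, 'e) chart"
  assumes c: "c \<in> atlas M"
begin

lemma chart_open: "openin (mtop M) (fst c)" "open (snd c ` fst c)"
  using M c by (auto simp: smooth_manifold_def)

lemma chart_homeomorphic:
  "homeomorphic_map (subtopology (mtop M) (fst c)) (top_of_set (snd c ` fst c)) (snd c)"
  using M c by (simp add: smooth_manifold_def)

lemma chart_subset: "fst c \<subseteq> points M"
  using chart_open(1) by (rule openin_subset)

lemma chart_inj: "inj_on (snd c) (fst c)"
  using homeomorphic_imp_injective_map[OF chart_homeomorphic] chart_subset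
  by (simp add: Int_absorb1)

lemma chart_inv_left [simp]: "x \<in> fst c \<Longrightarrow> chart_inv c (snd c x) = x"
  using chart_inj by (simp add: chart_inv_def)

lemma chart_inv_right: "y \<in> snd c ` fst c \<Longrightarrow> snd c (chart_inv c y) = y"
  unfolding chart_inv_def by (rule f_inv_into_f)

lemma chart_inv_mem: "y \<in> snd c ` fst c \<Longrightarrow> chart_inv c y \<in> fst c"
  unfolding chart_inv_def by (rule inv_into_into)

lemma chart_image_iff:
  assumes "W \<subseteq> fst c"
  shows "y \<in> snd c ` W \<longleftrightarrow> y \<in> snd c ` fst c \<and> chart_inv c y \<in> W"
  using assms chart_inv_left chart_inv_right by (auto simp: image_iff subset_iff)

lemma chart_image_open:
  assumes "openin (mtop M) W"
  shows "open (snd c ` (fst c \<inter> W))"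
proof -
  have "openin (subtopology (mtop M) (fst c)) (fst c \<inter> W)"
    using assms by (auto simp: openin_subtopology)
  then have "openin (top_of_set (snd c ` fst c)) (snd c ` (fst c \<inter> W))"
    using homeomorphic_imp_open_map[OF chart_homeomorphic] by (simp add: open_map_def)
  then show ?thesis using chart_open(2) openin_open_trans by blast
qed

lemma continuous_map_chart_inv: "continuous_map (top_of_set (snd c ` fst c)) (mtop M) (chart_inv c)"
  unfolding continuous_map_def
proof (intro conjI allI impI)
  show "chart_inv c \<in> topspace (top_of_set (snd c ` fst c)) \<rightarrow> points M"
    using chart_inv_mem chart_subset by auto
  fix W assume "openin (mtop M) W"
  then have "open (snd c ` (fst c \<inter> W))" by (rule chart_image_open)
  moreover have "{y \<in> topspace (top_of_set (snd c ` fst c)). chart_inv c y \<in> W} = snd c ` (fst c \<inter> W)"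
    using chart_image_iff[of "fst c \<inter> W"] chart_inv_mem by auto
  ultimately show "openin (top_of_set (snd c ` fst c)) {y \<in> topspace (top_of_set (snd c ` fst c)). chart_inv c y \<in> W}"
    by (auto intro: open_subset)
qed

text \<open>Continuity is asked on \<open>W\<close> only, since the fibre coordinate of a
  trivialisation is continuous only over the trivialising set.\<close>

lemma continuous_on_chart:
  fixes F :: "'a \<Rightarrow> real"
  assumes "continuous_map (subtopology (mtop M) W) euclideanreal F" "S \<subseteq> snd c ` (fst c \<inter> W)"
  shows "continuous_on S (F \<circ> chart_inv c)"
proof -
  have "continuous_map (top_of_set S) (mtop M) (chart_inv c)"
    using continuous_map_from_subtopology_mono[OF continuous_map_chart_inv, of S] assms(2) by auto
  moreover have "chart_inv c \<in> S \<rightarrow> W"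
    using assms(2) chart_image_iff[of "fst c \<inter> W"] by auto
  ultimately have "continuous_map (top_of_set S) (subtopology (mtop M) W) (chart_inv c)"
    by (auto simp: continuous_map_in_subtopology)
  then have "continuous_map (top_of_set S) euclideanreal (F \<circ> chart_inv c)"
    using assms(1) by (rule continuous_map_compose)
  then show ?thesis by (simp add: continuous_map_iff_continuous)
qed

lemma compact_chart_image:
  assumes "compact_space (mtop M)" "closedin (mtop M) K" "K \<subseteq> fst c"
  shows "compact (snd c ` K)"
proof -
  have "compactin (mtop M) K" using assms(1,2) by (rule closedin_compact_space)
  then have "compactin (subtopology (mtop M) (fst c)) K" using assms(3) by (simp add: compactin_subtopology)
  then have "compactin (top_of_set (snd c ` fst c)) (snd c ` K)"
    using chart_homeomorphic by (intro image_compactin) (auto simp: homeomorphic_imp_continuous_map)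
  then show ?thesis by (simp add: compactin_subtopology)
qed

lemma chart_vector_has_derivative:
  assumes "x \<in> fst c"
  shows "(snd (chart_at M x) \<circ> chart_inv c has_derivative chart_vector M c x) (at (snd c x))"
  unfolding chart_vector_def
  using smooth_on_has_derivative[OF transition_smooth[OF c chart_at_props(1)[of x]], of "snd c x"]
    assms chart_subset chart_at_props(2)[of x] by auto

lemma linear_chart_vector: "x \<in> fst c \<Longrightarrow> linear (chart_vector M c x)"
  using chart_vector_has_derivative has_derivative_linear by blast

text \<open>Tangent vectors at \<open>F z\<close> are coordinates in the preferred chart, so a derivative computed in the
  chart \<open>c\<close> still has to be converted.\<close>

lemma has_derivative_chart_at:
  assumes F: "(snd c \<circ> F has_derivative F') (at z)" and N: "open N" "z \<in> N" "\<And>y. y \<in> N \<Longrightarrow> F y \<in> fst c"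
  shows "(snd (chart_at M (F z)) \<circ> F has_derivative chart_vector M c (F z) \<circ> F') (at z)"
  by (rule has_derivative_compose_near[OF F _ N(1,2)])
    (use chart_vector_has_derivative[of "F z"] N in auto)

end

lemma chart_vector_change:
  assumes c: "c \<in> atlas M" and d: "d \<in> atlas M" and x: "x \<in> fst c" "x \<in> fst d"
  shows "chart_vector M c x = chart_vector M d x \<circ> frechet_derivative (snd d \<circ> chart_inv c) (at (snd c x))"
proof -
  have "open (snd c ` (fst c \<inter> fst d))" using chart_image_open[OF c chart_open(1)[OF d]] .
  moreover have "snd c x \<in> snd c ` (fst c \<inter> fst d)" using x by blast
  moreover have "chart_inv c y \<in> fst d" if "y \<in> snd c ` (fst c \<inter> fst d)" for y
    using that chart_image_iff[OF c, of "fst c \<inter> fst d"] by auto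
  ultimately have "(snd (chart_at M (chart_inv c (snd c x))) \<circ> chart_inv c has_derivative
      chart_vector M d (chart_inv c (snd c x)) \<circ> frechet_derivative (snd d \<circ> chart_inv c) (at (snd c x))) (at (snd c x))"
    by (intro has_derivative_chart_at[OF d smooth_on_has_derivative[OF transition_smooth[OF c d]]])
  then show ?thesis
    using has_derivative_unique[OF chart_vector_has_derivative[OF c x(1)]] x(1) chart_inv_left[OF c] by simp
qed

lemma chart_vector_chart_at:
  assumes "x \<in> points M"
  shows "chart_vector M (chart_at M x) x = id"
proof -
  let ?c = "chart_at M x"
  have c: "?c \<in> atlas M" "x \<in> fst ?c" using chart_at_props[OF assms] .
  have "(id has_derivative id) (at (snd ?c x))" by (simp add: has_derivative_id[unfolded id_def[symmetric]])
  then have "(snd ?c \<circ> chart_inv ?c has_derivative id) (at (snd ?c x))"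
    by (rule has_derivative_transform_within_open[OF _ chart_open(2)[OF c(1)]])
      (use c chart_inv_right in auto)
  then show ?thesis using has_derivative_unique[OF chart_vector_has_derivative[OF c]] by simp
qed

text \<open>The inverse is the derivative of the opposite transition map, from the preferred chart
  at \<open>x\<close> to \<open>c\<close>.\<close>

lemma bij_chart_vector:
  assumes c: "c \<in> atlas M" and x: "x \<in> fst c"
  shows "bij (chart_vector M c x)"
proof -
  have xM: "x \<in> points M" using chart_subset[OF c] x by blast
  let ?d = "chart_at M x"
  have d: "?d \<in> atlas M" "x \<in> fst ?d" using chart_at_props[OF xM] .
  let ?T = "frechet_derivative (snd c \<circ> chart_inv ?d) (at (snd ?d x))"
  have "chart_vector M c x \<circ> ?T = id"
    using chart_vector_change[OF d(1) c d(2) x] chart_vector_chart_at[OF xM] by simp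
  moreover have "?T \<circ> chart_vector M c x = id"
  proof -
    have *: "snd ?d x = (snd ?d \<circ> chart_inv c) (snd c x)" using chart_inv_left[OF c x] by simp
    have "(snd c \<circ> chart_inv ?d has_derivative ?T) (at (snd ?d x))"
      using smooth_on_has_derivative[OF transition_smooth[OF d(1) c]] d(2) x by auto
    then have T: "(snd c \<circ> chart_inv ?d has_derivative ?T) (at ((snd ?d \<circ> chart_inv c) (snd c x)))"
      using * by simp
    have "(snd c \<circ> chart_inv ?d) ((snd ?d \<circ> chart_inv c) y) = id y" if "y \<in> snd c ` (fst c \<inter> fst ?d)" for y
      using that chart_image_iff[OF c, of "fst c \<inter> fst ?d"] chart_inv_left[OF d(1)] chart_inv_right[OF c] by auto
    then have "(id has_derivative ?T \<circ> chart_vector M c x) (at (snd c x))"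
      using x d by (intro has_derivative_compose_near[OF chart_vector_has_derivative[OF c x] T
            chart_image_open[OF c chart_open(1)[OF d(1)]]]) auto
    then show ?thesis
      using has_derivative_unique[of id _ "snd c x" id] by (simp add: has_derivative_id[unfolded id_def[symmetric]])
  qed
  ultimately show ?thesis by (rule o_bij[rotated])
qed

lemma ordered_basis_frame:
  assumes "c \<in> atlas M" "x \<in> fst c" "ordered_basis UNIV bs"
  shows "ordered_basis UNIV (map (chart_vector M c x) bs)"
  using assms by (intro ordered_basis_map linear_chart_vector bij_chart_vector)

end

section \<open>Densities and the integral\<close>

text \<open>For \<open>w\<close> the product of an orientation and a form, this is the integrand of
  \<open>chart_integral\<close> as a function on the model space.\<close>

definition frame_density ::
    "('a, 'e::real_normed_vector) manifold \<Rightarrow> ('a, 'e) chart \<Rightarrow> ('a \<Rightarrow> 'e list \<Rightarrow> real) \<Rightarrow> 'e \<Rightarrow> real" where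
  "frame_density M c w y = w (chart_inv c y) (map (chart_vector M c (chart_inv c y)) model_basis)"

text \<open>The product \<open>\<epsilon> \<omega>\<close> of an orientation and a top-degree form is such a density; its sign no longer
  depends on the orientation.\<close>

definition signed_density ::
    "('a, 'e::real_normed_vector) manifold \<Rightarrow> ('a \<Rightarrow> 'e list \<Rightarrow> real) \<Rightarrow> bool" where
  "signed_density M w \<longleftrightarrow>
     (\<forall>x\<in>points M. \<exists>a \<eta>. top_form \<eta> \<and> (\<forall>vs. ordered_basis UNIV vs \<longrightarrow> w x vs = a * \<bar>\<eta> vs\<bar>)) \<and>
     (\<forall>c\<in>atlas M. continuous_on (snd c ` fst c) (frame_density M c w))"

definition supported_in :: "('a, 'e) manifold \<Rightarrow> 'a set \<Rightarrow> ('a \<Rightarrow> real) \<Rightarrow> bool" where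
  "supported_in M U \<rho> \<longleftrightarrow> continuous_map (mtop M) euclideanreal \<rho> \<and>
     mtop M closure_of {x \<in> points M. \<rho> x \<noteq> 0} \<subseteq> U"

lemma supported_in_zero:
  assumes "supported_in M U \<rho>" "x \<in> points M" "x \<notin> U"
  shows "\<rho> x = 0"
proof (rule ccontr)
  assume "\<rho> x \<noteq> 0"
  then have "x \<in> mtop M closure_of {x \<in> points M. \<rho> x \<noteq> 0}"
    using closure_of_subset[of "{x \<in> points M. \<rho> x \<noteq> 0}" "mtop M"] assms(2) by auto
  then show False using assms by (auto simp: supported_in_def)
qed

lemma supported_in_mult:
  assumes "supported_in M U \<rho>" "continuous_map (mtop M) euclideanreal \<sigma>"
  shows "supported_in M U (\<lambda>x. \<rho> x * \<sigma> x)"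
proof -
  have "mtop M closure_of {x \<in> points M. \<rho> x * \<sigma> x \<noteq> 0} \<subseteq> mtop M closure_of {x \<in> points M. \<rho> x \<noteq> 0}"
    by (rule closure_of_mono) auto
  then show ?thesis using assms by (auto simp: supported_in_def intro!: continuous_map_real_mult)
qed

lemma has_form_integral_iff:
  "has_form_integral M \<epsilon> \<omega> I \<longleftrightarrow> (\<exists>(m::nat) c \<rho>.
     (\<forall>i<m. c i \<in> atlas M \<and> supported_in M (fst (c i)) (\<rho> i) \<and> (\<forall>x\<in>points M. 0 \<le> \<rho> i x)) \<and>
     (\<forall>x\<in>points M. (\<Sum>i<m. \<rho> i x) = 1) \<and>
     I = (\<Sum>i<m. chart_integral M \<epsilon> (c i) (\<lambda>x vs. \<rho> i x * \<omega> x vs)))"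
  unfolding has_form_integral_def supported_in_def by (intro ex_cong1) blast

lemma has_form_integralE:
  assumes "has_form_integral M \<epsilon> \<omega> I"
  obtains m :: nat and c and \<rho> :: "nat \<Rightarrow> 'a \<Rightarrow> real" where
    "\<And>i. i < m \<Longrightarrow> c i \<in> atlas M" "\<And>i. i < m \<Longrightarrow> supported_in M (fst (c i)) (\<rho> i)"
    "\<And>i x. i < m \<Longrightarrow> x \<in> points M \<Longrightarrow> 0 \<le> \<rho> i x"
    "\<And>x. x \<in> points M \<Longrightarrow> (\<Sum>i<m. \<rho> i x) = 1"
    "I = (\<Sum>i<m. chart_integral M \<epsilon> (c i) (\<lambda>x vs. \<rho> i x * \<omega> x vs))"
proof -
  from assms[unfolded has_form_integral_iff] obtain m :: nat and c and \<rho> :: "nat \<Rightarrow> 'a \<Rightarrow> real" where *: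
    "\<forall>i<m. c i \<in> atlas M \<and> supported_in M (fst (c i)) (\<rho> i) \<and> (\<forall>x\<in>points M. 0 \<le> \<rho> i x)"
    "\<forall>x\<in>points M. (\<Sum>i<m. \<rho> i x) = 1"
    "I = (\<Sum>i<m. chart_integral M \<epsilon> (c i) (\<lambda>x vs. \<rho> i x * \<omega> x vs))"
    by (elim exE conjE) (rule that; assumption)
  show thesis by (rule that[of m c \<rho>]) (use * in simp_all)
qed

section \<open>The integral of a form: change of chart and uniqueness of the value\<close>

context
  fixes M :: "('a, 'e::real_normed_vector) manifold" and \<epsilon> \<omega> :: "'a \<Rightarrow> 'e list \<Rightarrow> real"
  assumes M: "smooth_manifold M" and w: "signed_density M (\<lambda>x vs. \<epsilon> x vs * \<omega> x vs)"
begin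

abbreviation (input) "w \<equiv> \<lambda>x vs. \<epsilon> x vs * \<omega> x vs"

text \<open>On bases a signed density is a multiple of the absolute value of a form, so a linear
  substitution multiplies it by the absolute value of a determinant. The source of \<open>A\<close>
  may differ from the model space of \<open>M\<close>; it will also be the product of the model
  spaces of base and group.\<close>

lemma frame_density_linear:
  fixes A :: "'d::real_vector \<Rightarrow> 'e"
  assumes c: "c \<in> atlas M" and y: "y \<in> snd c ` fst c" and A: "linear A"
    and b: "ordered_basis UNIV (map (chart_vector M c (chart_inv c y) \<circ> A) bs)"
  shows "w (chart_inv c y) (map (chart_vector M c (chart_inv c y) \<circ> A) bs) =
    \<bar>basis_det model_basis (map A bs)\<bar> * frame_density M c w y"
proof -
  let ?x = "chart_inv c y" and ?mb = "model_basis :: 'e list"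
  have x: "?x \<in> fst c" "?x \<in> points M"
    using chart_inv_mem[OF M c y] chart_subset[OF M c] by auto
  then obtain a \<eta> where \<eta>: "top_form \<eta>" "\<And>vs. ordered_basis UNIV vs \<Longrightarrow> w ?x vs = a * \<bar>\<eta> vs\<bar>"
    using w unfolding signed_density_def by blast
  have top: "top_form (\<lambda>vs. \<eta> (map (chart_vector M c ?x) vs))"
    using \<eta>(1) linear_chart_vector[OF M c x(1)] by (rule top_form_comp_linear) simp
  have "length bs = dim (UNIV :: 'e set)" using ordered_basis_length[OF b] by simp
  then have "\<eta> (map (chart_vector M c ?x) (map A bs)) =
      basis_det ?mb (map A bs) * \<eta> (map (chart_vector M c ?x) ?mb)"
    using top_form_basis_det[OF top manifold_basis[OF M], of "map A bs"] by simp
  then show ?thesis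
    using \<eta>(2)[OF b] \<eta>(2)[OF ordered_basis_frame[OF M c x(1) manifold_basis[OF M]]]
    by (simp add: frame_density_def abs_mult)
qed

lemma frame_density_change:
  assumes c: "c \<in> atlas M" and d: "d \<in> atlas M" and y: "y \<in> snd c ` (fst c \<inter> fst d)"
  shows "frame_density M c w y =
    \<bar>basis_det model_basis (map (frechet_derivative (snd d \<circ> chart_inv c) (at y)) model_basis)\<bar> *
    frame_density M d w (snd d (chart_inv c y))"
proof -
  let ?x = "chart_inv c y" and ?T = "frechet_derivative (snd d \<circ> chart_inv c) (at y)"
  have yc: "y \<in> snd c ` fst c" using y by blast
  have x: "?x \<in> fst c" "?x \<in> fst d" using y chart_image_iff[OF M c, of "fst c \<inter> fst d"] by auto
  have sy: "snd c ?x = y" by (rule chart_inv_right[OF M c yc])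
  have lin: "linear ?T"
    using smooth_on_has_derivative[OF transition_smooth[OF M c d] y] has_derivative_linear by blast
  have ch: "chart_vector M c ?x = chart_vector M d ?x \<circ> ?T"
    using chart_vector_change[OF M c d x] sy by simp
  have dx: "chart_inv d (snd d ?x) = ?x" using chart_inv_left[OF M d x(2)] .
  have "ordered_basis UNIV (map (chart_vector M d ?x \<circ> ?T) (model_basis :: 'e list))"
    using ordered_basis_frame[OF M c x(1) manifold_basis[OF M]] ch by simp
  then show ?thesis
    using frame_density_linear[OF d, of "snd d ?x" ?T model_basis] x(2) lin
    by (simp add: dx frame_density_def ch)
qed

lemma continuous_on_frame_density:
  assumes "c \<in> atlas M" "S \<subseteq> snd c ` fst c"
  shows "continuous_on S (frame_density M c w)"
  using w assms continuous_on_subset unfolding signed_density_def by blast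

text \<open>The function \<open>\<rho>\<close> may jump at the boundary of \<open>W\<close>: an
  extension by 0 from an open set is still measurable, and that is all the transfer to the model
  space requires.\<close>

lemma chart_integral_supported:
  assumes c: "c \<in> atlas M" and W: "openin (mtop M) W"
    and \<rho>: "continuous_map (subtopology (mtop M) W) euclideanreal \<rho>" "\<And>x. x \<in> points M \<Longrightarrow> x \<notin> W \<Longrightarrow> \<rho> x = 0"
  defines "F \<equiv> \<lambda>y. if y \<in> snd c ` (fst c \<inter> W) then \<rho> (chart_inv c y) * frame_density M c w y else 0"
  shows "F \<in> borel_measurable borel"
    and "chart_integral M \<epsilon> c (\<lambda>x vs. \<rho> x * \<omega> x vs) = integral\<^sup>L (basis_lborel model_basis) F"
proof -
  have op: "open (snd c ` (fst c \<inter> W))" by (rule chart_image_open[OF M c W])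
  have "continuous_on (snd c ` (fst c \<inter> W)) (\<rho> \<circ> chart_inv c)"
    using continuous_on_chart[OF M c \<rho>(1)] by simp
  then have "continuous_on (snd c ` (fst c \<inter> W)) (\<lambda>y. \<rho> (chart_inv c y) * frame_density M c w y)"
    by (intro continuous_on_mult continuous_on_frame_density[OF c]) (auto simp: o_def)
  then show F: "F \<in> borel_measurable borel"
    unfolding F_def using op by (intro borel_measurable_continuous_cutoff) auto
  show "chart_integral M \<epsilon> c (\<lambda>x vs. \<rho> x * \<omega> x vs) = integral\<^sup>L (basis_lborel model_basis) F"
  proof (rule chart_integral_eq[OF manifold_basis[OF M] F])
    fix y assume y: "y \<in> snd c ` fst c"
    then have "chart_inv c y \<in> points M" "chart_inv c y \<in> fst c"
      using chart_inv_mem[OF M c] chart_subset[OF M c] by auto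
    then have "\<not> y \<in> snd c ` (fst c \<inter> W) \<Longrightarrow> \<rho> (chart_inv c y) = 0"
      using chart_image_iff[OF M c, of "fst c \<inter> W"] y \<rho>(2) by auto
    then show "F y = \<epsilon> (chart_inv c y) (map (chart_vector M c (chart_inv c y)) model_basis) *
        (\<rho> (chart_inv c y) * \<omega> (chart_inv c y) (map (chart_vector M c (chart_inv c y)) model_basis))"
      by (simp add: F_def frame_density_def)
  qed (auto simp: F_def)
qed

text \<open>Both sides are integrals over the overlap of the two charts, related by the transition
  map. No integrability is asked for, because the change of variables also equates the default
  values.\<close>

lemma chart_integral_change:
  assumes c: "c \<in> atlas M" and d: "d \<in> atlas M" and \<rho>: "continuous_map (mtop M) euclideanreal \<rho>"
    and z: "\<And>x. x \<in> points M \<Longrightarrow> x \<notin> fst c \<inter> fst d \<Longrightarrow> \<rho> x = 0"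
  shows "chart_integral M \<epsilon> c (\<lambda>x vs. \<rho> x * \<omega> x vs) = chart_integral M \<epsilon> d (\<lambda>x vs. \<rho> x * \<omega> x vs)"
proof -
  let ?W = "fst c \<inter> fst d"
  have W: "openin (mtop M) ?W" using chart_open(1)[OF M] c d by (intro openin_Int) auto
  have \<rho>W: "continuous_map (subtopology (mtop M) ?W) euclideanreal \<rho>"
    using \<rho> by (rule continuous_map_from_subtopology)
  let ?S = "snd c ` (fst c \<inter> ?W)" and ?\<phi> = "snd d \<circ> chart_inv c"
  let ?H = "\<lambda>y. if y \<in> ?S then \<rho> (chart_inv c y) * frame_density M c w y else 0"
  let ?G = "\<lambda>y. if y \<in> snd d ` (fst d \<inter> ?W) then \<rho> (chart_inv d y) * frame_density M d w y else 0"
  note H = chart_integral_supported[OF c W \<rho>W z] and G = chart_integral_supported[OF d W \<rho>W z]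
  have S: "open ?S" by (rule chart_image_open[OF M c W])
  have S': "?S = snd c ` ?W" by (rule arg_cong[where f = "image (snd c)"]) blast
  have inv: "chart_inv c y \<in> ?W \<and> snd c (chart_inv c y) = y" if "y \<in> ?S" for y
    using that chart_image_iff[OF M c, of ?W] chart_inv_right[OF M c] unfolding S' by auto
  have img: "?\<phi> ` ?S = snd d ` (fst d \<inter> ?W)"
  proof -
    have "chart_inv c ` ?S = fst d \<inter> ?W"
      unfolding S' image_image using chart_inv_left[OF M c] by (auto simp: image_iff)
    then show ?thesis by (simp only: image_comp[symmetric])
  qed
  have inj: "inj_on ?\<phi> ?S"
  proof (rule inj_onI)
    fix x y assume xy: "x \<in> ?S" "y \<in> ?S" "?\<phi> x = ?\<phi> y"
    then have "chart_inv c x = chart_inv c y"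
      using chart_inj[OF M d] inv by (auto simp: inj_on_def)
    then show "x = y" using inv xy by metis
  qed
  have "integral\<^sup>L (basis_lborel model_basis) ?H = integral\<^sup>L (basis_lborel model_basis) ?G"
  proof (rule basis_lborel_change_of_variables(2)[OF manifold_basis[OF M] manifold_basis[OF M] refl _ _ inj])
    show "?S \<in> sets borel" using S by simp
    show "(?\<phi> has_derivative frechet_derivative ?\<phi> (at y)) (at y)" if "y \<in> ?S" for y
      using smooth_on_has_derivative[OF transition_smooth[OF M c d], of y] that S' by simp
    show "?G y = 0" if "y \<notin> ?\<phi> ` ?S" for y using that img by simp
    fix y assume y: "y \<in> ?S"
    then have "?\<phi> y \<in> snd d ` (fst d \<inter> ?W)" using img by blast
    moreover have "chart_inv d (?\<phi> y) = chart_inv c y" using inv[OF y] chart_inv_left[OF M d] by simp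
    ultimately show "?H y = \<bar>basis_det model_basis (map (frechet_derivative ?\<phi> (at y)) model_basis)\<bar> * ?G (?\<phi> y)"
      using y frame_density_change[OF c d, of y] unfolding S' by simp
  qed (use G(1) H(1) in auto)
  then show ?thesis using H(2) G(2) by simp
qed

context
  assumes comp: "compact_space (mtop M)"
begin

lemma integrable_chart:
  assumes c: "c \<in> atlas M" and \<rho>: "supported_in M (fst c) \<rho>"
  shows "integrable (basis_lborel model_basis)
    (\<lambda>y. if y \<in> snd c ` fst c then \<rho> (chart_inv c y) * frame_density M c w y else 0)"
proof -
  let ?K = "mtop M closure_of {x \<in> points M. \<rho> x \<noteq> 0}"
  have K: "?K \<subseteq> fst c" using \<rho> by (simp add: supported_in_def)
  have "continuous_on (snd c ` fst c) (\<rho> \<circ> chart_inv c)"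
    using continuous_on_chart[OF M c, of "points M" \<rho>] \<rho> chart_subset[OF M c]
    by (simp add: supported_in_def Int_absorb2)
  then have cont: "continuous_on (snd c ` fst c) (\<lambda>y. \<rho> (chart_inv c y) * frame_density M c w y)"
    by (intro continuous_on_mult continuous_on_frame_density[OF c]) (auto simp: o_def)
  show ?thesis
  proof (rule integrable_basis_lborel_compact_support[OF manifold_basis[OF M] chart_open(2)[OF M c] cont])
    show "compact (snd c ` ?K)" by (rule compact_chart_image[OF M c comp closedin_closure_of K])
    show "snd c ` ?K \<subseteq> snd c ` fst c" using K by blast
    fix y assume y: "y \<in> snd c ` fst c - snd c ` ?K"
    then have "chart_inv c y \<notin> ?K" "chart_inv c y \<in> points M"
      using chart_image_iff[OF M c K] chart_inv_mem[OF M c] chart_subset[OF M c] by auto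
    then have "\<rho> (chart_inv c y) = 0"
      using closure_of_subset[of "{x \<in> points M. \<rho> x \<noteq> 0}" "mtop M"] by auto
    then show "\<rho> (chart_inv c y) * frame_density M c w y = 0" by simp
  qed
qed

text \<open>Additivity requires each piece to be integrable; this is supplied by compactness of the
  supports in the chart.\<close>

lemma chart_integral_sum:
  fixes \<sigma> :: "nat \<Rightarrow> 'a \<Rightarrow> real"
  assumes c: "c \<in> atlas M" and \<rho>: "supported_in M (fst c) \<rho>"
    and \<sigma>: "\<And>j. j < m \<Longrightarrow> continuous_map (mtop M) euclideanreal (\<sigma> j)" "\<And>x. x \<in> points M \<Longrightarrow> (\<Sum>j<m. \<sigma> j x) = 1"
  shows "chart_integral M \<epsilon> c (\<lambda>x vs. \<rho> x * \<omega> x vs) =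
    (\<Sum>j<m. chart_integral M \<epsilon> c (\<lambda>x vs. (\<rho> x * \<sigma> j x) * \<omega> x vs))"
proof -
  let ?f = "\<lambda>\<rho> y. if y \<in> snd c ` fst c then \<rho> (chart_inv c y) * frame_density M c w y else 0"
  have eq: "chart_integral M \<epsilon> c (\<lambda>x vs. \<rho> x * \<omega> x vs) = integral\<^sup>L (basis_lborel model_basis) (?f \<rho>)"
    if "supported_in M (fst c) \<rho>" for \<rho>
    using chart_integral_supported(2)[OF c openin_topspace, of \<rho>] that chart_subset[OF M c]
    by (simp add: supported_in_def Int_absorb2)
  have "(\<Sum>j<m. chart_integral M \<epsilon> c (\<lambda>x vs. (\<rho> x * \<sigma> j x) * \<omega> x vs)) =
      (\<Sum>j<m. integral\<^sup>L (basis_lborel model_basis) (?f (\<lambda>x. \<rho> x * \<sigma> j x)))"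
    by (intro sum.cong eq supported_in_mult \<rho> \<sigma>) auto
  also have "\<dots> = integral\<^sup>L (basis_lborel model_basis) (\<lambda>y. \<Sum>j<m. ?f (\<lambda>x. \<rho> x * \<sigma> j x) y)"
    by (intro Bochner_Integration.integral_sum[symmetric] integrable_chart c supported_in_mult \<rho> \<sigma>) auto
  also have "(\<lambda>y. \<Sum>j<m. ?f (\<lambda>x. \<rho> x * \<sigma> j x) y) = ?f \<rho>"
  proof
    fix y
    show "(\<Sum>j<m. ?f (\<lambda>x. \<rho> x * \<sigma> j x) y) = ?f \<rho> y"
    proof (cases "y \<in> snd c ` fst c")
      case True
      then have "chart_inv c y \<in> points M" using chart_inv_mem[OF M c] chart_subset[OF M c] by auto
      have "(\<Sum>j<m. ?f (\<lambda>x. \<rho> x * \<sigma> j x) y) =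
          (\<rho> (chart_inv c y) * frame_density M c w y) * (\<Sum>j<m. \<sigma> j (chart_inv c y))"
        using True by (simp add: sum_distrib_left sum_distrib_right mult_ac)
      then show ?thesis using True \<sigma>(2)[OF \<open>chart_inv c y \<in> points M\<close>] by simp
    qed simp
  qed
  finally show ?thesis using eq[OF \<rho>] by simp
qed

text \<open>Inserting each partition into the sum of the other turns both values into double sums
  over the products \<open>\<rho> i x * \<sigma> j x\<close>. Each product vanishes outside the
  overlap of two charts, where the chart may be changed.\<close>

lemma has_form_integral_unique:
  assumes I: "has_form_integral M \<epsilon> \<omega> I" and J: "has_form_integral M \<epsilon> \<omega> J"
  shows "I = J"
proof -
  obtain m :: nat and c and \<rho> :: "nat \<Rightarrow> 'a \<Rightarrow> real" where
    c: "\<And>i. i < m \<Longrightarrow> c i \<in> atlas M" "\<And>i. i < m \<Longrightarrow> supported_in M (fst (c i)) (\<rho> i)"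
      "\<And>i x. i < m \<Longrightarrow> x \<in> points M \<Longrightarrow> 0 \<le> \<rho> i x" and
    s\<rho>: "\<And>x. x \<in> points M \<Longrightarrow> (\<Sum>i<m. \<rho> i x) = 1" and
    I': "I = (\<Sum>i<m. chart_integral M \<epsilon> (c i) (\<lambda>x vs. \<rho> i x * \<omega> x vs))"
  proof (rule has_form_integralE[OF I], goal_cases)
    case (1 m c \<rho>)
    from 1(1)[OF 1(2-6)] show ?case .
  qed
  obtain n :: nat and d and \<sigma> :: "nat \<Rightarrow> 'a \<Rightarrow> real" where
    d: "\<And>i. i < n \<Longrightarrow> d i \<in> atlas M" "\<And>i. i < n \<Longrightarrow> supported_in M (fst (d i)) (\<sigma> i)"
      "\<And>i x. i < n \<Longrightarrow> x \<in> points M \<Longrightarrow> 0 \<le> \<sigma> i x" and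
    s\<sigma>: "\<And>x. x \<in> points M \<Longrightarrow> (\<Sum>i<n. \<sigma> i x) = 1" and
    J': "J = (\<Sum>i<n. chart_integral M \<epsilon> (d i) (\<lambda>x vs. \<sigma> i x * \<omega> x vs))"
  proof (rule has_form_integralE[OF J], goal_cases)
    case (1 n d \<sigma>)
    from 1(1)[OF 1(2-6)] show ?case .
  qed
  have cont: "\<And>i. i < m \<Longrightarrow> continuous_map (mtop M) euclideanreal (\<rho> i)"
    "\<And>i. i < n \<Longrightarrow> continuous_map (mtop M) euclideanreal (\<sigma> i)"
    using c d by (auto simp: supported_in_def)
  have "I = (\<Sum>i<m. \<Sum>j<n. chart_integral M \<epsilon> (c i) (\<lambda>x vs. (\<rho> i x * \<sigma> j x) * \<omega> x vs))"
    unfolding I' using c cont s\<sigma> by (intro sum.cong refl chart_integral_sum) auto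
  also have "\<dots> = (\<Sum>i<m. \<Sum>j<n. chart_integral M \<epsilon> (d j) (\<lambda>x vs. (\<sigma> j x * \<rho> i x) * \<omega> x vs))"
  proof (intro sum.cong refl)
    fix i j assume ij: "i \<in> {..<m}" "j \<in> {..<n}"
    have "chart_integral M \<epsilon> (c i) (\<lambda>x vs. (\<rho> i x * \<sigma> j x) * \<omega> x vs) =
        chart_integral M \<epsilon> (d j) (\<lambda>x vs. (\<rho> i x * \<sigma> j x) * \<omega> x vs)"
    proof (rule chart_integral_change)
      fix x assume "x \<in> points M" "x \<notin> fst (c i) \<inter> fst (d j)"
      then show "\<rho> i x * \<sigma> j x = 0"
        using supported_in_zero[of M "fst (c i)" "\<rho> i" x] supported_in_zero[of M "fst (d j)" "\<sigma> j" x] c d ij by auto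
    qed (use c d ij cont in \<open>auto intro!: continuous_map_real_mult\<close>)
    then show "chart_integral M \<epsilon> (c i) (\<lambda>x vs. (\<rho> i x * \<sigma> j x) * \<omega> x vs) =
        chart_integral M \<epsilon> (d j) (\<lambda>x vs. (\<sigma> j x * \<rho> i x) * \<omega> x vs)"
      by (simp only: mult.commute[of "\<sigma> j _"])
  qed
  also have "\<dots> = (\<Sum>j<n. \<Sum>i<m. chart_integral M \<epsilon> (d j) (\<lambda>x vs. (\<sigma> j x * \<rho> i x) * \<omega> x vs))"
    by (rule sum.swap)
  also have "\<dots> = J"
    unfolding J' using d cont s\<rho> by (intro sum.cong refl chart_integral_sum[symmetric]) auto
  finally show ?thesis .
qed

lemma form_integral_eq:
  assumes "has_form_integral M \<epsilon> \<omega> I"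
  shows "form_integral M \<epsilon> \<omega> = I"
  unfolding form_integral_def using assms has_form_integral_unique by (intro the_equality) auto

end

end

text \<open>A compact Hausdorff space is completely regular, so every point has a nonnegative bump
  function supported in a member of the cover. Finitely many of the sets where these are positive
  cover the space, and dividing by the sum normalises.\<close>

lemma partition_of_unity:
  fixes X :: "'a topology"
  assumes comp: "compact_space X" and Haus: "Hausdorff_space X"
    and cover: "\<And>x. x \<in> topspace X \<Longrightarrow> \<exists>U\<in>\<U>. openin X U \<and> x \<in> U"
  obtains m :: nat and U and \<rho> :: "nat \<Rightarrow> 'a \<Rightarrow> real" where
    "\<And>i. i < m \<Longrightarrow> U i \<in> \<U>" "\<And>i. i < m \<Longrightarrow> continuous_map X euclideanreal (\<rho> i)"
    "\<And>i x. i < m \<Longrightarrow> x \<in> topspace X \<Longrightarrow> 0 \<le> \<rho> i x"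
    "\<And>i. i < m \<Longrightarrow> X closure_of {x \<in> topspace X. \<rho> i x \<noteq> 0} \<subseteq> U i"
    "\<And>x. x \<in> topspace X \<Longrightarrow> (\<Sum>i<m. \<rho> i x) = 1"
proof -
  have "completely_regular_space X"
    using compact_Hausdorff_or_regular_imp_normal_space[OF comp] Haus
      normal_imp_completely_regular_space by blast
  define Q where "Q = (\<lambda>x U (u :: 'a \<Rightarrow> real). U \<in> \<U> \<and> continuous_map X euclideanreal u \<and>
      (\<forall>y\<in>topspace X. 0 \<le> u y) \<and> X closure_of {y \<in> topspace X. u y \<noteq> 0} \<subseteq> U \<and> u x > 0)"
  have "\<exists>U u. Q x U u" if x: "x \<in> topspace X" for x
  proof -
    obtain U where U: "U \<in> \<U>" "openin X U" "x \<in> U" using cover[OF x] by blast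
    obtain f :: "'a \<Rightarrow> real" where f: "continuous_map X (top_of_set {0..1}) f" "f x = 0" "f ` (topspace X - U) \<subseteq> {1}"
      using \<open>completely_regular_space X\<close> U x openin_closedin_eq unfolding completely_regular_space_def
      by (metis Diff_iff closedin_topspace closedin_diff)
    \<comment> \<open>Here \<open>f\<close> is 0 at \<open>x\<close> and 1 outside \<open>U\<close>.
      Cutting off at 1/2 places the support inside the closed set where \<open>f\<close> is at most
      1/2, which misses the complement of \<open>U\<close>; the function \<open>1 - f\<close> would
      merely vanish there.\<close>
    define u where "u = (\<lambda>y. max 0 (1/2 - f y))"
    have cf: "continuous_map X euclideanreal f" using f(1) by (simp add: continuous_map_in_subtopology)
    have "closedin X {y \<in> topspace X. f y \<in> {..1/2}}"
      by (rule closedin_continuous_map_preimage[OF cf]) simp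
    then have "X closure_of {y \<in> topspace X. u y \<noteq> 0} \<subseteq> {y \<in> topspace X. f y \<in> {..1/2}}"
      by (rule closure_of_minimal[rotated]) (auto simp: u_def max_def split: if_splits)
    also have "\<dots> \<subseteq> U"
    proof
      fix y assume y: "y \<in> {y \<in> topspace X. f y \<in> {..1/2}}"
      show "y \<in> U"
      proof (rule ccontr)
        assume "y \<notin> U"
        then have "f y = 1" using f(3) y by blast
        then show False using y by simp
      qed
    qed
    finally have "X closure_of {y \<in> topspace X. u y \<noteq> 0} \<subseteq> U" .
    moreover have "continuous_map X euclideanreal u"
      unfolding u_def by (intro continuous_map_real_max continuous_map_diff cf) auto
    ultimately show ?thesis
      unfolding Q_def using U(1) f(2) by (intro exI[of _ U] exI[of _ u]) (auto simp: u_def)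
  qed
  then obtain U u where "\<And>x. x \<in> topspace X \<Longrightarrow> Q x (U x) (u x)" by metis
  then have Uu: "U x \<in> \<U> \<and> continuous_map X euclideanreal (u x) \<and> (\<forall>y\<in>topspace X. 0 \<le> u x y) \<and>
      X closure_of {y \<in> topspace X. u x y \<noteq> 0} \<subseteq> U x \<and> u x x > 0" if "x \<in> topspace X" for x
    using that unfolding Q_def by blast
  define N where "N = (\<lambda>x. {y \<in> topspace X. u x y \<in> {0<..}})"
  have "openin X (N x)" if "x \<in> topspace X" for x
    unfolding N_def using Uu[OF that] by (intro openin_continuous_map_preimage[of X euclideanreal]) auto
  moreover have "topspace X \<subseteq> \<Union>(N ` topspace X)" using Uu by (auto simp: N_def)
  ultimately have "\<exists>\<F>. finite \<F> \<and> \<F> \<subseteq> N ` topspace X \<and> topspace X \<subseteq> \<Union>\<F>"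
    using comp[unfolded compact_space_alt, rule_format, of "N ` topspace X"] by blast
  then obtain \<F> where "finite \<F>" "\<F> \<subseteq> N ` topspace X" "topspace X \<subseteq> \<Union>\<F>" by blast
  then obtain T where T: "finite T" "T \<subseteq> topspace X" "topspace X \<subseteq> \<Union>(N ` T)"
    using finite_subset_image by metis
  obtain p where p: "bij_betw p {..<card T} T" using ex_bij_betw_nat_finite[OF T(1)] by (auto simp: atLeast0LessThan)
  have pT: "p i \<in> topspace X" if "i < card T" for i using p that T(2) by (auto simp: bij_betw_def)
  define s where "s = (\<lambda>y. \<Sum>i<card T. u (p i) y)"
  have spos: "s y > 0" if y: "y \<in> topspace X" for y
  proof -
    obtain t where t: "t \<in> T" "y \<in> N t" using T(3) y by blast
    obtain i where i: "i < card T" "p i = t" using p t(1) by (metis bij_betw_iff_bijections lessThan_iff)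
    have "0 < u (p i) y" using t i by (simp add: N_def)
    also have "u (p i) y \<le> s y"
      unfolding s_def using Uu pT y i by (intro member_le_sum) auto
    finally show ?thesis .
  qed
  have cs: "continuous_map X euclideanreal s"
    unfolding s_def using Uu pT by (intro continuous_map_sum) auto
  show thesis
  proof (rule that[of "card T" "\<lambda>i. U (p i)" "\<lambda>i y. u (p i) y / s y"])
    fix i assume i: "i < card T"
    show "U (p i) \<in> \<U>" using Uu pT[OF i] by blast
    show "continuous_map X euclideanreal (\<lambda>y. u (p i) y / s y)"
      using Uu pT[OF i] cs spos by (intro continuous_map_real_divide) (auto simp: less_imp_neq[symmetric])
    have "X closure_of {y \<in> topspace X. u (p i) y / s y \<noteq> 0} \<subseteq> X closure_of {y \<in> topspace X. u (p i) y \<noteq> 0}"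
      by (rule closure_of_mono) auto
    then show "X closure_of {y \<in> topspace X. u (p i) y / s y \<noteq> 0} \<subseteq> U (p i)"
      using Uu pT[OF i] by blast
    fix y assume y: "y \<in> topspace X"
    show "0 \<le> u (p i) y / s y" using Uu pT[OF i] y spos[OF y] by simp
  next
    fix y assume "y \<in> topspace X"
    then show "(\<Sum>i<card T. u (p i) y / s y) = 1"
      using spos[of y] by (simp add: sum_divide_distrib[symmetric] s_def)
  qed
qed

text \<open>As \<open>chart_integral\<close> is a total function, existence of a value is existence
  of a partition of unity subordinate to charts, for arbitrary \<open>\<omega>\<close>.\<close>

lemma ex_has_form_integral:
  assumes M: "smooth_manifold M" and comp: "compact_space (mtop M)"
  shows "\<exists>I. has_form_integral M \<epsilon> \<omega> I"
proof -
  have cov: "\<exists>U\<in>fst ` atlas M. openin (mtop M) U \<and> x \<in> U" if "x \<in> points M" for x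
    using manifold_chart_ex[OF M that] chart_open(1)[OF M] by blast
  obtain m :: nat and U \<rho> where \<rho>: "\<And>i. i < m \<Longrightarrow> U i \<in> fst ` atlas M"
    "\<And>i. i < m \<Longrightarrow> continuous_map (mtop M) euclideanreal (\<rho> i)"
    "\<And>i x. i < m \<Longrightarrow> x \<in> points M \<Longrightarrow> 0 \<le> \<rho> i x"
    "\<And>i. i < m \<Longrightarrow> mtop M closure_of {x \<in> points M. \<rho> i x \<noteq> 0} \<subseteq> U i"
    "\<And>x. x \<in> points M \<Longrightarrow> (\<Sum>i<m. \<rho> i x) = 1"
    using partition_of_unity[OF comp manifold_Hausdorff[OF M] cov] by blast
  have "\<forall>i\<in>{..<m}. \<exists>c. c \<in> atlas M \<and> U i = fst c" using \<rho>(1) by blast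
  then obtain c where c: "\<forall>i\<in>{..<m}. c i \<in> atlas M \<and> U i = fst (c i)" by (rule bchoice[THEN exE])
  have "has_form_integral M \<epsilon> \<omega> (\<Sum>i<m. chart_integral M \<epsilon> (c i) (\<lambda>x vs. \<rho> i x * \<omega> x vs))"
    unfolding has_form_integral_iff supported_in_def
    by (rule exI[of _ m], rule exI[of _ c], rule exI[of _ \<rho>]) (use \<rho> c in simp)
  then show ?thesis by blast
qed

text \<open>The volume form is prescribed point by point through orthonormal bases. Its absolute
  value on a coordinate frame is the square root of the Gram determinant of that frame, whose
  entries are continuous because the metric is smooth.\<close>

lemma signed_density_riemannian:
  fixes M :: "('a, 'e::real_normed_vector) manifold"
  assumes M: "smooth_manifold M" and h: "riemannian_metric M h" and or: "\<And>x. x \<in> points M \<Longrightarrow> orientation (\<epsilon> x)"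
    and vol: "riemannian_volume_form M h \<epsilon> \<mu>" and F: "continuous_map (mtop M) euclideanreal F"
  shows "signed_density M (\<lambda>x vs. \<epsilon> x vs * (F x * \<mu> x vs))"
proof -
  note mb = manifold_basis[OF M]
  have ip: "inner_product (h x)" and ev: "euclidean_volume_form (h x) (\<epsilon> x) (\<mu> x)" if "x \<in> points M" for x
    using h vol that by (auto simp: riemannian_metric_def riemannian_volume_form_def)
  have top: "top_form (\<mu> x)" if "x \<in> points M" for x
    using ev[OF that] by (simp add: euclidean_volume_form_def)
  have eq: "\<epsilon> x vs * (F x * \<mu> x vs) = F x * \<bar>\<mu> x vs\<bar>" if "x \<in> points M" "ordered_basis UNIV vs" for x vs
    using orientation_volume_form(1)[OF ip or ev that(2)] that(1) by (simp add: mult.left_commute)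
  have "continuous_on (snd c ` fst c) (frame_density M c (\<lambda>x vs. \<epsilon> x vs * (F x * \<mu> x vs)))"
    if c: "c \<in> atlas M" for c
  proof -
    let ?fr = "\<lambda>y. map (chart_vector M c (chart_inv c y)) (model_basis :: 'e list)"
    have pt: "chart_inv c y \<in> fst c" "chart_inv c y \<in> points M" if "y \<in> snd c ` fst c" for y
      using chart_inv_mem[OF M c that] chart_subset[OF M c] by auto
    have unit: "\<bar>\<mu> (chart_inv c y) es\<bar> = 1"
      if "y \<in> snd c ` fst c" "orthonormal_basis (h (chart_inv c y)) es" for y es
      using euclidean_volume_form_abs[OF ip or ev] that pt by blast
    have "continuous_on (snd c ` fst c) (\<lambda>y. \<bar>\<mu> (chart_inv c y) (?fr y)\<bar>)"
    proof (cases "dim (UNIV :: 'e set) = 0")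
      case True
      then have Nil: "(model_basis :: 'e list) = []" using ordered_basis_length[OF mb] by simp
      have "\<bar>\<mu> (chart_inv c y) (?fr y)\<bar> = 1" if y: "y \<in> snd c ` fst c" for y
      proof -
        obtain es where es: "orthonormal_basis (h (chart_inv c y)) es"
          using ex_orthonormal_basis[OF ip[OF pt(2)[OF y]] mb] by blast
        then have "es = []" using ordered_basis_length[of es] True by (simp add: orthonormal_basis_def)
        then show ?thesis using unit[OF y es] Nil by simp
      qed
      then show ?thesis by (simp cong: continuous_on_cong)
    next
      case False
      let ?g = "\<lambda>y. \<chi> (i::'e basis_index) (j::'e basis_index).
        h (chart_inv c y) (?fr y ! Rep_basis_index i) (?fr y ! Rep_basis_index j)"
      have lt: "Rep_basis_index i < length (model_basis :: 'e list)" for i :: "'e basis_index"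
        using bij_betw_Rep_basis_index[OF False] ordered_basis_length[OF mb] by (auto simp: bij_betw_def)
      have "\<bar>\<mu> (chart_inv c y) (?fr y)\<bar> = sqrt (det (?g y))" if y: "y \<in> snd c ` fst c" for y
      proof -
        have "(\<mu> (chart_inv c y) (?fr y))\<^sup>2 = det (?g y)"
          by (rule gram_det[OF ip[OF pt(2)[OF y]] False mb top[OF pt(2)[OF y]] unit[OF y]])
            (use ordered_basis_length[OF mb] in auto)
        then show ?thesis by (metis real_sqrt_abs)
      qed
      moreover have "continuous_on (snd c ` fst c) (\<lambda>y. sqrt (det (?g y)))"
      proof -
        have "continuous_on (snd c ` fst c) (\<lambda>y. ?g y $ i $ j)" for i j
          using h c lt by (auto simp: riemannian_metric_def Let_def intro: smooth_on_continuous_on)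
        then show ?thesis
          unfolding det_def
          by (intro continuous_on_real_sqrt continuous_on_sum continuous_on_mult continuous_on_const continuous_on_prod)
      qed
      ultimately show ?thesis by (simp cong: continuous_on_cong)
    qed
    moreover have "continuous_on (snd c ` fst c) (F \<circ> chart_inv c)"
      using continuous_on_chart[OF M c, of "points M" F] F chart_subset[OF M c] by (simp add: Int_absorb2)
    ultimately have "continuous_on (snd c ` fst c) (\<lambda>y. F (chart_inv c y) * \<bar>\<mu> (chart_inv c y) (?fr y)\<bar>)"
      by (intro continuous_on_mult) (auto simp: o_def)
    moreover have "frame_density M c (\<lambda>x vs. \<epsilon> x vs * (F x * \<mu> x vs)) y = F (chart_inv c y) * \<bar>\<mu> (chart_inv c y) (?fr y)\<bar>"
      if y: "y \<in> snd c ` fst c" for y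
      unfolding frame_density_def by (rule eq[OF pt(2)[OF y] ordered_basis_frame[OF M c pt(1)[OF y] mb]])
    ultimately show ?thesis by (simp cong: continuous_on_cong)
  qed
  then show ?thesis using eq top unfolding signed_density_def by blast
qed

section \<open>Tangent maps\<close>

text \<open>A relational form of \<open>tangent_map\<close> for maps that are only defined near
  \<open>x\<close>, such as inverse charts and trivialisations in coordinates.\<close>

definition has_tangent_map ::
    "('a, 'e::real_normed_vector) manifold \<Rightarrow> ('b, 'f::real_normed_vector) manifold \<Rightarrow>
     ('a \<Rightarrow> 'b) \<Rightarrow> 'a \<Rightarrow> ('e \<Rightarrow> 'f) \<Rightarrow> bool" where
  "has_tangent_map M N f x f' \<longleftrightarrow> x \<in> points M \<and>
     (\<exists>W. openin (mtop M) W \<and> x \<in> W \<and> continuous_map (subtopology (mtop M) W) (mtop N) f) \<and>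
     (snd (chart_at N (f x)) \<circ> f \<circ> chart_inv (chart_at M x) has_derivative f') (at (snd (chart_at M x) x))"

text \<open>The properties of preferred charts that the calculus of tangent maps needs. Unlike
  \<open>smooth_manifold\<close>, they are immediate for \<open>model_manifold\<close>.\<close>

definition charted :: "('a, 'e::real_normed_vector) manifold \<Rightarrow> bool" where
  "charted M \<longleftrightarrow> (\<forall>x\<in>points M. x \<in> fst (chart_at M x) \<and> openin (mtop M) (fst (chart_at M x)) \<and>
     inj_on (snd (chart_at M x)) (fst (chart_at M x)) \<and>
     (\<forall>W. openin (mtop M) W \<longrightarrow> open (snd (chart_at M x) ` (fst (chart_at M x) \<inter> W))))"

lemma charted_smooth_manifold: "smooth_manifold M \<Longrightarrow> charted M"
  using chart_at_props[of M] chart_open[of M] chart_inj[of M] chart_image_open[of M]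
  by (simp add: charted_def)

lemma chart_at_model [simp]: "chart_at model_manifold x = (UNIV, id)"
proof -
  have "(SOME c. c = (UNIV, id) \<and> x \<in> fst c) = (UNIV, id)" by (rule some_equality) auto
  then show ?thesis by (simp add: chart_at_def model_manifold_def)
qed

lemma mtop_model [simp]: "mtop model_manifold = euclidean"
  by (simp add: model_manifold_def)

lemma chart_inv_model [simp]: "chart_inv (UNIV, id) = id"
  by (simp add: chart_inv_def fun_eq_iff)

lemma charted_model: "charted (model_manifold :: ('e::real_normed_vector, 'e) manifold)"
  by (simp add: charted_def)

lemma charted_inv:
  assumes "charted M" "x \<in> points M" "y \<in> fst (chart_at M x)"
  shows "chart_inv (chart_at M x) (snd (chart_at M x) y) = y"
  using assms by (simp add: charted_def chart_inv_def)

lemma has_tangent_map_points: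
  assumes "has_tangent_map M N f x f'"
  shows "x \<in> points M" "f x \<in> points N"
  using assms by (auto simp: has_tangent_map_def continuous_map_def Pi_iff)

text \<open>Continuity of \<open>f\<close> near \<open>x\<close> keeps its values inside the
  preferred chart at \<open>f x\<close>. Only there do the coordinate expressions of the two maps
  compose to the one of \<open>g \<circ> f\<close>.\<close>

lemma has_tangent_map_compose:
  assumes M: "charted M" and N: "charted N"
    and f: "has_tangent_map M N f x f'" and g: "has_tangent_map N Q g (f x) g'"
  shows "has_tangent_map M Q (g \<circ> f) x (g' \<circ> f')"
proof -
  obtain W1 where W1: "openin (mtop M) W1" "x \<in> W1" "continuous_map (subtopology (mtop M) W1) (mtop N) f"
    using f by (auto simp: has_tangent_map_def)
  obtain W2 where W2: "openin (mtop N) W2" "f x \<in> W2" "continuous_map (subtopology (mtop N) W2) (mtop Q) g"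
    using g by (auto simp: has_tangent_map_def)
  have x: "x \<in> points M" "f x \<in> points N" using has_tangent_map_points[OF f] .
  let ?c = "chart_at M x" and ?d = "chart_at N (f x)"
  have c: "x \<in> fst ?c" "f x \<in> fst ?d" "openin (mtop N) (fst ?d)"
    using M N x by (auto simp: charted_def)
  have pre: "openin (mtop M) {y \<in> W1. f y \<in> V}" if "openin (mtop N) V" for V
  proof -
    have "openin (subtopology (mtop M) W1) {y \<in> topspace (subtopology (mtop M) W1). f y \<in> V}"
      using W1(3) that by (rule openin_continuous_map_preimage)
    moreover have "{y \<in> topspace (subtopology (mtop M) W1). f y \<in> V} = {y \<in> W1. f y \<in> V}"
      using openin_subset[OF W1(1)] by auto
    ultimately show ?thesis using W1(1) openin_trans_full by metis
  qed
  let ?W = "{y \<in> W1. f y \<in> W2}"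
  have "continuous_map (subtopology (mtop M) ?W) (subtopology (mtop N) W2) f"
    using continuous_map_from_subtopology_mono[OF W1(3), of ?W] by (auto simp: continuous_map_in_subtopology)
  then have cont: "continuous_map (subtopology (mtop M) ?W) (mtop Q) (g \<circ> f)"
    using W2(3) by (rule continuous_map_compose)
  let ?V = "{y \<in> W1. f y \<in> fst ?d}"
  have op: "open (snd ?c ` (fst ?c \<inter> ?V))"
    using M x(1) pre[OF c(3)] by (auto simp: charted_def)
  have df: "(snd ?d \<circ> f \<circ> chart_inv ?c has_derivative f') (at (snd ?c x))"
    using f by (simp add: has_tangent_map_def)
  have dg: "(snd (chart_at Q (g (f x))) \<circ> g \<circ> chart_inv ?d has_derivative g')
      (at ((snd ?d \<circ> f \<circ> chart_inv ?c) (snd ?c x)))"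
    using g charted_inv[OF M x(1) c(1)] by (simp add: has_tangent_map_def)
  have "(snd (chart_at Q (g (f x))) \<circ> (g \<circ> f) \<circ> chart_inv ?c has_derivative g' \<circ> f') (at (snd ?c x))"
  proof (rule has_derivative_compose_near[OF df dg op])
    show "snd ?c x \<in> snd ?c ` (fst ?c \<inter> ?V)" using c W1(2) by blast
    fix y assume "y \<in> snd ?c ` (fst ?c \<inter> ?V)"
    then obtain p where p: "p \<in> fst ?c" "f p \<in> fst ?d" "y = snd ?c p" by blast
    then show "(snd (chart_at Q (g (f x))) \<circ> g \<circ> chart_inv ?d) ((snd ?d \<circ> f \<circ> chart_inv ?c) y) =
        (snd (chart_at Q (g (f x))) \<circ> (g \<circ> f) \<circ> chart_inv ?c) y"
      using charted_inv[OF M x(1) p(1)] charted_inv[OF N x(2) p(2)] by simp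
  qed
  then show ?thesis
    using x(1) cont pre[OF W2(1)] W1(2) W2(2) unfolding has_tangent_map_def by auto
qed

text \<open>The means by which identities between tangent maps are obtained: one map, written near
  \<open>x\<close> in two ways, is differentiated twice.\<close>

lemma has_tangent_map_unique:
  assumes M: "charted M" and f: "has_tangent_map M N f x f'" and h: "has_tangent_map M N h x h'"
    and W: "openin (mtop M) W" "x \<in> W" "\<And>y. y \<in> W \<Longrightarrow> f y = h y"
  shows "f' = h'"
proof -
  have x: "x \<in> points M" using has_tangent_map_points[OF f] by simp
  let ?c = "chart_at M x"
  have c: "x \<in> fst ?c" "open (snd ?c ` (fst ?c \<inter> W))" using M x W by (auto simp: charted_def)
  have "(snd (chart_at N (f x)) \<circ> f \<circ> chart_inv ?c has_derivative f') (at (snd ?c x))"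
    using f by (simp add: has_tangent_map_def)
  then have "(snd (chart_at N (h x)) \<circ> h \<circ> chart_inv ?c has_derivative f') (at (snd ?c x))"
  proof (rule has_derivative_transform_within_open[OF _ c(2)])
    show "snd ?c x \<in> snd ?c ` (fst ?c \<inter> W)" using c W by blast
    fix y assume "y \<in> snd ?c ` (fst ?c \<inter> W)"
    then show "(snd (chart_at N (f x)) \<circ> f \<circ> chart_inv ?c) y = (snd (chart_at N (h x)) \<circ> h \<circ> chart_inv ?c) y"
      using charted_inv[OF M x] W by auto
  qed
  moreover have "(snd (chart_at N (h x)) \<circ> h \<circ> chart_inv ?c has_derivative h') (at (snd ?c x))"
    using h by (simp add: has_tangent_map_def)
  ultimately show ?thesis by (rule has_derivative_unique)
qed

lemma has_tangent_map_linear: "has_tangent_map M N f x f' \<Longrightarrow> linear f'"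
  by (auto simp: has_tangent_map_def intro: has_derivative_linear)

lemma has_tangent_map_id:
  assumes M: "charted M" and x: "x \<in> points M"
  shows "has_tangent_map M M id x id"
proof -
  let ?c = "chart_at M x"
  have "x \<in> fst ?c" "open (snd ?c ` (fst ?c \<inter> points M))" "openin (mtop M) (fst ?c)"
    using M x by (auto simp: charted_def)
  then have c: "x \<in> fst ?c" "open (snd ?c ` fst ?c)"
    using openin_subset[of "mtop M" "fst ?c"] by (auto simp: Int_absorb2)
  have "(id has_derivative id) (at (snd ?c x))" by (simp add: id_def)
  then have "(snd ?c \<circ> id \<circ> chart_inv ?c has_derivative id) (at (snd ?c x))"
    by (rule has_derivative_transform_within_open[OF _ c(2)]) (use c charted_inv[OF M x] in auto)
  then show ?thesis using x unfolding has_tangent_map_def by (auto intro!: exI[of _ "points M"])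
qed

lemma has_tangent_map_const:
  assumes "x \<in> points M" "q \<in> points N"
  shows "has_tangent_map M N (\<lambda>_. q) x (\<lambda>_. 0)"
proof -
  have "(snd (chart_at N q) \<circ> (\<lambda>_. q) \<circ> chart_inv (chart_at M x)) = (\<lambda>_. snd (chart_at N q) q)" by auto
  then show ?thesis using assms unfolding has_tangent_map_def by (auto intro!: exI[of _ "points M"])
qed

lemma has_tangent_map_model:
  fixes f :: "'e::real_normed_vector \<Rightarrow> 'f::real_normed_vector"
  assumes "(f has_derivative f') (at x)" "open W" "x \<in> W" "continuous_on W f"
  shows "has_tangent_map model_manifold model_manifold f x f'"
  using assms unfolding has_tangent_map_def by (auto intro!: exI[of _ W])

lemma has_tangent_map_smooth:
  assumes M: "smooth_manifold M" and N: "smooth_manifold N" and f: "smooth_map M N f" and x: "x \<in> points M"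
  shows "has_tangent_map M N f x (tangent_map M N f x)"
proof -
  have cont: "continuous_map (mtop M) (mtop N) f" using f by (simp add: smooth_map_def)
  then have fx: "f x \<in> points N" using x by (auto simp: continuous_map_def)
  have "snd (chart_at M x) x \<in> snd (chart_at M x) ` (fst (chart_at M x) \<inter> f -` fst (chart_at N (f x)))"
    using chart_at_props[OF M x] chart_at_props[OF N fx] by auto
  moreover have "smooth_on (snd (chart_at N (f x)) \<circ> f \<circ> chart_inv (chart_at M x))
      (snd (chart_at M x) ` (fst (chart_at M x) \<inter> f -` fst (chart_at N (f x))))"
    using f chart_at_props[OF M x] chart_at_props[OF N fx] by (auto simp: smooth_map_def)
  ultimately have "(snd (chart_at N (f x)) \<circ> f \<circ> chart_inv (chart_at M x) has_derivative tangent_map M N f x)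
      (at (snd (chart_at M x) x))"
    unfolding tangent_map_def by (intro smooth_on_has_derivative)
  then show ?thesis
    using x cont unfolding has_tangent_map_def by (auto intro!: exI[of _ "points M"])
qed

lemma has_tangent_map_chart_inv:
  assumes M: "smooth_manifold M" and c: "c \<in> atlas M" and x: "x \<in> fst c"
  shows "has_tangent_map model_manifold M (chart_inv c) (snd c x) (chart_vector M c x)"
proof -
  have "continuous_map (subtopology euclidean (snd c ` fst c)) (mtop M) (chart_inv c)"
    by (rule continuous_map_chart_inv[OF M c])
  then show ?thesis
    using chart_vector_has_derivative[OF M c x] chart_inv_left[OF M c x] chart_open(2)[OF M c] x
    unfolding has_tangent_map_def by (auto intro!: exI[of _ "snd c ` fst c"])
qed

section \<open>Charts of products and of open submanifolds\<close>

lemma chart_inv_prod: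
  assumes "inj_on (snd c) (fst c)" "inj_on (snd d) (fst d)" "p \<in> fst c" "q \<in> fst d"
  shows "chart_inv (fst c \<times> fst d, map_prod (snd c) (snd d)) (snd c p, snd d q) = (p, q)"
proof -
  have "inj_on (map_prod (snd c) (snd d)) (fst c \<times> fst d)" using assms(1,2) by (rule map_prod_inj_on)
  from inv_into_f_f[OF this, of "(p, q)"] show ?thesis using assms(3,4) by (simp add: chart_inv_def)
qed

lemma prod_chart_in_atlas:
  "c \<in> atlas M \<Longrightarrow> d \<in> atlas N \<Longrightarrow> (fst c \<times> fst d, map_prod (snd c) (snd d)) \<in> atlas (prod_manifold M N)"
  unfolding prod_manifold_def manifold.simps by (intro CollectI exI[of _ c] exI[of _ d] conjI refl)

lemma sub_chart_in_atlas:
  "c \<in> atlas M \<Longrightarrow> (fst c \<inter> W, snd c) \<in> atlas (open_submanifold M W)"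
  unfolding open_submanifold_def manifold.simps by (intro CollectI exI[of _ c] conjI refl)

text \<open>Orbit maps and translations arise from smooth maps on a product by fixing the first
  argument. Their coordinate expression is that of the product map restricted to an affine
  slice.\<close>

lemma has_tangent_map_slice:
  assumes M: "smooth_manifold M" and N: "smooth_manifold N" and Q: "smooth_manifold Q"
    and f: "smooth_map (prod_manifold M N) Q f" and p: "p \<in> points M" and x: "x \<in> points N"
  shows "has_tangent_map N Q (\<lambda>h. f (p, h)) x (tangent_map N Q (\<lambda>h. f (p, h)) x)"
proof -
  have cont: "continuous_map (prod_topology (mtop M) (mtop N)) (mtop Q) f"
    using f by (simp add: smooth_map_def prod_manifold_def)
  have "continuous_map (mtop N) (prod_topology (mtop M) (mtop N)) (\<lambda>h. (p, h))"
    using p by (simp add: continuous_map_pairedI)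
  then have cont2: "continuous_map (mtop N) (mtop Q) (\<lambda>h. f (p, h))"
    using continuous_map_compose[OF _ cont] by (simp add: o_def)
  have fx: "f (p, x) \<in> points Q" using cont2 x by (auto simp: continuous_map_def)
  let ?c = "chart_at M p" and ?d = "chart_at N x" and ?q = "chart_at Q (f (p, x))"
  have c: "?c \<in> atlas M" "p \<in> fst ?c" and d: "?d \<in> atlas N" "x \<in> fst ?d" and q: "?q \<in> atlas Q" "f (p, x) \<in> fst ?q"
    using chart_at_props[OF M p] chart_at_props[OF N x] chart_at_props[OF Q fx] by auto
  let ?pc = "(fst ?c \<times> fst ?d, map_prod (snd ?c) (snd ?d))"
  let ?F = "snd ?q \<circ> f \<circ> chart_inv ?pc"
  have "smooth_on ?F (snd ?pc ` (fst ?pc \<inter> f -` fst ?q))"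
    using f prod_chart_in_atlas[OF c(1) d(1)] q(1) unfolding smooth_map_def by blast
  moreover have "(snd ?c p, snd ?d x) \<in> snd ?pc ` (fst ?pc \<inter> f -` fst ?q)"
    using c d q by (auto intro!: image_eqI[of _ _ "(p, x)"])
  ultimately have F: "(?F has_derivative frechet_derivative ?F (at (snd ?c p, snd ?d x))) (at (snd ?c p, snd ?d x))"
    by (rule smooth_on_has_derivative)
  have "((\<lambda>z. (snd ?c p, z)) has_derivative (\<lambda>w. (0, w))) (at (snd ?d x))"
    by (intro derivative_intros)
  moreover have "?F (snd ?c p, z) = (snd ?q \<circ> (\<lambda>h. f (p, h)) \<circ> chart_inv ?d) z" if "z \<in> snd ?d ` fst ?d" for z
  proof -
    obtain h where h: "h \<in> fst ?d" "z = snd ?d h" using \<open>z \<in> snd ?d ` fst ?d\<close> by blast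
    show ?thesis
      using chart_inv_prod[OF chart_inj[OF M c(1)] chart_inj[OF N d(1)] c(2) h(1)] chart_inv_left[OF N d(1) h(1)]
      by (simp add: h(2))
  qed
  ultimately have "(snd ?q \<circ> (\<lambda>h. f (p, h)) \<circ> chart_inv ?d has_derivative
      frechet_derivative ?F (at (snd ?c p, snd ?d x)) \<circ> (\<lambda>w. (0, w))) (at (snd ?d x))"
    using d(2) F by (intro has_derivative_compose_near[OF _ _ chart_open(2)[OF N d(1)]]) auto
  then have "(snd ?q \<circ> (\<lambda>h. f (p, h)) \<circ> chart_inv ?d) differentiable (at (snd ?d x))"
    by (auto simp: differentiable_def)
  then show ?thesis
    using x cont2 unfolding has_tangent_map_def tangent_map_def
    by (auto intro!: exI[of _ "points N"] simp: frechet_derivative_works)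
qed

section \<open>Local trivialisations\<close>

text \<open>The objects \<open>hg\<close>, \<open>\<epsilon>g\<close>, \<open>\<mu>g\<close> and
  \<open>\<nu>\<close>, whose existence is asserted by \<open>orbit_volume_function\<close>, are
  fixed here together with the bundle.\<close>

locale riemannian_principal_bundle =
  fixes G :: "'g monoid"
    and MG :: "('g, 'k::real_normed_vector) manifold"
    and P :: "('p, 'e::real_normed_vector) manifold"
    and B :: "('b, 'f::real_normed_vector) manifold"
    and \<pi> :: "'p \<Rightarrow> 'b"
    and act :: "'p \<times> 'g \<Rightarrow> 'p"
    and hP :: "'p \<Rightarrow> 'e \<Rightarrow> 'e \<Rightarrow> real"
    and hB :: "'b \<Rightarrow> 'f \<Rightarrow> 'f \<Rightarrow> real"
    and \<epsilon>P :: "'p \<Rightarrow> 'e list \<Rightarrow> real" and \<mu>P :: "'p \<Rightarrow> 'e list \<Rightarrow> real"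
    and \<epsilon>B :: "'b \<Rightarrow> 'f list \<Rightarrow> real" and \<mu>B :: "'b \<Rightarrow> 'f list \<Rightarrow> real"
    and V :: "'b \<Rightarrow> real"
    and hg :: "'p \<Rightarrow> 'k \<Rightarrow> 'k \<Rightarrow> real" and \<epsilon>g :: "'k list \<Rightarrow> real"
    and \<mu>g :: "'p \<Rightarrow> 'k list \<Rightarrow> real" and \<nu> :: "'g \<Rightarrow> 'k list \<Rightarrow> real"
  assumes principal: "principal_bundle G MG P B \<pi> act"
    and compact_G: "compact_space (mtop MG)" and compact_P: "compact_space (mtop P)"
    and orientation_P: "manifold_orientation P \<epsilon>P" and orientation_B: "manifold_orientation B \<epsilon>B"
    and metric_P: "riemannian_metric P hP" and volume_P: "riemannian_volume_form P hP \<epsilon>P \<mu>P"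
    and metric_B: "riemannian_metric B hB" and volume_B: "riemannian_volume_form B hB \<epsilon>B \<mu>B"
    and submersion: "riemannian_submersion P B hP hB \<pi>"
    and V_continuous: "continuous_map (mtop B) euclideanreal V" and V_pos: "\<And>b. b \<in> points B \<Longrightarrow> V b > 0"
    and fibre: "fibre_metric G MG P B \<pi> act hP hB hg"
    and orientation_g: "orientation \<epsilon>g"
    and volume_g: "\<And>x. x \<in> points P \<Longrightarrow> euclidean_volume_form (hg x) \<epsilon>g (\<mu>g x)"
    and biinvariant: "biinvariant_volume_form G MG \<nu>"
    and normalised: "form_integral MG (left_invariant_orientation G MG \<epsilon>g) \<nu> = 1"
    and V_volume: "\<And>x vs. x \<in> points P \<Longrightarrow> length vs = dim (UNIV :: 'k set) \<Longrightarrow>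
        V (\<pi> x) * \<nu> \<one>\<^bsub>G\<^esub> vs = \<mu>g x vs"
begin

lemma manifolds: "smooth_manifold MG" "smooth_manifold P" "smooth_manifold B"
  and group_G: "group G" and points_MG: "points MG = carrier G"
  using principal by (auto simp: principal_bundle_def lie_group_def)

lemmas MG = manifolds(1) and P = manifolds(2) and B = manifolds(3)

lemma one_MG: "\<one>\<^bsub>G\<^esub> \<in> points MG"
  by (simp add: points_MG group.is_monoid[OF group_G])

lemma \<pi>_smooth: "smooth_map P B \<pi>"
  using principal by (simp add: principal_bundle_def)

lemma \<pi>_continuous: "continuous_map (mtop P) (mtop B) \<pi>"
  using \<pi>_smooth by (simp add: smooth_map_def)

lemma tangent_\<pi>: "x \<in> points P \<Longrightarrow> has_tangent_map P B \<pi> x (tangent_map P B \<pi> x)"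
  by (rule has_tangent_map_smooth[OF P B \<pi>_smooth])

lemma tangent_orbit:
  assumes "x \<in> points P"
  shows "has_tangent_map MG P (\<lambda>g. act (x, g)) \<one>\<^bsub>G\<^esub> (orbit_map_deriv G MG P act x)"
  unfolding orbit_map_deriv_def
  using principal assms one_MG
  by (intro has_tangent_map_slice[OF P MG P]) (auto simp: principal_bundle_def smooth_right_action_def)

lemma tangent_left_mult:
  assumes "a \<in> carrier G" "g \<in> carrier G"
  shows "has_tangent_map MG MG (\<lambda>h. a \<otimes>\<^bsub>G\<^esub> h) g (tangent_map MG MG (\<lambda>h. a \<otimes>\<^bsub>G\<^esub> h) g)"
proof -
  have "smooth_map (prod_manifold MG MG) MG (\<lambda>(g, h). g \<otimes>\<^bsub>G\<^esub> h)"
    using principal by (simp add: principal_bundle_def lie_group_def)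
  from has_tangent_map_slice[OF MG MG MG this, of a g] show ?thesis using assms points_MG by simp
qed

abbreviation (input) "maurer_cartan g \<equiv> tangent_map MG MG (\<lambda>h. inv\<^bsub>G\<^esub> g \<otimes>\<^bsub>G\<^esub> h) g"

definition trivialisation :: "'b set \<Rightarrow> ('b \<times> 'g \<Rightarrow> 'p) \<Rightarrow> bool" where
  "trivialisation U \<psi> \<longleftrightarrow> openin (mtop B) U \<and>
     diffeomorphism (prod_manifold (open_submanifold B U) MG)
       (open_submanifold P {x \<in> points P. \<pi> x \<in> U}) \<psi> \<and>
     (\<forall>u\<in>U. \<forall>g\<in>carrier G. \<pi> (\<psi> (u, g)) = u \<and>
        (\<forall>h\<in>carrier G. act (\<psi> (u, g), h) = \<psi> (u, g \<otimes>\<^bsub>G\<^esub> h)))"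

lemma ex_trivialisation: "b \<in> points B \<Longrightarrow> \<exists>U \<psi>. b \<in> U \<and> trivialisation U \<psi>"
  using principal unfolding principal_bundle_def trivialisation_def by blast

context
  fixes U \<psi> assumes triv: "trivialisation U \<psi>"
begin

abbreviation (input) "PU \<equiv> {x \<in> points P. \<pi> x \<in> U}"

definition "\<psi>i = inv_into (U \<times> carrier G) \<psi>"

lemma U_open: "openin (mtop B) U" and U_subset: "U \<subseteq> points B"
  using triv openin_subset by (auto simp: trivialisation_def)

lemma PU_open: "openin (mtop P) PU"
  using openin_continuous_map_preimage[OF \<pi>_continuous U_open] .

lemma \<pi>_\<psi>: "u \<in> U \<Longrightarrow> g \<in> carrier G \<Longrightarrow> \<pi> (\<psi> (u, g)) = u"
  and act_\<psi>: "u \<in> U \<Longrightarrow> g \<in> carrier G \<Longrightarrow> h \<in> carrier G \<Longrightarrow> act (\<psi> (u, g), h) = \<psi> (u, g \<otimes>\<^bsub>G\<^esub> h)"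
  using triv by (auto simp: trivialisation_def)

lemma points_sub:
  "points (open_submanifold P PU) = PU"
  "points (prod_manifold (open_submanifold B U) MG) = U \<times> carrier G"
  using U_subset by (auto simp: open_submanifold_def prod_manifold_def points_MG)

lemma \<psi>_bij: "bij_betw \<psi> (U \<times> carrier G) PU"
  and \<psi>_smooth: "smooth_map (prod_manifold (open_submanifold B U) MG) (open_submanifold P PU) \<psi>"
  and \<psi>i_smooth: "smooth_map (open_submanifold P PU) (prod_manifold (open_submanifold B U) MG) \<psi>i"
  using triv unfolding trivialisation_def diffeomorphism_def \<psi>i_def by (auto simp: points_sub)

lemma \<psi>_mem: "u \<in> U \<Longrightarrow> g \<in> carrier G \<Longrightarrow> \<psi> (u, g) \<in> points P"
  using \<psi>_bij by (auto simp: bij_betw_def)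

lemma \<psi>i_\<psi>: "u \<in> U \<Longrightarrow> g \<in> carrier G \<Longrightarrow> \<psi>i (\<psi> (u, g)) = (u, g)"
  unfolding \<psi>i_def using \<psi>_bij by (intro inv_into_f_f) (auto simp: bij_betw_def)

lemma \<psi>_\<psi>i: "x \<in> PU \<Longrightarrow> \<psi> (\<psi>i x) = x" and \<psi>i_mem: "x \<in> PU \<Longrightarrow> \<psi>i x \<in> U \<times> carrier G"
proof -
  assume x: "x \<in> PU"
  then have *: "x \<in> \<psi> ` (U \<times> carrier G)" using \<psi>_bij by (simp add: bij_betw_def)
  show "\<psi> (\<psi>i x) = x" unfolding \<psi>i_def by (rule f_inv_into_f[OF *])
  show "\<psi>i x \<in> U \<times> carrier G" unfolding \<psi>i_def by (rule inv_into_into[OF *])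
qed

lemma \<psi>_continuous: "continuous_map (prod_topology (subtopology (mtop B) U) (mtop MG)) (subtopology (mtop P) PU) \<psi>"
  and \<psi>i_continuous: "continuous_map (subtopology (mtop P) PU) (prod_topology (subtopology (mtop B) U) (mtop MG)) \<psi>i"
  using \<psi>_smooth \<psi>i_smooth by (auto simp: smooth_map_def prod_manifold_def open_submanifold_def)

lemma sub_chart_inv:
  assumes "inj_on (snd c) (fst c)" "x \<in> fst c" "x \<in> W"
  shows "chart_inv (fst c \<inter> W, snd c) (snd c x) = x"
  unfolding chart_inv_def using assms by (auto intro!: inv_into_f_f intro: inj_on_subset)

section \<open>Product coordinates over a trivialising set\<close>

context
  fixes d :: "('b, 'f) chart" and k :: "('g, 'k) chart"
  assumes d: "d \<in> atlas B" and k: "k \<in> atlas MG"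
begin

abbreviation (input) "DK \<equiv> (snd d ` (fst d \<inter> U)) \<times> (snd k ` fst k)"

text \<open>The trivialisation read in the charts \<open>d\<close> and \<open>k\<close> parametrises
  a part of \<open>P\<close> by an open set of the product model space, with local inverse
  \<open>\<Xi>\<close>. The two replace a chart of \<open>P\<close> that the atlas need not
  contain.\<close>

definition "\<Psi> = (\<lambda>x. \<psi> (chart_inv d (fst x), chart_inv k (snd x)))"

definition "\<Xi> = (\<lambda>x. (snd d (fst (\<psi>i x)), snd k (snd (\<psi>i x))))"

lemma k_subset: "fst k \<subseteq> carrier G"
  using chart_subset[OF MG k] points_MG by simp

lemma dom_open: "open DK"
  using chart_image_open[OF B d U_open] chart_open(2)[OF MG k] by (rule open_Times)

lemma dom_inv:
  assumes "x \<in> DK"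
  shows "chart_inv d (fst x) \<in> fst d \<inter> U" "snd d (chart_inv d (fst x)) = fst x"
    "chart_inv k (snd x) \<in> fst k" "snd k (chart_inv k (snd x)) = snd x"
  using assms chart_inv_left[OF B d] chart_inv_left[OF MG k] by auto

lemma \<Psi>_mem: "x \<in> DK \<Longrightarrow> \<Psi> x \<in> PU"
  using dom_inv[of x] k_subset \<psi>_mem \<pi>_\<psi> by (auto simp: \<Psi>_def)

lemma \<Psi>_continuous: "continuous_map (top_of_set DK) (mtop P) \<Psi>"
proof -
  have "continuous_map (top_of_set DK) (top_of_set (snd d ` fst d)) fst"
    "continuous_map (top_of_set DK) (top_of_set (snd k ` fst k)) snd"
    by (auto simp: continuous_map_in_subtopology intro!: continuous_intros)
  from continuous_map_compose[OF this(1) continuous_map_chart_inv[OF B d]]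
    continuous_map_compose[OF this(2) continuous_map_chart_inv[OF MG k]]
  have "continuous_map (top_of_set DK) (subtopology (mtop B) U) (chart_inv d \<circ> fst)"
    "continuous_map (top_of_set DK) (mtop MG) (chart_inv k \<circ> snd)"
    using dom_inv by (auto simp: continuous_map_in_subtopology Pi_iff)
  then have "continuous_map (top_of_set DK) (prod_topology (subtopology (mtop B) U) (mtop MG))
      (\<lambda>x. (chart_inv d (fst x), chart_inv k (snd x)))"
    by (intro continuous_map_pairedI) (simp_all add: o_def)
  from continuous_map_compose[OF this \<psi>_continuous] show ?thesis
    by (simp add: \<Psi>_def o_def continuous_map_in_subtopology)
qed

lemma \<Psi>_differentiable:
  assumes c: "c \<in> atlas P" and x: "x \<in> DK" "\<Psi> x \<in> fst c"
  shows "(snd c \<circ> \<Psi>) differentiable (at x)"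
proof -
  let ?d = "(fst d \<inter> U, snd d)" and ?c = "(fst c \<inter> PU, snd c)"
  let ?pc = "(fst ?d \<times> fst k, map_prod (snd ?d) (snd k))"
  let ?F = "snd ?c \<circ> \<psi> \<circ> chart_inv ?pc"
  have sm: "smooth_on ?F (snd ?pc ` (fst ?pc \<inter> \<psi> -` fst ?c))"
    using \<psi>_smooth[unfolded smooth_map_def, THEN conjunct2, rule_format,
        OF prod_chart_in_atlas[OF sub_chart_in_atlas[OF d] k] sub_chart_in_atlas[OF c]] .
  have inv: "chart_inv ?pc y = (chart_inv d (fst y), chart_inv k (snd y))" if y: "y \<in> DK" for y
  proof -
    have "inj_on (snd ?d) (fst ?d)" using chart_inj[OF B d] by (auto intro: inj_on_subset)
    from chart_inv_prod[OF this chart_inj[OF MG k], of "chart_inv d (fst y)" "chart_inv k (snd y)"]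
    show ?thesis using dom_inv[OF y] by simp
  qed
  have "x \<in> snd ?pc ` (fst ?pc \<inter> \<psi> -` fst ?c)"
    using x dom_inv[OF x(1)] \<Psi>_mem[OF x(1)]
    by (intro image_eqI[of _ _ "(chart_inv d (fst x), chart_inv k (snd x))"]) (auto simp: \<Psi>_def)
  note smooth_on_has_derivative[OF sm this]
  moreover have "?F y = (snd c \<circ> \<Psi>) y" if "y \<in> DK" for y
    using inv[OF that] by (simp add: \<Psi>_def)
  ultimately have "(snd c \<circ> \<Psi> has_derivative frechet_derivative ?F (at x)) (at x)"
    by (rule has_derivative_transform_within_open[OF _ dom_open x(1)])
  then show ?thesis by (auto simp: differentiable_def)
qed

lemma \<Xi>_differentiable:
  assumes c: "c \<in> atlas P" and x: "x \<in> PU" "x \<in> fst c" "\<psi>i x \<in> fst d \<times> fst k"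
  shows "(\<Xi> \<circ> chart_inv c) differentiable (at (snd c x))"
proof -
  let ?d = "(fst d \<inter> U, snd d)" and ?c = "(fst c \<inter> PU, snd c)"
  let ?pc = "(fst ?d \<times> fst k, map_prod (snd ?d) (snd k))"
  let ?F = "snd ?pc \<circ> \<psi>i \<circ> chart_inv ?c"
  have sm: "smooth_on ?F (snd ?c ` (fst ?c \<inter> \<psi>i -` fst ?pc))"
    using \<psi>i_smooth[unfolded smooth_map_def, THEN conjunct2, rule_format,
        OF sub_chart_in_atlas[OF c] prod_chart_in_atlas[OF sub_chart_in_atlas[OF d] k]] .
  have "snd c x \<in> snd ?c ` (fst ?c \<inter> \<psi>i -` fst ?pc)"
    using x \<psi>i_mem[OF x(1)] by (intro image_eqI[of _ _ x]) auto
  from smooth_on_has_derivative[OF sm this]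
  have "(\<Xi> \<circ> chart_inv c has_derivative frechet_derivative ?F (at (snd c x))) (at (snd c x))"
  proof (rule has_derivative_transform_within_open[OF _ chart_image_open[OF P c PU_open]])
    show "snd c x \<in> snd c ` (fst c \<inter> PU)" using x by blast
    fix y assume "y \<in> snd c ` (fst c \<inter> PU)"
    then obtain p where p: "p \<in> fst c" "p \<in> PU" "y = snd c p" by blast
    show "?F y = (\<Xi> \<circ> chart_inv c) y"
      using sub_chart_inv[OF chart_inj[OF P c] p(1,2)] chart_inv_left[OF P c p(1)] p(3)
      by (simp add: \<Xi>_def map_prod_def split_beta)
  qed
  then show ?thesis by (auto simp: differentiable_def)
qed

text \<open>\<open>L\<close> is the differential of the trivialisation in the charts \<open>d\<close> and \<open>k\<close>.\<close>

lemma trivialisation_tangent: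
  assumes x: "x \<in> DK"
  defines "p \<equiv> \<Psi> x" and "u \<equiv> chart_inv d (fst x)" and "g \<equiv> chart_inv k (snd x)"
  defines "\<l> \<equiv> maurer_cartan g"
  obtains L where "has_tangent_map model_manifold P \<Psi> x L" "bij L"
    "\<And>v w. tangent_map P B \<pi> p (L (v, w)) = chart_vector B d u v"
    "\<And>w. L (0, w) = orbit_map_deriv G MG P act p (\<l> (chart_vector MG k g w))"
proof -
  have p: "p \<in> points P" "\<pi> p \<in> U" "p \<in> PU" using \<Psi>_mem[OF x] by (auto simp: p_def)
  have u: "u \<in> fst d" "u \<in> U" "snd d u = fst x" and g: "g \<in> fst k" "g \<in> carrier G" "snd k g = snd x"
    using dom_inv[OF x] k_subset by (auto simp: u_def g_def)
  have p': "p = \<psi> (u, g)" by (simp add: p_def \<Psi>_def u_def g_def)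
  note cM = charted_smooth_manifold[OF P] charted_smooth_manifold[OF B] charted_smooth_manifold[OF MG]
    charted_model
  define L where "L = frechet_derivative (snd (chart_at P p) \<circ> \<Psi>) (at x)"
  have "(snd (chart_at P p) \<circ> \<Psi>) differentiable (at x)"
    using \<Psi>_differentiable[OF chart_at_props(1)[OF P p(1)] x] chart_at_props(2)[OF P p(1)] by (simp add: p_def)
  then have L: "has_tangent_map model_manifold P \<Psi> x L"
    using \<Psi>_continuous dom_open x unfolding has_tangent_map_def L_def p_def frechet_derivative_works
    by (auto intro!: exI[of _ DK])
  \<comment> \<open>The map \<open>\<Xi>\<close> is differentiable because the inverse of a
    trivialisation is smooth; \<open>L'\<close> is going to be the two-sided inverse of
    \<open>L\<close>.\<close>
  define L' where "L' = frechet_derivative (\<Xi> \<circ> chart_inv (chart_at P p)) (at (snd (chart_at P p) p))"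
  have \<psi>ip: "\<psi>i p = (u, g)" unfolding p' by (rule \<psi>i_\<psi>[OF u(2) g(2)])
  let ?W = "{q \<in> PU. \<psi>i q \<in> (fst d \<inter> U) \<times> fst k}"
  have opW: "openin (mtop P) ?W"
  proof -
    have "openin (subtopology (mtop B) U) (fst d \<inter> U)"
      using chart_open(1)[OF B d] by (auto simp: openin_subtopology)
    then have "openin (prod_topology (subtopology (mtop B) U) (mtop MG)) ((fst d \<inter> U) \<times> fst k)"
      using chart_open(1)[OF MG k] by (simp add: openin_prod_Times_iff)
    from openin_continuous_map_preimage[OF \<psi>i_continuous this]
    have "openin (subtopology (mtop P) PU) ?W" by (simp add: Int_absorb1 conj_ac cong: conj_cong)
    then show ?thesis using PU_open openin_trans_full by blast
  qed
  have "continuous_map (subtopology (mtop P) ?W) euclidean \<Xi>"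
  proof -
    have "continuous_map (subtopology (mtop P) ?W) (prod_topology (subtopology (mtop B) U) (mtop MG)) \<psi>i"
      by (rule continuous_map_from_subtopology_mono[OF \<psi>i_continuous]) auto
    then have c1: "continuous_map (subtopology (mtop P) ?W) (subtopology (mtop B) (fst d)) (fst \<circ> \<psi>i)"
      and c2: "continuous_map (subtopology (mtop P) ?W) (subtopology (mtop MG) (fst k)) (snd \<circ> \<psi>i)"
      by (auto simp: continuous_map_pairwise continuous_map_in_subtopology)
    from continuous_map_compose[OF c1 homeomorphic_imp_continuous_map[OF chart_homeomorphic[OF B d]]]
      continuous_map_compose[OF c2 homeomorphic_imp_continuous_map[OF chart_homeomorphic[OF MG k]]]
    have "continuous_map (subtopology (mtop P) ?W) euclidean (\<lambda>q. snd d (fst (\<psi>i q)))"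
      "continuous_map (subtopology (mtop P) ?W) euclidean (\<lambda>q. snd k (snd (\<psi>i q)))"
      by (auto simp: continuous_map_in_subtopology o_def)
    from continuous_map_pairedI[OF this] show ?thesis
      by (simp add: \<Xi>_def)
  qed
  moreover have "(\<Xi> \<circ> chart_inv (chart_at P p)) differentiable (at (snd (chart_at P p) p))"
    using \<Xi>_differentiable[OF chart_at_props(1)[OF P p(1)] p(3) chart_at_props(2)[OF P p(1)]] \<psi>ip u g by simp
  ultimately have L': "has_tangent_map P model_manifold \<Xi> p L'"
    using p opW u g \<psi>ip unfolding has_tangent_map_def L'_def frechet_derivative_works
    by (auto intro!: exI[of _ ?W])
  have \<Xi>\<Psi>: "\<Xi> (\<Psi> y) = y" if "y \<in> DK" for y
    using dom_inv[OF that] k_subset \<psi>i_\<psi> by (auto simp: \<Xi>_def \<Psi>_def prod_eq_iff)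
  have \<Psi>\<Xi>: "\<Psi> (\<Xi> q) = q" if "q \<in> ?W" for q
    using that \<psi>_\<psi>i[of q] chart_inv_left[OF B d] chart_inv_left[OF MG k]
    by (auto simp: \<Xi>_def \<Psi>_def mem_Times_iff)
  have \<Xi>p: "\<Xi> p = x" unfolding p_def by (rule \<Xi>\<Psi>[OF x])
  have "L' \<circ> L = id"
    by (rule has_tangent_map_unique[OF cM(4) has_tangent_map_compose[OF cM(4) cM(1) L L'[unfolded p_def]] has_tangent_map_id[OF cM(4)], of DK])
      (use dom_open x \<Xi>\<Psi> in auto)
  moreover have "L \<circ> L' = id"
    by (rule has_tangent_map_unique[OF cM(1) has_tangent_map_compose[OF cM(1) cM(4) L' L[folded \<Xi>p]] has_tangent_map_id[OF cM(1)], of ?W])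
      (use opW p u g \<psi>ip \<Psi>\<Xi> in auto)
  ultimately have bij: "bij L" using o_bij by blast
  have D: "tangent_map P B \<pi> p (L (v, w)) = chart_vector B d u v" for v w
  proof -
    have f: "has_tangent_map model_manifold model_manifold fst x fst"
      by (rule has_tangent_map_model[OF _ open_UNIV]) (auto intro!: derivative_eq_intros continuous_intros)
    have "has_tangent_map model_manifold B (chart_inv d) (fst x) (chart_vector B d u)"
      using has_tangent_map_chart_inv[OF B d u(1)] u(3) by simp
    then have A: "has_tangent_map model_manifold B (chart_inv d \<circ> fst) x (chart_vector B d u \<circ> fst)"
      by (rule has_tangent_map_compose[OF cM(4) cM(4) f])
    have eq: "\<pi> (\<Psi> y) = chart_inv d (fst y)" if "y \<in> DK" for y
      using dom_inv(1,3)[OF that] k_subset \<pi>_\<psi> by (auto simp: \<Psi>_def)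
    have "tangent_map P B \<pi> (\<Psi> x) \<circ> L = chart_vector B d u \<circ> fst"
      by (rule has_tangent_map_unique[OF cM(4) has_tangent_map_compose[OF cM(4) cM(1) L tangent_\<pi>[OF p(1), unfolded p_def]] A, of DK])
        (use dom_open x eq in simp_all)
    then show ?thesis by (simp add: p_def fun_eq_iff)
  qed
  \<comment> \<open>Equivariance gives \<open>\<psi> (u, h)\<close> as the action on
    \<open>p\<close> of the inverse of \<open>g\<close> times \<open>h\<close>. With the base
    coordinate fixed, \<open>\<Psi>\<close> is therefore an inverse chart of the group, followed by
    left translation by the inverse of \<open>g\<close>, followed by the orbit map of
    \<open>p\<close>.\<close>
  have O: "L (0, w) = orbit_map_deriv G MG P act p (\<l> (chart_vector MG k g w))" for w
  proof -
    have "((\<lambda>z. (fst x, z)) has_derivative (\<lambda>w. (0, w))) (at (snd x))"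
      by (intro derivative_intros)
    then have "has_tangent_map model_manifold model_manifold (\<lambda>z. (fst x, z)) (snd x) (\<lambda>w. (0, w))"
      by (rule has_tangent_map_model[OF _ open_UNIV]) (auto intro!: continuous_intros)
    then have 1: "has_tangent_map model_manifold P (\<Psi> \<circ> (\<lambda>z. (fst x, z))) (snd x) (L \<circ> (\<lambda>w. (0, w)))"
      by (rule has_tangent_map_compose[OF cM(4) cM(4)]) (use L in simp)
    have ig: "inv\<^bsub>G\<^esub> g \<in> carrier G" "inv\<^bsub>G\<^esub> g \<otimes>\<^bsub>G\<^esub> g = \<one>\<^bsub>G\<^esub>"
      using g(2) group_G by (auto simp: group.l_inv)
    have "has_tangent_map model_manifold MG (chart_inv k) (snd x) (chart_vector MG k g)"
      using has_tangent_map_chart_inv[OF MG k g(1)] g(3) by simp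
    then have "has_tangent_map model_manifold MG ((\<lambda>h. inv\<^bsub>G\<^esub> g \<otimes>\<^bsub>G\<^esub> h) \<circ> chart_inv k) (snd x)
        (\<l> \<circ> chart_vector MG k g)"
      by (rule has_tangent_map_compose[OF cM(4) cM(3)])
        (use tangent_left_mult[OF ig(1) g(2)] in \<open>simp add: g_def[symmetric] \<l>_def\<close>)
    then have 2: "has_tangent_map model_manifold P ((\<lambda>h. act (p, h)) \<circ> ((\<lambda>h. inv\<^bsub>G\<^esub> g \<otimes>\<^bsub>G\<^esub> h) \<circ> chart_inv k)) (snd x)
        (orbit_map_deriv G MG P act p \<circ> (\<l> \<circ> chart_vector MG k g))"
      by (rule has_tangent_map_compose[OF cM(4) cM(3)])
        (use tangent_orbit[OF p(1)] ig in \<open>simp add: g_def[symmetric]\<close>)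
    have "L \<circ> (\<lambda>w. (0, w)) = orbit_map_deriv G MG P act p \<circ> (\<l> \<circ> chart_vector MG k g)"
    proof (rule has_tangent_map_unique[OF cM(4) 1 2, of "snd k ` fst k"])
      show "openin (mtop model_manifold) (snd k ` fst k)" using chart_open(2)[OF MG k] by simp
      show "snd x \<in> snd k ` fst k" using x by auto
      fix z assume "z \<in> snd k ` fst k"
      then have h: "chart_inv k z \<in> carrier G" using chart_inv_mem[OF MG k] k_subset by blast
      have "g \<otimes>\<^bsub>G\<^esub> (inv\<^bsub>G\<^esub> g \<otimes>\<^bsub>G\<^esub> chart_inv k z) = chart_inv k z"
        using group.inv_solve_left'[OF group_G] h g(2) ig(1) group_G
        by (metis group.is_monoid group.r_inv monoid.l_one monoid.m_assoc)
      then show "(\<Psi> \<circ> (\<lambda>z. (fst x, z))) z = ((\<lambda>h. act (p, h)) \<circ> ((\<lambda>h. inv\<^bsub>G\<^esub> g \<otimes>\<^bsub>G\<^esub> h) \<circ> chart_inv k)) z"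
        using act_\<psi>[OF u(2) g(2), of "inv\<^bsub>G\<^esub> g \<otimes>\<^bsub>G\<^esub> chart_inv k z"] h ig(1) group_G
        by (simp add: \<Psi>_def p' u_def[symmetric] group.is_monoid monoid.m_closed)
    qed
    then show ?thesis by (simp add: fun_eq_iff)
  qed
  show thesis by (rule that[OF L bij D O])
qed

end

end

end

section \<open>Integration along the fibres\<close>

context riemannian_principal_bundle
begin

lemma action_one: "x \<in> points P \<Longrightarrow> act (x, \<one>\<^bsub>G\<^esub>) = x"
  using principal by (simp add: principal_bundle_def smooth_right_action_def)

lemma charted_all: "charted P" "charted B" "charted MG"
  using charted_smooth_manifold manifolds by auto

text \<open>The inverse is the differential \<open>\<l>'\<close> at the unit of left translation by
  \<open>g\<close>, by the chain rule for the two composites.\<close>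

lemma left_mult_tangent_inverse:
  assumes g: "g \<in> carrier G"
  defines "\<l> \<equiv> maurer_cartan g" and "\<l>' \<equiv> tangent_map MG MG (\<lambda>h. g \<otimes>\<^bsub>G\<^esub> h) \<one>\<^bsub>G\<^esub>"
  shows "linear \<l>" "bij \<l>"
proof -
  interpret group G by (rule group_G)
  have one: "\<one>\<^bsub>G\<^esub> \<in> carrier G" by simp
  have l: "has_tangent_map MG MG (\<lambda>h. inv\<^bsub>G\<^esub> g \<otimes>\<^bsub>G\<^esub> h) g \<l>"
    and l': "has_tangent_map MG MG (\<lambda>h. g \<otimes>\<^bsub>G\<^esub> h) \<one>\<^bsub>G\<^esub> \<l>'"
    unfolding \<l>_def \<l>'_def using tangent_left_mult g by auto
  show "linear \<l>" using l by (rule has_tangent_map_linear)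
  note ch = charted_all(3)
  have id: "has_tangent_map MG MG id \<one>\<^bsub>G\<^esub> id" "has_tangent_map MG MG id g id"
    using has_tangent_map_id[OF ch] points_MG g by auto
  have "has_tangent_map MG MG ((\<lambda>h. inv\<^bsub>G\<^esub> g \<otimes>\<^bsub>G\<^esub> h) \<circ> (\<lambda>h. g \<otimes>\<^bsub>G\<^esub> h)) \<one>\<^bsub>G\<^esub> (\<l> \<circ> \<l>')"
    by (rule has_tangent_map_compose[OF ch ch l']) (use l g in simp)
  from has_tangent_map_unique[OF ch this id(1), of "points MG"] have "\<l> \<circ> \<l>' = id"
    using points_MG g openin_topspace[of "mtop MG"] by (simp add: m_assoc[symmetric])
  moreover have "has_tangent_map MG MG ((\<lambda>h. g \<otimes>\<^bsub>G\<^esub> h) \<circ> (\<lambda>h. inv\<^bsub>G\<^esub> g \<otimes>\<^bsub>G\<^esub> h)) g (\<l>' \<circ> \<l>)"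
    by (rule has_tangent_map_compose[OF ch ch l]) (use l' g in simp)
  from has_tangent_map_unique[OF ch this id(2), of "points MG"] have "\<l>' \<circ> \<l> = id"
    using points_MG g openin_topspace[of "mtop MG"] by (simp add: m_assoc[symmetric])
  ultimately show "bij \<l>" using o_bij by blast
qed

text \<open>Everything is read off from the bijection \<open>L\<close> of one trivialisation through
  \<open>x\<close>. The base component of \<open>L (v, w)\<close> is a bijective function of
  \<open>v\<close> alone, which gives surjectivity and shows that a vector of the kernel has
  \<open>v = 0\<close>, hence comes from the orbit map; injectivity of \<open>L\<close> passes to
  \<open>Q\<close>. Conversely \<open>\<pi>\<close> is constant along the orbit, so
  \<open>D \<circ> Q\<close> is 0.\<close>

lemma orbit_tangent_kernel:
  assumes x: "x \<in> points P"
  defines "D \<equiv> tangent_map P B \<pi> x" and "Q \<equiv> orbit_map_deriv G MG P act x"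
  shows "linear D" "surj D" "linear Q" "inj Q" "range Q = {v. D v = 0}"
proof -
  have \<pi>x: "\<pi> x \<in> points B" using \<pi>_continuous x by (auto simp: continuous_map_def)
  obtain U \<psi> where U: "\<pi> x \<in> U" and triv: "trivialisation U \<psi>" using ex_trivialisation[OF \<pi>x] by blast
  have xU: "x \<in> {x \<in> points P. \<pi> x \<in> U}" using x U by simp
  define u g where "u = fst (\<psi>i U \<psi> x)" and "g = snd (\<psi>i U \<psi> x)"
  have ug: "u \<in> U" "g \<in> carrier G" "\<psi> (u, g) = x"
    using \<psi>i_mem[OF triv xU] \<psi>_\<psi>i[OF triv xU] by (auto simp: u_def g_def mem_Times_iff)
  have "u \<in> points B" "g \<in> points MG" using ug U_subset[OF triv] points_MG by auto
  define d k where "d = chart_at B u" and "k = chart_at MG g"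
  have d: "d \<in> atlas B" "u \<in> fst d" and k: "k \<in> atlas MG" "g \<in> fst k"
    unfolding d_def k_def using chart_at_props[OF B \<open>u \<in> points B\<close>] chart_at_props[OF MG \<open>g \<in> points MG\<close>] by auto
  define y where "y = (snd d u, snd k g)"
  have y: "y \<in> (snd d ` (fst d \<inter> U)) \<times> (snd k ` fst k)" using d k ug by (auto simp: y_def)
  have inv: "chart_inv d (fst y) = u" "chart_inv k (snd y) = g"
    using chart_inv_left[OF B d] chart_inv_left[OF MG k] by (auto simp: y_def)
  have \<Psi>y: "\<Psi> \<psi> d k y = x" using inv ug by (simp add: \<Psi>_def[OF triv d(1) k(1)])
  let ?l = "maurer_cartan g"
  obtain L where L: "has_tangent_map model_manifold P (\<Psi> \<psi> d k) y L" "bij L"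
    "\<And>v w. D (L (v, w)) = chart_vector B d u v"
    "\<And>w. L (0, w) = Q (?l (chart_vector MG k g w))"
    using trivialisation_tangent[OF triv d(1) k(1) y] unfolding inv \<Psi>y D_def Q_def by blast
  have linL: "linear L" using L(1) by (rule has_tangent_map_linear)
  have cvd: "linear (chart_vector B d u)" "bij (chart_vector B d u)"
    using linear_chart_vector[OF B d] bij_chart_vector[OF B d] by auto
  have cvk: "linear (chart_vector MG k g)" "bij (chart_vector MG k g)"
    using linear_chart_vector[OF MG k] bij_chart_vector[OF MG k] by auto
  note l = left_mult_tangent_inverse[OF ug(2)]
  show D: "linear D" unfolding D_def using tangent_\<pi>[OF x] by (rule has_tangent_map_linear)
  show Q: "linear Q" unfolding Q_def using tangent_orbit[OF x] by (rule has_tangent_map_linear)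
  show "surj D"
  proof (rule surjI)
    fix b show "D (L (inv_into UNIV (chart_vector B d u) b, 0)) = b"
      using L(3) cvd(2) by (simp add: bij_is_surj surj_f_inv_f)
  qed
  have "Q v = 0 \<Longrightarrow> v = 0" for v
  proof -
    assume "Q v = 0"
    obtain w where w: "v = ?l (chart_vector MG k g w)"
      using l(2) cvk(2) by (metis bij_pointE)
    then have "L (0, w) = L 0" using L(4) \<open>Q v = 0\<close> linear_0[OF linL] by simp
    then have "w = 0" using L(2) by (simp add: bij_def inj_eq zero_prod_def)
    then show "v = 0" using w linear_0[OF l(1)] linear_0[OF cvk(1)] by simp
  qed
  then show "inj Q" using linear_injective_0[OF Q] by blast
  have "has_tangent_map P B \<pi> (act (x, \<one>\<^bsub>G\<^esub>)) D"
    using tangent_\<pi>[OF x] action_one[OF x] by (simp add: D_def)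
  from has_tangent_map_compose[OF charted_all(3,1) tangent_orbit[OF x] this]
  have "has_tangent_map MG B (\<pi> \<circ> (\<lambda>h. act (x, h))) \<one>\<^bsub>G\<^esub> (D \<circ> Q)" by (simp add: Q_def)
  moreover have "has_tangent_map MG B (\<lambda>_. u) \<one>\<^bsub>G\<^esub> (\<lambda>_. 0)"
    using one_MG \<open>u \<in> points B\<close> by (rule has_tangent_map_const)
  moreover have "(\<pi> \<circ> (\<lambda>h. act (x, h))) h = u" if "h \<in> points MG" for h
    using act_\<psi>[OF triv ug(1,2), of h] that points_MG \<pi>_\<psi>[OF triv ug(1), of "g \<otimes>\<^bsub>G\<^esub> h"] ug
      monoid.m_closed[OF group.is_monoid[OF group_G], of g h] by simp
  ultimately have DQ: "D \<circ> Q = (\<lambda>_. 0)"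
    by (rule has_tangent_map_unique[OF charted_all(3) _ _ openin_topspace one_MG])
  show "range Q = {v. D v = 0}"
  proof (intro equalityI subsetI)
    fix v assume "v \<in> range Q"
    then show "v \<in> {v. D v = 0}" using DQ by (auto simp: fun_eq_iff)
  next
    fix v assume v: "v \<in> {v. D v = 0}"
    obtain a w where aw: "v = L (a, w)" using L(2) by (metis bij_pointE surj_pair)
    then have "chart_vector B d u a = chart_vector B d u 0"
      using v L(3) linear_0[OF cvd(1)] by simp
    then have "a = 0" using cvd(2) by (simp add: bij_def inj_eq)
    then show "v \<in> range Q" using aw L(4) by simp
  qed
qed

section \<open>Volumes and orientations along the fibres\<close>

lemma orientations: "x \<in> points P \<Longrightarrow> orientation (\<epsilon>P x)" "b \<in> points B \<Longrightarrow> orientation (\<epsilon>B b)"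
  using orientation_P orientation_B by (auto simp: manifold_orientation_def)

lemma \<nu>_top: "g \<in> carrier G \<Longrightarrow> top_form (\<nu> g)"
  using biinvariant points_MG by (auto simp: biinvariant_volume_form_def smooth_top_form_def)

lemma \<nu>_left:
  assumes g: "g \<in> carrier G" and l: "length vs = dim (UNIV :: 'k set)"
  shows "\<nu> \<one>\<^bsub>G\<^esub> (map (maurer_cartan g) vs) = \<nu> g vs"
proof -
  interpret group G by (rule group_G)
  have "\<forall>a\<in>carrier G. \<nu> (a \<otimes>\<^bsub>G\<^esub> g) (map (tangent_map MG MG (\<lambda>h. a \<otimes>\<^bsub>G\<^esub> h) g) vs) = \<nu> g vs"
    using biinvariant g l by (simp add: biinvariant_volume_form_def)
  from bspec[OF this, of "inv\<^bsub>G\<^esub> g"] show ?thesis using g by simp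
qed

text \<open>In the decomposition of \<open>hP\<close> the base term vanishes on vectors tangent to
  the orbit, and on these vectors the connection form inverts the orbit map.\<close>

lemma orbit_isometric:
  assumes x: "x \<in> points P"
  defines "Q \<equiv> orbit_map_deriv G MG P act x"
  shows "hP x (Q a) (Q c) = hg x a c"
proof -
  note k = orbit_tangent_kernel[OF x, folded Q_def]
  have ipP: "inner_product (hP x)" using metric_P x by (simp add: riemannian_metric_def)
  have "\<pi> x \<in> points B" using \<pi>_continuous x by (auto simp: continuous_map_def)
  then have ipB: "inner_product (hB (\<pi> x))" using metric_B by (simp add: riemannian_metric_def)
  have "subspace (range Q)" using linear_subspace_image[OF k(3) subspace_UNIV] .
  then have th: "connection_form G MG P act hP x (Q a) = a" for a
    unfolding connection_form_def orbit_tangent_def Q_def[symmetric]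
    using orthogonal_projection_ident[OF ipP] k(4) by simp
  have D0: "tangent_map P B \<pi> x (Q a) = 0" for a using k(5) by blast
  show ?thesis
    using fibre x linear_0[OF ip_linear[OF ipB]]
    by (simp add: fibre_metric_def Let_def th D0)
qed

text \<open>The pointwise volume formula of a submersion is applied at \<open>p\<close> to the
  images under \<open>L\<close> of base vectors followed by group vectors. The equality of
  dimensions is a by-product of counting an adapted orthonormal basis; the change of variables into
  the model space of \<open>P\<close> relies on it.\<close>

lemma volume_product:
  assumes triv: "trivialisation U \<psi>" and d: "d \<in> atlas B" and k: "k \<in> atlas MG"
    and y: "y \<in> (snd d ` (fst d \<inter> U)) \<times> (snd k ` fst k)"
    and L: "\<And>v w. tangent_map P B \<pi> (\<Psi> \<psi> d k y) (L (v, w)) = chart_vector B d (chart_inv d (fst y)) v"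
      "\<And>w. L (0, w) = orbit_map_deriv G MG P act (\<Psi> \<psi> d k y)
        (maurer_cartan (chart_inv k (snd y))
          (chart_vector MG k (chart_inv k (snd y)) w))"
    and vs: "length vs = dim (UNIV :: 'f set)" and ws: "length ws = dim (UNIV :: 'k set)"
  shows "\<bar>\<mu>P (\<Psi> \<psi> d k y) (map L (prod_basis vs ws))\<bar> =
    \<bar>\<mu>B (chart_inv d (fst y)) (map (chart_vector B d (chart_inv d (fst y))) vs)\<bar> *
    (V (chart_inv d (fst y)) * \<bar>\<nu> (chart_inv k (snd y)) (map (chart_vector MG k (chart_inv k (snd y))) ws)\<bar>)"
    and "dim (UNIV :: ('f \<times> 'k) set) = dim (UNIV :: 'e set)"
proof -
  define p u g where "p = \<Psi> \<psi> d k y" and "u = chart_inv d (fst y)" and "g = chart_inv k (snd y)"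
  have inv: "u \<in> fst d" "u \<in> U" "g \<in> fst k" using dom_inv[OF triv d k y] by (auto simp: u_def g_def)
  have g: "g \<in> carrier G" using k_subset[OF triv d k] inv(3) by blast
  have p: "p \<in> points P" "\<pi> p = u"
    using \<Psi>_mem[OF triv d k y] \<pi>_\<psi>[OF triv inv(2) g] by (auto simp: p_def \<Psi>_def[OF triv d k] u_def g_def)
  have u: "u \<in> points B" using U_subset[OF triv] inv(2) by blast
  let ?D = "tangent_map P B \<pi> p" and ?Q = "orbit_map_deriv G MG P act p"
  let ?l = "maurer_cartan g"
  note kk = orbit_tangent_kernel[OF p(1)]
  have ip: "inner_product (hP p)" "inner_product (hB u)" "inner_product (hg p)"
    using metric_P metric_B fibre p u by (auto simp: riemannian_metric_def fibre_metric_def)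
  have ev: "euclidean_volume_form (hP p) (\<epsilon>P p) (\<mu>P p)" "euclidean_volume_form (hB u) (\<epsilon>B u) (\<mu>B u)"
    "euclidean_volume_form (hg p) \<epsilon>g (\<mu>g p)"
    using volume_P volume_B volume_g p u by (auto simp: riemannian_volume_form_def)
  have sub: "hB u (?D a) (?D b) = hP p a b"
    if "a \<in> orthogonal_complement (hP p) {v. ?D v = 0}" "b \<in> orthogonal_complement (hP p) {v. ?D v = 0}" for a b
    using submersion p(1) that unfolding riemannian_submersion_def Let_def p(2)[symmetric] by blast
  have tops: "top_form (\<mu>P p)" "top_form (\<mu>B u)" "top_form (\<mu>g p)"
    using ev by (auto simp: euclidean_volume_form_def)
  have unit: "\<bar>\<mu>P p es\<bar> = 1" if "orthonormal_basis (hP p) es" for es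
    using euclidean_volume_form_abs[OF ip(1) orientations(1)[OF p(1)] ev(1) that] .
  have unit2: "\<bar>\<mu>B u es\<bar> = 1" if "orthonormal_basis (hB u) es" for es
    using euclidean_volume_form_abs[OF ip(2) orientations(2)[OF u] ev(2) that] .
  have unit3: "\<bar>\<mu>g p es\<bar> = 1" if "orthonormal_basis (hg p) es" for es
    using euclidean_volume_form_abs[OF ip(3) orientation_g ev(3) that] .
  note sv = submersion_volume[OF ip manifold_basis[OF P] manifold_basis[OF B] manifold_basis[OF MG] kk(1,2,3,5)]
  have dims: "dim (UNIV :: 'f set) + dim (UNIV :: 'k set) = dim (UNIV :: 'e set)"
    by (rule sv(1)) (rule sub orbit_isometric[OF p(1)] tops unit unit2 unit3; assumption)+
  have "length (prod_basis (model_basis :: 'f list) (model_basis :: 'k list)) = dim (UNIV :: ('f \<times> 'k) set)"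
    by (rule ordered_basis_length[OF ordered_basis_prod[OF manifold_basis[OF B] manifold_basis[OF MG]]])
  then show "dim (UNIV :: ('f \<times> 'k) set) = dim (UNIV :: 'e set)"
    using dims ordered_basis_length[OF manifold_basis[OF B]] ordered_basis_length[OF manifold_basis[OF MG]]
    by (simp add: prod_basis_def)
  let ?us = "map (\<lambda>v. L (v, 0)) vs" and ?ws = "map ?l (map (chart_vector MG k g) ws)"
  have split: "map L (prod_basis vs ws) = ?us @ map ?Q ?ws"
    using L(2) by (simp add: prod_basis_def o_def p_def g_def)
  have "\<bar>\<mu>P p (?us @ map ?Q ?ws)\<bar> = \<bar>\<mu>B u (map ?D ?us)\<bar> * \<bar>\<mu>g p ?ws\<bar>"
    by (rule sv(2)) (rule sub orbit_isometric[OF p(1)] tops unit unit2 unit3; assumption | simp add: vs ws)+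
  moreover have "map ?D ?us = map (chart_vector B d u) vs"
    using L(1) by (simp add: o_def p_def u_def)
  moreover have "\<bar>\<mu>g p ?ws\<bar> = V u * \<bar>\<nu> g (map (chart_vector MG k g) ws)\<bar>"
    using V_volume[OF p(1), of ?ws] \<nu>_left[OF g, of "map (chart_vector MG k g) ws"] ws V_pos[OF u] p(2)
    by (simp add: abs_mult[symmetric] abs_mult)
      (metis abs_mult abs_of_pos)
  ultimately show "\<bar>\<mu>P (\<Psi> \<psi> d k y) (map L (prod_basis vs ws))\<bar> =
    \<bar>\<mu>B (chart_inv d (fst y)) (map (chart_vector B d (chart_inv d (fst y))) vs)\<bar> *
    (V (chart_inv d (fst y)) * \<bar>\<nu> (chart_inv k (snd y)) (map (chart_vector MG k (chart_inv k (snd y))) ws)\<bar>)"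
    by (simp only: split p_def u_def g_def)
qed

text \<open>By left invariance \<open>V (\<pi> x) * \<nu> g vs\<close> is the volume form
  \<open>\<mu>g x\<close> on the translated vectors, and \<open>V\<close> is positive; so
  \<open>\<nu>\<close> has the sign given by the translated orientation. The point \<open>x\<close>
  serves only to provide a Euclidean structure on the Lie algebra, and any point of \<open>P\<close>
  will do.\<close>

lemma \<nu>_orientation:
  assumes x: "x \<in> points P" and g: "g \<in> carrier G" and vs: "ordered_basis UNIV vs"
  shows "left_invariant_orientation G MG \<epsilon>g g vs * \<nu> g vs = \<bar>\<nu> g vs\<bar>"
proof -
  let ?l = "maurer_cartan g"
  have len: "length vs = dim (UNIV :: 'k set)" by (rule ordered_basis_length[OF vs])
  have b: "ordered_basis UNIV (map ?l vs)" using left_mult_tangent_inverse[OF g] vs by (intro ordered_basis_map)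
  have ip: "inner_product (hg x)" using fibre x by (simp add: fibre_metric_def)
  have "\<pi> x \<in> points B" using \<pi>_continuous x by (auto simp: continuous_map_def)
  then have V: "V (\<pi> x) > 0" by (rule V_pos)
  have "V (\<pi> x) * \<nu> g vs = \<mu>g x (map ?l vs)"
    using V_volume[OF x, of "map ?l vs"] \<nu>_left[OF g len] len by simp
  moreover have "\<epsilon>g (map ?l vs) * \<mu>g x (map ?l vs) = \<bar>\<mu>g x (map ?l vs)\<bar>"
    by (rule orientation_volume_form(1)[OF ip orientation_g volume_g[OF x] b])
  ultimately have "\<epsilon>g (map ?l vs) * (V (\<pi> x) * \<nu> g vs) = \<bar>V (\<pi> x) * \<nu> g vs\<bar>" by simp
  then have "V (\<pi> x) * (\<epsilon>g (map ?l vs) * \<nu> g vs) = V (\<pi> x) * \<bar>\<nu> g vs\<bar>"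
    using V by (simp add: abs_mult mult_ac)
  then show ?thesis using V by (simp add: left_invariant_orientation_def)
qed

lemma signed_density_\<nu>:
  assumes x: "x \<in> points P"
  shows "signed_density MG (\<lambda>g vs. left_invariant_orientation G MG \<epsilon>g g vs * \<nu> g vs)" (is "signed_density MG ?w")
proof -
  have "continuous_on (snd k ` fst k) (frame_density MG k ?w)" if k: "k \<in> atlas MG" for k
  proof -
    have "smooth_on (\<lambda>y. \<nu> (chart_inv k y) (map (chart_vector MG k (chart_inv k y)) model_basis)) (snd k ` fst k)"
      using biinvariant k ordered_basis_length[OF manifold_basis[OF MG]]
      by (simp add: biinvariant_volume_form_def smooth_top_form_def Let_def)
    then have "continuous_on (snd k ` fst k) (\<lambda>y. \<bar>\<nu> (chart_inv k y) (map (chart_vector MG k (chart_inv k y)) model_basis)\<bar>)"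
      by (intro continuous_on_rabs smooth_on_continuous_on)
    moreover have "frame_density MG k ?w y = \<bar>\<nu> (chart_inv k y) (map (chart_vector MG k (chart_inv k y)) model_basis)\<bar>"
      if "y \<in> snd k ` fst k" for y
      unfolding frame_density_def
      using chart_inv_mem[OF MG k that] chart_subset[OF MG k] points_MG
      by (intro \<nu>_orientation[OF x] ordered_basis_frame[OF MG k] manifold_basis[OF MG]) auto
    ultimately show ?thesis by (simp cong: continuous_on_cong)
  qed
  moreover have "\<exists>a \<eta>. top_form \<eta> \<and> (\<forall>vs. ordered_basis UNIV vs \<longrightarrow> ?w g vs = a * \<bar>\<eta> vs\<bar>)" if "g \<in> points MG" for g
    using \<nu>_orientation[OF x, of g] \<nu>_top[of g] that points_MG by (intro exI[of _ 1] exI[of _ "\<nu> g"]) auto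
  ultimately show ?thesis by (simp add: signed_density_def)
qed

text \<open>Combines partition functions \<open>\<tau>\<close> of the total space,
  \<open>\<beta>\<close> of the base and \<open>\<sigma>\<close> of the group. The fibre coordinate
  has no meaning outside \<open>U\<close>, hence the explicit value 0 there.\<close>

definition fibre_cutoff where
  "fibre_cutoff U \<psi> \<beta> \<sigma> \<tau> x = (if \<pi> x \<in> U then \<tau> x * \<beta> (\<pi> x) * \<sigma> (snd (\<psi>i U \<psi> x)) else (0 :: real))"

context
  fixes f :: "'b \<Rightarrow> real"
  assumes f: "continuous_map (mtop B) euclideanreal f"
begin

abbreviation (input) "\<omega>P \<equiv> \<lambda>x vs. (f \<circ> \<pi>) x * \<mu>P x vs"
abbreviation (input) "\<omega>B \<equiv> \<lambda>b vs. f b * (V b * \<mu>B b vs)"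
abbreviation (input) "\<epsilon>G \<equiv> left_invariant_orientation G MG \<epsilon>g"
abbreviation (input) "wP \<equiv> \<lambda>x vs. \<epsilon>P x vs * \<omega>P x vs"
abbreviation (input) "wB \<equiv> \<lambda>b vs. \<epsilon>B b vs * \<omega>B b vs"
abbreviation (input) "wG \<equiv> \<lambda>g vs. \<epsilon>G g vs * \<nu> g vs"

lemma signed_density_P: "signed_density P wP"
  by (rule signed_density_riemannian[OF P metric_P orientations(1) volume_P continuous_map_compose[OF \<pi>_continuous f]])

lemma signed_density_B: "signed_density B wB"
  using signed_density_riemannian[OF B metric_B orientations(2) volume_B continuous_map_real_mult[OF f V_continuous]]
  by (simp only: mult.assoc)

context
  fixes x0 :: 'p
  assumes x0: "x0 \<in> points P"
begin

context
  fixes U \<psi> and d :: "('b, 'f) chart" and k :: "('g, 'k) chart"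
  assumes triv: "trivialisation U \<psi>" and d: "d \<in> atlas B" and k: "k \<in> atlas MG"
begin

abbreviation (input) "\<Phi> \<equiv> \<Psi> \<psi> d k"

lemma DK_preimage_open:
  assumes "openin (mtop P) W"
  shows "open {y \<in> (DK U d k). \<Phi> y \<in> W}"
proof -
  have "openin (top_of_set (DK U d k)) {y \<in> topspace (top_of_set (DK U d k)). \<Phi> y \<in> W}"
    using \<Psi>_continuous[OF triv d k] assms by (rule openin_continuous_map_preimage)
  then show ?thesis using dom_open[OF triv d k] openin_open_trans by simp blast
qed

text \<open>The derivative \<open>?A\<close> in the chart \<open>c\<close> and the tangent map
  \<open>L\<close> of the product coordinates differ by \<open>chart_vector P c p\<close>. The
  determinant of \<open>?A\<close> thus turns the density in the chart \<open>c\<close> into the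
  value on the frame \<open>map L ?pb\<close>, which splits into base and group factors.\<close>

lemma frame_density_product:
  assumes c: "c \<in> atlas P" and y: "y \<in> (DK U d k)" "\<Phi> y \<in> fst c"
  shows "\<bar>basis_det model_basis (map (frechet_derivative (snd c \<circ> \<Phi>) (at y)) (prod_basis model_basis model_basis))\<bar> *
      frame_density P c wP (snd c (\<Phi> y)) =
    frame_density B d wB (fst y) * frame_density MG k wG (snd y)"
    and "dim (UNIV :: ('f \<times> 'k) set) = dim (UNIV :: 'e set)"
proof -
  define p u g where "p = \<Phi> y" and "u = chart_inv d (fst y)" and "g = chart_inv k (snd y)"
  let ?A = "frechet_derivative (snd c \<circ> \<Phi>) (at y)"
  let ?pb = "prod_basis model_basis model_basis :: ('f \<times> 'k) list"
  have inv: "u \<in> fst d" "u \<in> U" "g \<in> fst k" using dom_inv[OF triv d k y(1)] by (auto simp: u_def g_def)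
  have g: "g \<in> carrier G" using k_subset[OF triv d k] inv(3) by blast
  have p: "p \<in> points P" "\<pi> p = u" "p \<in> fst c"
    using \<Psi>_mem[OF triv d k y(1)] \<pi>_\<psi>[OF triv inv(2) g] y(2) by (auto simp: p_def \<Psi>_def[OF triv d k] u_def g_def)
  have u: "u \<in> points B" using U_subset[OF triv] inv(2) by blast
  obtain L where L: "has_tangent_map model_manifold P \<Phi> y L" "bij L"
    "\<And>v w. tangent_map P B \<pi> (\<Phi> y) (L (v, w)) = chart_vector B d (chart_inv d (fst y)) v"
    "\<And>w. L (0, w) = orbit_map_deriv G MG P act (\<Phi> y)
        (maurer_cartan (chart_inv k (snd y))
          (chart_vector MG k (chart_inv k (snd y)) w))"
    using trivialisation_tangent[OF triv d k y(1)] by blast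
  have A: "(snd c \<circ> \<Phi> has_derivative ?A) (at y)"
    using \<Psi>_differentiable[OF triv d k c y] by (simp add: frechet_derivative_works)
  have "(snd (chart_at P (\<Phi> y)) \<circ> \<Phi> has_derivative chart_vector P c (\<Phi> y) \<circ> ?A) (at y)"
    by (rule has_derivative_chart_at[OF P c A DK_preimage_open[OF chart_open(1)[OF P c]]]) (use y in auto)
  moreover have "(snd (chart_at P (\<Phi> y)) \<circ> \<Phi> has_derivative L) (at y)"
    using L(1) by (simp add: has_tangent_map_def)
  ultimately have LA: "L = chart_vector P c p \<circ> ?A"
    unfolding p_def using has_derivative_unique by blast
  have linL: "linear L" using L(1) by (rule has_tangent_map_linear)
  have cp: "chart_inv c (snd c p) = p" using chart_inv_left[OF P c p(3)] .
  have pb: "ordered_basis UNIV ?pb" by (rule ordered_basis_prod[OF manifold_basis[OF B] manifold_basis[OF MG]])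
  have Lb: "ordered_basis UNIV (map L ?pb)" by (rule ordered_basis_map[OF pb linL L(2)])
  have ip: "inner_product (hP p)" "inner_product (hB u)"
    using metric_P metric_B p u by (auto simp: riemannian_metric_def)
  have ev: "euclidean_volume_form (hP p) (\<epsilon>P p) (\<mu>P p)" "euclidean_volume_form (hB u) (\<epsilon>B u) (\<mu>B u)"
    using volume_P volume_B p u by (auto simp: riemannian_volume_form_def)
  have fB: "ordered_basis UNIV (map (chart_vector B d u) model_basis)"
    by (rule ordered_basis_frame[OF B d inv(1) manifold_basis[OF B]])
  have fG: "ordered_basis UNIV (map (chart_vector MG k g) model_basis)"
    by (rule ordered_basis_frame[OF MG k inv(3) manifold_basis[OF MG]])
  have "\<bar>basis_det model_basis (map ?A ?pb)\<bar> * frame_density P c wP (snd c p) = wP p (map L ?pb)"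
    using frame_density_linear[OF P signed_density_P c, of "snd c p" ?A ?pb] p(3) Lb
      has_derivative_linear[OF A] unfolding cp LA by simp
  also have "\<dots> = f u * \<bar>\<mu>P p (map L ?pb)\<bar>"
    using orientation_volume_form(1)[OF ip(1) orientations(1)[OF p(1)] ev(1) Lb] p(2)
    by (simp add: mult.left_commute)
  also have "\<dots> = f u * (\<bar>\<mu>B u (map (chart_vector B d u) model_basis)\<bar> *
      (V u * \<bar>\<nu> g (map (chart_vector MG k g) model_basis)\<bar>))"
    using volume_product(1)[OF triv d k y(1) L(3,4), of model_basis model_basis]
      ordered_basis_length[OF manifold_basis[OF B]] ordered_basis_length[OF manifold_basis[OF MG]]
    by (simp add: p_def u_def g_def)
  also have "\<dots> = wB u (map (chart_vector B d u) model_basis) * wG g (map (chart_vector MG k g) model_basis)"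
    unfolding \<nu>_orientation[OF x0 g fG] orientation_volume_form(1)[OF ip(2) orientations(2)[OF u] ev(2) fB, symmetric]
    by (simp add: mult_ac)
  finally show "\<bar>basis_det model_basis (map ?A ?pb)\<bar> * frame_density P c wP (snd c (\<Phi> y)) =
    frame_density B d wB (fst y) * frame_density MG k wG (snd y)"
    by (simp only: frame_density_def p_def u_def g_def)
  show "dim (UNIV :: ('f \<times> 'k) set) = dim (UNIV :: 'e set)"
    by (rule volume_product(2)[OF triv d k y(1) L(3,4)])
      (use ordered_basis_length[OF manifold_basis[OF B]] ordered_basis_length[OF manifold_basis[OF MG]] in auto)
qed

section \<open>One piece of the integral: a chart of the total space against a product of
  charts\<close>

context
  fixes \<beta> :: "'b \<Rightarrow> real" and \<sigma> :: "'g \<Rightarrow> real"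
  assumes \<beta>: "supported_in B (fst d \<inter> U) \<beta>" and \<sigma>: "supported_in MG (fst k) \<sigma>"
    and \<sigma>1: "\<And>g. g \<in> carrier G \<Longrightarrow> \<bar>\<sigma> g\<bar> \<le> 1"
begin

abbreviation (input) "cutoff \<equiv> fibre_cutoff U \<psi> \<beta> \<sigma>"

abbreviation (input) "u0 \<equiv> \<lambda>y. if y \<in> snd d ` (fst d \<inter> U) then \<beta> (chart_inv d y) * frame_density B d wB y else 0"
abbreviation (input) "v0 \<equiv> \<lambda>y. if y \<in> snd k ` fst k then \<sigma> (chart_inv k y) * frame_density MG k wG y else 0"

lemma base_integral: "u0 \<in> borel_measurable borel"
    "chart_integral B \<epsilon>B d (\<lambda>b vs. \<beta> b * \<omega>B b vs) = integral\<^sup>L (basis_lborel model_basis) u0"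
proof -
  have "continuous_map (subtopology (mtop B) U) euclideanreal \<beta>"
    using \<beta> by (simp add: supported_in_def continuous_map_from_subtopology)
  from chart_integral_supported[OF B signed_density_B d U_open[OF triv] this]
  show "u0 \<in> borel_measurable borel"
    "chart_integral B \<epsilon>B d (\<lambda>b vs. \<beta> b * \<omega>B b vs) = integral\<^sup>L (basis_lborel model_basis) u0"
    using supported_in_zero[OF \<beta>] by auto
qed

lemma group_integral: "v0 \<in> borel_measurable borel"
    "chart_integral MG \<epsilon>G k (\<lambda>g vs. \<sigma> g * \<nu> g vs) = integral\<^sup>L (basis_lborel model_basis) v0"
proof -
  have "continuous_map (subtopology (mtop MG) (points MG)) euclideanreal \<sigma>"
    using \<sigma> by (simp add: supported_in_def)
  moreover have "fst k \<inter> points MG = fst k" using chart_subset[OF MG k] by blast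
  ultimately show "v0 \<in> borel_measurable borel"
    "chart_integral MG \<epsilon>G k (\<lambda>g vs. \<sigma> g * \<nu> g vs) = integral\<^sup>L (basis_lborel model_basis) v0"
    using chart_integral_supported[OF MG signed_density_\<nu>[OF x0] k openin_topspace, of \<sigma>] by auto
qed

context
  fixes c :: "('p, 'e) chart" and \<tau> :: "'p \<Rightarrow> real"
  assumes c: "c \<in> atlas P" and \<tau>: "supported_in P (fst c) \<tau>"
begin

abbreviation (input) "G0 \<equiv> \<lambda>z. if z \<in> snd c ` (fst c \<inter> (PU U)) then cutoff \<tau> (chart_inv c z) * frame_density P c wP z else 0"

lemma cutoff_measurable: "G0 \<in> borel_measurable borel"
proof -
  have "continuous_map (subtopology (mtop P) (PU U)) (mtop MG) (snd \<circ> \<psi>i U \<psi>)"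
    using \<psi>i_continuous[OF triv] by (simp add: continuous_map_pairwise)
  then have "continuous_map (subtopology (mtop P) (PU U)) euclideanreal (\<sigma> \<circ> (snd \<circ> \<psi>i U \<psi>))"
    using \<sigma> unfolding supported_in_def by (blast intro: continuous_map_compose)
  moreover have "continuous_map (subtopology (mtop P) (PU U)) euclideanreal (\<beta> \<circ> \<pi>)"
    using \<beta> \<pi>_continuous
    by (intro continuous_map_from_subtopology continuous_map_compose[of _ "mtop B"]) (auto simp: supported_in_def)
  moreover have "continuous_map (subtopology (mtop P) (PU U)) euclideanreal \<tau>"
    using \<tau> by (simp add: supported_in_def continuous_map_from_subtopology)
  ultimately have "continuous_map (subtopology (mtop P) (PU U)) euclideanreal (\<lambda>x. \<tau> x * \<beta> (\<pi> x) * \<sigma> (snd (\<psi>i U \<psi> x)))"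
    by (intro continuous_map_real_mult) (auto simp: o_def)
  then have "continuous_map (subtopology (mtop P) (PU U)) euclideanreal (cutoff \<tau>)"
    by (rule continuous_map_eq) (simp add: fibre_cutoff_def)
  from chart_integral_supported(1)[OF P signed_density_P c PU_open[OF triv] this]
  show ?thesis by (auto simp: fibre_cutoff_def)
qed

text \<open>The factor \<open>\<sigma>\<close> is bounded by 1, so the integrand is dominated by the
  one without it. That one is continuous with compact support in the chart \<open>c\<close>, whereas
  continuity of the cutoff across the boundary of the trivialised part has not been
  established.\<close>

lemma cutoff_integrable: "integrable (basis_lborel model_basis) G0"
proof (rule Bochner_Integration.integrable_bound)
  have "continuous_map (mtop P) euclideanreal (\<beta> \<circ> \<pi>)"
    using \<beta> \<pi>_continuous by (intro continuous_map_compose[of _ "mtop B"]) (auto simp: supported_in_def)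
  then have "supported_in P (fst c) (\<lambda>x. \<tau> x * (\<beta> \<circ> \<pi>) x)" by (rule supported_in_mult[OF \<tau>])
  then show "integrable (basis_lborel model_basis)
      (\<lambda>z. if z \<in> snd c ` fst c then \<tau> (chart_inv c z) * (\<beta> \<circ> \<pi>) (chart_inv c z) * frame_density P c wP z else 0)"
    by (rule integrable_chart[OF P signed_density_P compact_P c])
  show "G0 \<in> borel_measurable (basis_lborel model_basis)" using cutoff_measurable by simp
  have "norm (G0 z) \<le> norm (if z \<in> snd c ` fst c then \<tau> (chart_inv c z) * (\<beta> \<circ> \<pi>) (chart_inv c z) * frame_density P c wP z else 0)" for z
  proof (cases "z \<in> snd c ` (fst c \<inter> (PU U))")
    case True
    let ?x = "chart_inv c z"
    have x: "?x \<in> (PU U)" "z \<in> snd c ` fst c" using True chart_image_iff[OF P c, of "fst c \<inter> (PU U)"] by auto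
    have "\<bar>\<sigma> (snd (\<psi>i U \<psi> ?x))\<bar> \<le> 1" using \<psi>i_mem[OF triv x(1)] by (intro \<sigma>1) auto
    then have "\<bar>\<tau> ?x * \<beta> (\<pi> ?x) * frame_density P c wP z\<bar> * \<bar>\<sigma> (snd (\<psi>i U \<psi> ?x))\<bar> \<le>
        \<bar>\<tau> ?x * \<beta> (\<pi> ?x) * frame_density P c wP z\<bar>" by (intro mult_left_le) auto
    then show ?thesis using True x by (simp add: fibre_cutoff_def abs_mult mult_ac)
  qed simp
  then show "AE z in basis_lborel model_basis. norm (G0 z) \<le>
      norm (if z \<in> snd c ` fst c then \<tau> (chart_inv c z) * (\<beta> \<circ> \<pi>) (chart_inv c z) * frame_density P c wP z else 0)"
    by simp
qed

text \<open>Each support condition accounts for one boundary: \<open>\<beta>\<close> forces the base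
  point into the chart \<open>d\<close>, \<open>\<sigma>\<close> forces the fibre coordinate into
  the chart \<open>k\<close>, and \<open>\<tau>\<close> forces \<open>\<Phi> y\<close> into the
  chart \<open>c\<close>. So neither integrand has a contribution outside the region where both
  coordinate systems are defined.\<close>

lemma cutoff_change_of_variables:
  defines "H \<equiv> \<lambda>y. if y \<in> (DK U d k) then \<tau> (\<Phi> y) * (u0 (fst y) * v0 (snd y)) else 0"
  shows "integrable (basis_lborel (prod_basis model_basis model_basis)) H"
    and "integral\<^sup>L (basis_lborel (prod_basis model_basis model_basis)) H = integral\<^sup>L (basis_lborel model_basis) G0"
proof -
  let ?S = "{y \<in> (DK U d k). \<Phi> y \<in> fst c}"
  have \<tau>0: "\<tau> x = 0" if "x \<in> points P" "x \<notin> fst c" for x using supported_in_zero[OF \<tau> that] .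
  have mem: "\<Phi> y \<in> (PU U)" if "y \<in> (DK U d k)" for y using \<Psi>_mem[OF triv d k that] .
  have inv: "\<psi>i U \<psi> (\<Phi> y) = (chart_inv d (fst y), chart_inv k (snd y))" "\<pi> (\<Phi> y) = chart_inv d (fst y)" if "y \<in> (DK U d k)" for y
    using dom_inv[OF triv d k that] k_subset[OF triv d k] \<psi>i_\<psi>[OF triv] \<pi>_\<psi>[OF triv]
    by (auto simp: \<Psi>_def[OF triv d k])
  have H0: "H y = 0" if "y \<notin> ?S" for y using that \<tau>0 mem by (auto simp: H_def)
  have inj: "inj_on (snd c \<circ> \<Phi>) ?S"
  proof (rule inj_onI)
    fix y y' assume yy: "y \<in> ?S" "y' \<in> ?S" "(snd c \<circ> \<Phi>) y = (snd c \<circ> \<Phi>) y'"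
    then have "\<Phi> y = \<Phi> y'" using chart_inj[OF P c] by (auto simp: inj_on_def)
    then have "chart_inv d (fst y) = chart_inv d (fst y')" "chart_inv k (snd y) = chart_inv k (snd y')"
      using inv(1)[of y] inv(1)[of y'] yy by auto
    moreover have yD: "y \<in> (DK U d k)" "y' \<in> (DK U d k)" using yy by blast+
    ultimately have "fst y = fst y'" "snd y = snd y'"
      using dom_inv(2,4)[OF triv d k yD(1)] dom_inv(2,4)[OF triv d k yD(2)] by metis+
    then show "y = y'" by (rule prod_eqI)
  qed
  have mH: "H \<in> borel_measurable borel"
  proof -
    have "continuous_map (top_of_set (DK U d k)) euclideanreal (\<tau> \<circ> \<Phi>)"
      using \<Psi>_continuous[OF triv d k] \<tau> by (intro continuous_map_compose) (auto simp: supported_in_def)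
    then have c1: "continuous_on (DK U d k) (\<lambda>y. \<tau> (\<Phi> y))" by (simp add: o_def)
    have "continuous_on (snd d ` (fst d \<inter> U)) (\<beta> \<circ> chart_inv d)"
      by (rule continuous_on_chart[OF B d]) (use \<beta> in \<open>auto simp: supported_in_def continuous_map_from_subtopology\<close>)
    moreover have "continuous_on (snd d ` (fst d \<inter> U)) (frame_density B d wB)"
      by (rule continuous_on_frame_density[OF B signed_density_B d]) auto
    ultimately have "continuous_on (snd d ` (fst d \<inter> U)) (\<lambda>y. \<beta> (chart_inv d y) * frame_density B d wB y)"
      by (intro continuous_on_mult) (auto simp: o_def)
    from continuous_on_compose2[OF this continuous_on_fst[OF continuous_on_id], of "DK U d k"]
    have c2: "continuous_on (DK U d k) (\<lambda>y. \<beta> (chart_inv d (fst y)) * frame_density B d wB (fst y))" by auto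
    have "continuous_on (snd k ` fst k) (\<sigma> \<circ> chart_inv k)"
      by (rule continuous_on_chart[OF MG k, of "fst k"]) (use \<sigma> in \<open>auto simp: supported_in_def continuous_map_from_subtopology\<close>)
    moreover have "continuous_on (snd k ` fst k) (frame_density MG k wG)"
      by (rule continuous_on_frame_density[OF MG signed_density_\<nu>[OF x0] k]) auto
    ultimately have "continuous_on (snd k ` fst k) (\<lambda>y. \<sigma> (chart_inv k y) * frame_density MG k wG y)"
      by (intro continuous_on_mult) (auto simp: o_def)
    from continuous_on_compose2[OF this continuous_on_snd[OF continuous_on_id], of "DK U d k"]
    have c3: "continuous_on (DK U d k) (\<lambda>y. \<sigma> (chart_inv k (snd y)) * frame_density MG k wG (snd y))" by auto
    have "continuous_on (DK U d k) (\<lambda>y. \<tau> (\<Phi> y) * (u0 (fst y) * v0 (snd y)))"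
      using continuous_on_mult[OF c1 continuous_on_mult[OF c2 c3]]
      by (rule continuous_on_eq) auto
    then show ?thesis
      unfolding H_def using dom_open[OF triv d k] by (intro borel_measurable_continuous_cutoff) auto
  qed
  have GH: "H y = \<bar>basis_det model_basis (map (frechet_derivative (snd c \<circ> \<Phi>) (at y)) (prod_basis model_basis model_basis))\<bar> *
      G0 ((snd c \<circ> \<Phi>) y)" if y: "y \<in> ?S" for y
  proof -
    have yD: "y \<in> (DK U d k)" "\<Phi> y \<in> fst c" using y by auto
    have "snd c (\<Phi> y) \<in> snd c ` (fst c \<inter> (PU U))" using yD mem[OF yD(1)] by blast
    then have "G0 ((snd c \<circ> \<Phi>) y) = cutoff \<tau> (\<Phi> y) * frame_density P c wP (snd c (\<Phi> y))"
      using chart_inv_left[OF P c yD(2)] by simp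
    moreover have "cutoff \<tau> (\<Phi> y) = \<tau> (\<Phi> y) * \<beta> (chart_inv d (fst y)) * \<sigma> (chart_inv k (snd y))"
      using inv[OF yD(1)] mem[OF yD(1)] by (simp add: fibre_cutoff_def)
    moreover have "H y = \<tau> (\<Phi> y) * \<beta> (chart_inv d (fst y)) * \<sigma> (chart_inv k (snd y)) *
        (frame_density B d wB (fst y) * frame_density MG k wG (snd y))"
      using yD(1) by (auto simp: H_def mult_ac)
    ultimately show ?thesis
      unfolding frame_density_product(1)[OF c yD, symmetric] by (simp only: mult_ac)
  qed
  have Gz: "G0 z = 0" if z: "z \<notin> (snd c \<circ> \<Phi>) ` ?S" for z
  proof (rule ccontr)
    assume nz: "G0 z \<noteq> 0"
    then have zc: "z \<in> snd c ` (fst c \<inter> (PU U))" by (auto split: if_splits)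
    define x where "x = chart_inv c z"
    have x: "x \<in> fst c" "x \<in> (PU U)" "snd c x = z"
      using zc chart_image_iff[OF P c, of "fst c \<inter> (PU U)"] chart_inv_right[OF P c, of z] by (auto simp: x_def)
    have "cutoff \<tau> x \<noteq> 0" using nz zc by (auto simp: x_def)
    then have nz2: "\<beta> (\<pi> x) \<noteq> 0" "\<sigma> (snd (\<psi>i U \<psi> x)) \<noteq> 0" by (auto simp: fibre_cutoff_def split: if_splits)
    define u g where "u = fst (\<psi>i U \<psi> x)" and "g = snd (\<psi>i U \<psi> x)"
    have ug: "u \<in> U" "g \<in> carrier G" "\<psi> (u, g) = x"
      using \<psi>i_mem[OF triv x(2)] \<psi>_\<psi>i[OF triv x(2)] by (auto simp: u_def g_def mem_Times_iff)
    have "\<pi> x = u" using \<pi>_\<psi>[OF triv ug(1,2)] ug(3) by simp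
    then have ud: "u \<in> fst d" using supported_in_zero[OF \<beta>, of u] nz2 U_subset[OF triv] ug(1) by auto
    have gk: "g \<in> fst k" using supported_in_zero[OF \<sigma>, of g] nz2 ug(2) points_MG by (auto simp: g_def)
    have "\<Phi> (snd d u, snd k g) = x"
      using chart_inv_left[OF B d ud] chart_inv_left[OF MG k gk] ug(3) by (simp add: \<Psi>_def[OF triv d k])
    then have "(snd d u, snd k g) \<in> ?S" "(snd c \<circ> \<Phi>) (snd d u, snd k g) = z" using x ud gk ug by auto
    then have "z \<in> (snd c \<circ> \<Phi>) ` ?S" by (intro image_eqI[OF sym])
    then show False using z by contradiction
  qed
  let ?N = "basis_lborel (prod_basis model_basis model_basis)" and ?M = "basis_lborel model_basis"
  have "(integrable ?N H \<longleftrightarrow> integrable ?M G0) \<and>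
    integral\<^sup>L ?N H = integral\<^sup>L ?M G0"
  \<comment> \<open>The equality of dimensions needed for the change of variables is obtained at a
    point of \<open>?S\<close>, so the empty case, where both integrands vanish, is
    separated.\<close>
  proof (cases "?S = {}")
    case True
    have "G0 z = 0" for z by (rule Gz) (simp only: True image_empty empty_iff not_False_eq_True)
    then have "G0 = (\<lambda>_. 0)" by (rule ext)
    moreover have "H y = 0" for y by (rule H0) (simp only: True empty_iff not_False_eq_True)
    then have "H = (\<lambda>_. 0)" by (rule ext)
    ultimately show ?thesis by simp
  next
    case False
    then obtain y where "y \<in> (DK U d k)" "\<Phi> y \<in> fst c" by blast
    note dim = frame_density_product(2)[OF c this]
    have der: "(snd c \<circ> \<Phi> has_derivative frechet_derivative (snd c \<circ> \<Phi>) (at y)) (at y)" if "y \<in> ?S" for y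
      using \<Psi>_differentiable[OF triv d k c] that by (simp add: frechet_derivative_works)
    have "?S \<in> sets borel" using DK_preimage_open[OF chart_open(1)[OF P c]] by simp
    from basis_lborel_change_of_variables[OF manifold_basis[OF P]
        ordered_basis_prod[OF manifold_basis[OF B] manifold_basis[OF MG]] dim this der inj
        cutoff_measurable Gz mH H0 GH]
    show ?thesis by blast
  qed
  then show "integrable ?N H" and "integral\<^sup>L ?N H = integral\<^sup>L ?M G0"
    using cutoff_integrable by auto
qed

end

text \<open>A single factor \<open>\<tau> i (\<Phi> y)\<close> does not separate into base and group
  variables. Summing over \<open>i\<close> before applying Fubini's theorem removes it, and the
  integrability of \<open>u0 (fst y) * v0 (snd y)\<close> is inherited from the summands.\<close>

lemma sum_cutoff_integral:
  fixes m :: nat and c :: "nat \<Rightarrow> ('p, 'e) chart" and \<tau> :: "nat \<Rightarrow> 'p \<Rightarrow> real"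
  assumes c: "\<And>i. i < m \<Longrightarrow> c i \<in> atlas P" and \<tau>: "\<And>i. i < m \<Longrightarrow> supported_in P (fst (c i)) (\<tau> i)"
    and s: "\<And>x. x \<in> points P \<Longrightarrow> (\<Sum>i<m. \<tau> i x) = 1"
  shows "(\<Sum>i<m. integral\<^sup>L (basis_lborel model_basis)
      (\<lambda>z. if z \<in> snd (c i) ` (fst (c i) \<inter> (PU U)) then cutoff (\<tau> i) (chart_inv (c i) z) * frame_density P (c i) wP z else 0)) =
    chart_integral B \<epsilon>B d (\<lambda>b vs. \<beta> b * \<omega>B b vs) * chart_integral MG \<epsilon>G k (\<lambda>g vs. \<sigma> g * \<nu> g vs)"
proof -
  let ?M = "basis_lborel (prod_basis model_basis model_basis) :: ('f \<times> 'k) measure"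
  let ?H = "\<lambda>i y. if y \<in> (DK U d k) then \<tau> i (\<Phi> y) * (u0 (fst y) * v0 (snd y)) else 0"
  have H: "integrable ?M (?H i)" if "i < m" for i
    using cutoff_change_of_variables(1)[OF c[OF that] \<tau>[OF that]] .
  have sum: "(\<Sum>i<m. ?H i y) = u0 (fst y) * v0 (snd y)" for y
  proof (cases "y \<in> (DK U d k)")
    case True
    then have "\<Phi> y \<in> points P" using \<Psi>_mem[OF triv d k] by blast
    then show ?thesis using True s[of "\<Phi> y"] by (simp add: sum_distrib_right[symmetric])
  next
    case False
    \<comment> \<open>Outside the product domain one of the two factors is 0 by definition.\<close>
    then show ?thesis by (auto simp: mem_Times_iff)
  qed
  have "integrable ?M (\<lambda>y. \<Sum>i<m. ?H i y)" using H by (intro Bochner_Integration.integrable_sum) auto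
  then have int: "integrable ?M (\<lambda>y. u0 (fst y) * v0 (snd y))" by (simp only: sum)
  have "(\<Sum>i<m. integral\<^sup>L (basis_lborel model_basis)
      (\<lambda>z. if z \<in> snd (c i) ` (fst (c i) \<inter> (PU U)) then cutoff (\<tau> i) (chart_inv (c i) z) * frame_density P (c i) wP z else 0)) =
    (\<Sum>i<m. integral\<^sup>L ?M (?H i))"
    by (rule sum.cong[OF refl], rule cutoff_change_of_variables(2)[symmetric]) (use c \<tau> in auto)
  also have "\<dots> = (LINT y|?M. (\<Sum>i<m. ?H i y))"
    using H by (intro Bochner_Integration.integral_sum[symmetric]) auto
  also have "\<dots> = (LINT y|?M. u0 (fst y) * v0 (snd y))" by (simp only: sum)
  also have "\<dots> = integral\<^sup>L (basis_lborel model_basis) u0 * integral\<^sup>L (basis_lborel model_basis) v0"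
    by (rule integral_basis_lborel_prod[OF manifold_basis[OF B] manifold_basis[OF MG] base_integral(1) group_integral(1) int])
  finally show ?thesis by (simp only: base_integral(2) group_integral(2))
qed

end

end

text \<open>The functions \<open>\<sigma> l\<close> sum to 1 along every fibre over
  \<open>U\<close>, so they may be inserted into the integral over \<open>P\<close>. Exchanging the
  sums adds up the charts of \<open>P\<close> for each fixed \<open>l\<close>, which is the form in
  which the product formula is available.\<close>

lemma fibre_integral:
  fixes m :: nat and c :: "nat \<Rightarrow> ('p, 'e) chart" and \<tau> :: "nat \<Rightarrow> 'p \<Rightarrow> real"
  assumes triv: "trivialisation U \<psi>" and d: "d \<in> atlas B" and \<beta>: "supported_in B (fst d \<inter> U) \<beta>"
    and c: "\<And>i. i < m \<Longrightarrow> c i \<in> atlas P" and \<tau>: "\<And>i. i < m \<Longrightarrow> supported_in P (fst (c i)) (\<tau> i)"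
    and s: "\<And>x. x \<in> points P \<Longrightarrow> (\<Sum>i<m. \<tau> i x) = 1"
  shows "(\<Sum>i<m. chart_integral P \<epsilon>P (c i) (\<lambda>x vs. (\<tau> i x * \<beta> (\<pi> x)) * \<omega>P x vs)) =
    chart_integral B \<epsilon>B d (\<lambda>b vs. \<beta> b * \<omega>B b vs)"
proof -
  \<comment> \<open>Uniqueness of the integral identifies the value attached to this partition with
    the normalisation 1; its charts and functions are the ones then used along the fibres.\<close>
  obtain I where I: "has_form_integral MG \<epsilon>G \<nu> I" using ex_has_form_integral[OF MG compact_G] by blast
  then have "I = 1"
    using form_integral_eq[OF MG signed_density_\<nu>[OF x0] compact_G I] normalised by simp
  obtain n :: nat and k and \<sigma> :: "nat \<Rightarrow> 'g \<Rightarrow> real" where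
    k: "\<And>l. l < n \<Longrightarrow> k l \<in> atlas MG" and \<sigma>: "\<And>l. l < n \<Longrightarrow> supported_in MG (fst (k l)) (\<sigma> l)"
    and pos: "\<And>l g. l < n \<Longrightarrow> g \<in> points MG \<Longrightarrow> 0 \<le> \<sigma> l g"
    and s\<sigma>: "\<And>g. g \<in> points MG \<Longrightarrow> (\<Sum>l<n. \<sigma> l g) = 1"
    and I': "I = (\<Sum>l<n. chart_integral MG \<epsilon>G (k l) (\<lambda>g vs. \<sigma> l g * \<nu> g vs))"
  proof (rule has_form_integralE[OF I], goal_cases)
    case (1 n k \<sigma>)
    from 1(1)[OF 1(2-6)] show ?case .
  qed
  have \<sigma>1: "\<bar>\<sigma> l g\<bar> \<le> 1" if "l < n" "g \<in> carrier G" for l g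
  proof -
    have "\<sigma> l g \<le> (\<Sum>l<n. \<sigma> l g)" using that pos points_MG by (intro member_le_sum) auto
    then show ?thesis using s\<sigma>[of g] pos[of l g] that points_MG by simp
  qed
  let ?G = "\<lambda>i l z. if z \<in> snd (c i) ` (fst (c i) \<inter> PU U)
    then fibre_cutoff U \<psi> \<beta> (\<sigma> l) (\<tau> i) (chart_inv (c i) z) * frame_density P (c i) wP z else 0"
  have "chart_integral P \<epsilon>P (c i) (\<lambda>x vs. (\<tau> i x * \<beta> (\<pi> x)) * \<omega>P x vs) =
      (\<Sum>l<n. integral\<^sup>L (basis_lborel model_basis) (?G i l))" if i: "i < m" for i
  proof -
    let ?\<rho> = "\<lambda>x. \<tau> i x * \<beta> (\<pi> x)"
    have "continuous_map (mtop P) euclideanreal (\<beta> \<circ> \<pi>)"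
      using \<beta> \<pi>_continuous by (intro continuous_map_compose[of _ "mtop B"]) (auto simp: supported_in_def)
    then have "continuous_map (mtop P) euclideanreal ?\<rho>"
      using \<tau>[OF i] by (intro continuous_map_real_mult) (auto simp: supported_in_def o_def)
    then have \<rho>: "continuous_map (subtopology (mtop P) (PU U)) euclideanreal ?\<rho>"
      by (rule continuous_map_from_subtopology)
    have "?\<rho> x = 0" if "x \<in> points P" "x \<notin> PU U" for x
    proof -
      have "\<pi> x \<in> points B" using \<pi>_continuous that(1) by (auto simp: continuous_map_def)
      then show ?thesis using supported_in_zero[OF \<beta>, of "\<pi> x"] that by simp
    qed
    from chart_integral_supported(2)[OF P signed_density_P c[OF i] PU_open[OF triv] \<rho> this]
    have "chart_integral P \<epsilon>P (c i) (\<lambda>x vs. ?\<rho> x * \<omega>P x vs) = integral\<^sup>L (basis_lborel model_basis)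
        (\<lambda>z. if z \<in> snd (c i) ` (fst (c i) \<inter> PU U) then ?\<rho> (chart_inv (c i) z) * frame_density P (c i) wP z else 0)" .
    also have "(\<lambda>z. if z \<in> snd (c i) ` (fst (c i) \<inter> PU U) then ?\<rho> (chart_inv (c i) z) * frame_density P (c i) wP z else 0) =
        (\<lambda>z. \<Sum>l<n. ?G i l z)"
    proof
      fix z
      show "(if z \<in> snd (c i) ` (fst (c i) \<inter> PU U) then ?\<rho> (chart_inv (c i) z) * frame_density P (c i) wP z else 0) =
        (\<Sum>l<n. ?G i l z)"
      proof (cases "z \<in> snd (c i) ` (fst (c i) \<inter> PU U)")
        case True
        let ?x = "chart_inv (c i) z"
        have x: "?x \<in> PU U" using True chart_image_iff[OF P c[OF i], of "fst (c i) \<inter> PU U"] by auto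
        have "snd (\<psi>i U \<psi> ?x) \<in> points MG"
          using \<psi>i_mem[OF triv x] by (simp only: mem_Times_iff points_MG)
        from s\<sigma>[OF this] have "?\<rho> ?x = (\<Sum>l<n. fibre_cutoff U \<psi> \<beta> (\<sigma> l) (\<tau> i) ?x)"
          using x by (simp add: fibre_cutoff_def flip: sum_distrib_left)
        then show ?thesis using True by (simp add: sum_distrib_right)
      qed simp
    qed
    also have "integral\<^sup>L (basis_lborel model_basis) (\<lambda>z. \<Sum>l<n. ?G i l z) =
        (\<Sum>l<n. integral\<^sup>L (basis_lborel model_basis) (?G i l))"
      using cutoff_integrable[OF triv d k \<beta> \<sigma> \<sigma>1 c[OF i] \<tau>[OF i]]
      by (intro Bochner_Integration.integral_sum) auto
    finally show ?thesis .
  qed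
  then have "(\<Sum>i<m. chart_integral P \<epsilon>P (c i) (\<lambda>x vs. (\<tau> i x * \<beta> (\<pi> x)) * \<omega>P x vs)) =
      (\<Sum>i<m. \<Sum>l<n. integral\<^sup>L (basis_lborel model_basis) (?G i l))"
    by simp
  also have "\<dots> = (\<Sum>l<n. \<Sum>i<m. integral\<^sup>L (basis_lborel model_basis) (?G i l))"
    by (rule sum.swap)
  also have "\<dots> = (\<Sum>l<n. chart_integral B \<epsilon>B d (\<lambda>b vs. \<beta> b * \<omega>B b vs) *
      chart_integral MG \<epsilon>G (k l) (\<lambda>g vs. \<sigma> l g * \<nu> g vs))"
    using sum_cutoff_integral[OF triv d k \<beta> \<sigma> \<sigma>1 c \<tau> s] by (intro sum.cong refl) auto
  also have "\<dots> = chart_integral B \<epsilon>B d (\<lambda>b vs. \<beta> b * \<omega>B b vs) * I"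
    by (simp add: I' sum_distrib_left)
  finally show ?thesis by (simp add: \<open>I = 1\<close>)
qed

end

section \<open>From one trivialising set to the whole base\<close>

lemma \<pi>_surj:
  assumes b: "b \<in> points B"
  shows "\<exists>x\<in>points P. \<pi> x = b"
proof -
  obtain U \<psi> where U: "b \<in> U" and triv: "trivialisation U \<psi>" using ex_trivialisation[OF b] by blast
  have one: "\<one>\<^bsub>G\<^esub> \<in> carrier G" using one_MG points_MG by simp
  show ?thesis using \<psi>_mem[OF triv U one] \<pi>_\<psi>[OF triv U one] by blast
qed

text \<open>Compactness is inherited as the base is a continuous image of \<open>P\<close>; the
  partition of unity on \<open>B\<close> and the uniqueness of the integral over \<open>B\<close>
  rest on it.\<close>

lemma compact_B: "compact_space (mtop B)"
proof -
  have "compactin (mtop B) (\<pi> ` points P)"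
    using compact_P \<pi>_continuous by (intro image_compactin) (simp_all add: compact_space_def)
  moreover have "\<pi> ` points P = points B"
    using \<pi>_surj \<pi>_continuous by (auto simp: continuous_map_def image_iff)
  ultimately show ?thesis by (simp add: compact_space_def)
qed

theorem form_integral_bundle: "form_integral P \<epsilon>P \<omega>P = form_integral B \<epsilon>B \<omega>B"
proof (cases "points P = {}")
  case True
  then have "points B = {}" using \<pi>_surj by blast
  \<comment> \<open>With no point of \<open>P\<close> at hand the sign of \<open>\<nu>\<close>
    cannot be determined. The empty partition settles this case, both integrals being 0.\<close>
  have "has_form_integral P \<epsilon>P \<omega>P 0"
    unfolding has_form_integral_iff by (intro exI[of _ "0::nat"]) (simp add: True)
  moreover have "has_form_integral B \<epsilon>B \<omega>B 0"
    unfolding has_form_integral_iff by (intro exI[of _ "0::nat"]) (simp add: \<open>points B = {}\<close>)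
  ultimately show ?thesis
    using form_integral_eq[OF P signed_density_P compact_P] form_integral_eq[OF B signed_density_B compact_B] by simp
next
  case False
  then obtain x0 where x0: "x0 \<in> points P" by blast
  \<comment> \<open>A member of the cover has to lie in a chart and in a trivialising set at once,
    since the fibre integral needs \<open>\<beta>\<close> supported in both.\<close>
  define \<U> where "\<U> = {fst d \<inter> U |d U. d \<in> atlas B \<and> (\<exists>\<psi>. trivialisation U \<psi>)}"
  have cov: "\<exists>W\<in>\<U>. openin (mtop B) W \<and> b \<in> W" if b: "b \<in> points B" for b
  proof -
    obtain U \<psi> where U: "b \<in> U" "trivialisation U \<psi>" using ex_trivialisation[OF b] by blast
    obtain d where d: "d \<in> atlas B" "b \<in> fst d" using manifold_chart_ex[OF B b] by blast
    have "fst d \<inter> U \<in> \<U>" unfolding \<U>_def using U d by (intro CollectI exI[of _ d] exI[of _ U]) blast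
    moreover have "openin (mtop B) (fst d \<inter> U)"
      using chart_open(1)[OF B d(1)] U_open[OF U(2)] by (rule openin_Int)
    ultimately show ?thesis using U d by blast
  qed
  obtain n :: nat and W and \<beta> :: "nat \<Rightarrow> 'b \<Rightarrow> real" where
    W: "\<And>j. j < n \<Longrightarrow> W j \<in> \<U>" and \<beta>: "\<And>j. j < n \<Longrightarrow> continuous_map (mtop B) euclideanreal (\<beta> j)"
    and pos: "\<And>j b. j < n \<Longrightarrow> b \<in> points B \<Longrightarrow> 0 \<le> \<beta> j b"
    and supp: "\<And>j. j < n \<Longrightarrow> mtop B closure_of {b \<in> points B. \<beta> j b \<noteq> 0} \<subseteq> W j"
    and s\<beta>: "\<And>b. b \<in> points B \<Longrightarrow> (\<Sum>j<n. \<beta> j b) = 1"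
    using partition_of_unity[OF compact_B manifold_Hausdorff[OF B] cov] by blast
  have "\<exists>d U. j < n \<longrightarrow> W j = fst d \<inter> U \<and> d \<in> atlas B \<and> (\<exists>\<psi>. trivialisation U \<psi>)" for j
    using W[of j] unfolding \<U>_def by blast
  then obtain d U where "\<And>j. j < n \<longrightarrow> W j = fst (d j) \<inter> U j \<and> d j \<in> atlas B \<and> (\<exists>\<psi>. trivialisation (U j) \<psi>)"
    by metis
  then have d: "W j = fst (d j) \<inter> U j" "d j \<in> atlas B" "\<exists>\<psi>. trivialisation (U j) \<psi>" if "j < n" for j
    using that by blast+
  have sup: "supported_in B (fst (d j) \<inter> U j) (\<beta> j)" if "j < n" for j
    using \<beta>[OF that] supp[OF that] d(1)[OF that] by (simp add: supported_in_def)
  have intB: "has_form_integral B \<epsilon>B \<omega>B (\<Sum>j<n. chart_integral B \<epsilon>B (d j) (\<lambda>b vs. \<beta> j b * \<omega>B b vs))"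
    unfolding has_form_integral_iff
    by (rule exI[of _ n], rule exI[of _ d], rule exI[of _ \<beta>])
      (use sup pos s\<beta> d(2) in \<open>auto simp: supported_in_def\<close>)
  obtain I where I: "has_form_integral P \<epsilon>P \<omega>P I" using ex_has_form_integral[OF P compact_P] by blast
  obtain m :: nat and c and \<tau> :: "nat \<Rightarrow> 'p \<Rightarrow> real" where
    c: "\<And>i. i < m \<Longrightarrow> c i \<in> atlas P" and \<tau>: "\<And>i. i < m \<Longrightarrow> supported_in P (fst (c i)) (\<tau> i)"
    and "\<And>i x. i < m \<Longrightarrow> x \<in> points P \<Longrightarrow> 0 \<le> \<tau> i x"
    and s\<tau>: "\<And>x. x \<in> points P \<Longrightarrow> (\<Sum>i<m. \<tau> i x) = 1"
    and I': "I = (\<Sum>i<m. chart_integral P \<epsilon>P (c i) (\<lambda>x vs. \<tau> i x * \<omega>P x vs))"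
  proof (rule has_form_integralE[OF I], goal_cases)
    case (1 m c \<tau>)
    from 1(1)[OF 1(2-6)] show ?case .
  qed
  have \<beta>\<pi>: "continuous_map (mtop P) euclideanreal (\<lambda>x. \<beta> j (\<pi> x))" if "j < n" for j
    using continuous_map_compose[OF \<pi>_continuous \<beta>[OF that]] by (simp add: o_def)
  have s\<beta>\<pi>: "(\<Sum>j<n. \<beta> j (\<pi> x)) = 1" if "x \<in> points P" for x
    using s\<beta>[of "\<pi> x"] \<pi>_continuous that by (auto simp: continuous_map_def)
  have "I = (\<Sum>i<m. \<Sum>j<n. chart_integral P \<epsilon>P (c i) (\<lambda>x vs. (\<tau> i x * \<beta> j (\<pi> x)) * \<omega>P x vs))"
    unfolding I'
    by (intro sum.cong refl chart_integral_sum[OF P signed_density_P compact_P]) (use c \<tau> \<beta>\<pi> s\<beta>\<pi> in auto)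
  also have "\<dots> = (\<Sum>j<n. \<Sum>i<m. chart_integral P \<epsilon>P (c i) (\<lambda>x vs. (\<tau> i x * \<beta> j (\<pi> x)) * \<omega>P x vs))"
    by (rule sum.swap)
  also have "\<dots> = (\<Sum>j<n. chart_integral B \<epsilon>B (d j) (\<lambda>b vs. \<beta> j b * \<omega>B b vs))"
  proof (intro sum.cong refl)
    fix j assume "j \<in> {..<n}"
    then have j: "j < n" by simp
    obtain \<psi> where "trivialisation (U j) \<psi>" using d(3)[OF j] by blast
    from fibre_integral[OF x0 this d(2)[OF j] sup[OF j] c \<tau> s\<tau>]
    show "(\<Sum>i<m. chart_integral P \<epsilon>P (c i) (\<lambda>x vs. (\<tau> i x * \<beta> j (\<pi> x)) * \<omega>P x vs)) =
        chart_integral B \<epsilon>B (d j) (\<lambda>b vs. \<beta> j b * \<omega>B b vs)" by blast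
  qed
  \<comment> \<open>The same number \<open>I\<close> is a value of the integral for both forms, and
    uniqueness on either side finishes the proof.\<close>
  finally have "has_form_integral B \<epsilon>B \<omega>B I" using intB by simp
  then show ?thesis
    using form_integral_eq[OF P signed_density_P compact_P I] form_integral_eq[OF B signed_density_B compact_B] by simp
qed

end

end

theorem proposition3p11:
  fixes G :: "'g monoid"
    and MG :: "('g, 'k::real_normed_vector) manifold"
    and P :: "('p, 'e::real_normed_vector) manifold"
    and B :: "('b, 'f::real_normed_vector) manifold"
    and \<pi> :: "'p \<Rightarrow> 'b"
    and act :: "'p \<times> 'g \<Rightarrow> 'p"
    and hP :: "'p \<Rightarrow> 'e \<Rightarrow> 'e \<Rightarrow> real"
    and hB :: "'b \<Rightarrow> 'f \<Rightarrow> 'f \<Rightarrow> real"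
    and \<epsilon>P \<mu>P :: "'p \<Rightarrow> 'e list \<Rightarrow> real"
    and \<epsilon>B \<mu>B :: "'b \<Rightarrow> 'f list \<Rightarrow> real"
    and V f :: "'b \<Rightarrow> real"
  assumes "principal_bundle G MG P B \<pi> act"
    and "compact_space (mtop MG)" and "connected_space (mtop MG)"
    and "compact_space (mtop P)" and "connected_space (mtop P)"
    and "manifold_orientation P \<epsilon>P" and "manifold_orientation B \<epsilon>B"
    and "riemannian_metric P hP" and "invariant_metric G P act hP"
    and "riemannian_volume_form P hP \<epsilon>P \<mu>P"
    and "riemannian_metric B hB" and "riemannian_submersion P B hP hB \<pi>"
    and "riemannian_volume_form B hB \<epsilon>B \<mu>B"
    and "smooth_function B V" and "\<forall>b\<in>points B. V b > 0"
    and "orbit_volume_function G MG P B \<pi> act hP hB \<epsilon>P \<epsilon>B V"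
    and "smooth_function B f"
  shows "form_integral P \<epsilon>P (\<lambda>x vs. (f \<circ> \<pi>) x * \<mu>P x vs) =
         form_integral B \<epsilon>B (\<lambda>b vs. f b * (V b * \<mu>B b vs))"
proof -
  obtain hg \<epsilon>g \<mu>g \<nu> where *: "fibre_metric G MG P B \<pi> act hP hB hg"
    "lie_algebra_orientation G MG P B \<pi> act hP \<epsilon>P \<epsilon>B \<epsilon>g"
    "\<forall>x\<in>points P. euclidean_volume_form (hg x) \<epsilon>g (\<mu>g x)" "biinvariant_volume_form G MG \<nu>"
    "form_integral MG (left_invariant_orientation G MG \<epsilon>g) \<nu> = 1"
    "\<forall>x\<in>points P. \<forall>vs. length vs = dim (UNIV :: 'k set) \<longrightarrow> V (\<pi> x) * \<nu> \<one>\<^bsub>G\<^esub> vs = \<mu>g x vs"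
    using assms(16) unfolding orbit_volume_function_def by blast
  have orientation_g: "orientation \<epsilon>g" using *(2) by (simp add: lie_algebra_orientation_def)
  have cont: "continuous_map (mtop B) euclideanreal V" "continuous_map (mtop B) euclideanreal f"
    using assms(14,17) by (simp_all add: smooth_map_def model_manifold_def)
  interpret riemannian_principal_bundle G MG P B \<pi> act hP hB \<epsilon>P \<mu>P \<epsilon>B \<mu>B V hg \<epsilon>g \<mu>g \<nu>
    by (rule riemannian_principal_bundle.intro)
      (rule assms cont(1) assms(15)[rule_format] * orientation_g *(3)[rule_format] *(6)[rule_format]; assumption)+
  show ?thesis by (rule form_integral_bundle[OF cont(2)])
qed

end
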